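(* Let $\otimes$ be a continuous t-norm on $[0,1]$. The dualising object $([0,1]^{\mathrm{op}},[0,1])$ induces a natural dual adjunction $C\dashv G$ with $$C:\mathsf{PosComp}\to\mathsf{LaxMon}_\ominus([0,1]\text{-}\mathsf{FinSup})^{\mathrm{op}},\qquad G:\mathsf{LaxMon}_\ominus([0,1]\text{-}\mathsf{FinSup})^{\mathrm{op}}\to\mathsf{PosComp}.$$ Here $CX$ is given by $\mathsf{PosComp}(X,[0,1]^{\mathrm{op}})$ with all operations defined pointwise, and $GA$ is the space $\mathsf{LaxMon}_\ominus([0,1]\text{-}\mathsf{FinSup})(A,[0,1])$ equipped with the initial topology with respect to all evaluation maps $$\mathrm{ev}_a:\mathsf{LaxMon}_\ominus([0,1]\text{-}\mathsf{FinSup})(A,[0,1])\to[0,1]^{\mathrm{op}},\ \Phi\mapsto\Phi(a)\qquad(a\in A).$$ Furthermore, $C$ extends along the canonical functor $\mathsf{PosComp}\to\mathsf{PosCompDist}$ (into the Kleisli category of the Vietoris monad $\mathbb{V}$) to a functor $$C:\mathsf{PosCompDist}\to\mathsf{LaxMon}_\ominus([0,1]\text{-}\mathsf{FinSup})^{\mathrm{op}},\qquad C\varphi(\psi)(x)=\sup\{\psi(y)\mid x\,\varphi\,y\},$$ (that is, the evident triangle of functors commutes), and the induced monad morphism $j$ between $\mathbb{V}$ and the monad induced by $C\dashv G$, with components $j_X:VX\to GCX$, $A\mapsto(\psi\mapsto\sup_{x\in A}\psi(x))$, is an isomorphism. Therefore the functor $$C:\mathsf{PosCompDist}\longrightarrow\mathsf{LaxMon}_\ominus([0,1]\text{-}\mathsf{FinSup})^{\mathrm{op}}$$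 is fully faithful, and so is the functor $$C:\mathsf{PosComp}\longrightarrow\mathsf{Mon}_\ominus([0,1]\text{-}\mathsf{FinSup})^{\mathrm{op}}.$$
   Context: **Enriched categories.** A continuous t-norm is an associative commutative operation $\otimes$ on $[0,1]$ with neutral element $1$, preserving suprema in each variable and continuous for the Euclidean topology. $\hom(u,-)$ is the right adjoint of $u\otimes-$: $u\otimes v\le w\iff v\le\hom(u,w)$. Suprema of empty subsets of $[0,1]$ are $0$. A $[0,1]$-category is a set $X$ with a map $a:X\times X\to[0,1]$ with $a(x,x)=1$ and $a(x,y)\otimes a(y,z)\le a(x,z)$. A $[0,1]$-functor $f:(X,a)\to(Y,b)$ is a map with $a(x,y)\le b(f(x),f(y))$. The natural order is $x\le y\iff a(x,y)=1$; $(X,a)$ is separated if this order is anti-symmetric. A $u$-copower of $x$ is an element $x\otimes u$ with $a(x\otimes u,y)=\hom(u,a(x,y))$ for all $y$. $(X,a)$ is finitely cocomplete if it has all colimits of weighted diagrams with finite underlying set; equivalently, it has all copowers ($u\in[0,1]$), a bottom element, and all binary suprema in the natural order, with $a(x\vee y,z)=a(x,z)\wedge a(y,z)$ for all $z$. A map between finitely cocomplete $[0,1]$-categories is a finitely cocontinuous $[0,1]$-functor iff it is monotone and preserves copowers and binary suprema. $[0,1]\text{-}\mathsf{FinSup}$ is the category of separated finitely cocomplete $[0,1]$-categories and finitely cocontinuous $[0,1]$-functors. **Monoids.** $\mathsf{Mon}([0,1]\text{-}\mathsf{FinSup})$ and $\mathsf{LaxMon}([0,1]\text{-}\mathsf{FinSup})$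 have as objects the objects $X$ of $[0,1]\text{-}\mathsf{FinSup}$ with an associative commutative operation $\otimes:X\times X\to X$ whose unit is the top element $1$ of $X$, such that each $x\otimes-:X\to X$ is a finitely cocontinuous $[0,1]$-functor. Morphisms of $\mathsf{Mon}$ are the finitely cocontinuous $[0,1]$-functors preserving unit and multiplication; morphisms of $\mathsf{LaxMon}$ are the finitely cocontinuous $[0,1]$-functors with $f(x\otimes x')\le f(x)\otimes f(x')$. $\mathsf{Mon}_\ominus([0,1]\text{-}\mathsf{FinSup})$ and $\mathsf{LaxMon}_\ominus([0,1]\text{-}\mathsf{FinSup})$ are defined in the same way, but objects carry an additional action (a map) $\ominus:X\times[0,1]\to X$, no further axioms being listed, and morphisms preserve it: $f(x\ominus u)=f(x)\ominus u$. $([0,1],\hom)$ with $\otimes$ and truncated minus $u\ominus v=\max(u-v,0)$ is an object of both. **Spaces.** A partially ordered compact space is a compact space $X$ with a partial order closed in $X\times X$ (so $X$ is Hausdorff). $\mathsf{PosComp}$ is the category of these spaces and monotone continuous maps. $[0,1]^{\mathrm{op}}$ is $[0,1]$ with the Euclidean topology and dual order; so $CX$ is the set of continuous order-reversing maps $X\to[0,1]$, with pointwise $\vee$, $-\otimes u$, $\otimes$, $-\ominus u$, $0$, $1$. On morphisms, $Cf$ and $Gh$ are given by precomposition. $GA$ carries the initial structure from $[0,1]^{\mathrm{op}}$ (pointwise convergence, reversed pointwise order). "Induced by the dualising object" means that $|C|=\hom(-,[0,1]^{\mathrm{op}})$, $|G|=\hom(-,[0,1])$ and the units are the evaluation maps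 $X\to GCX$, $A\to CGA$. **Vietoris monad.** $VX$ is the set of closed upper subsets of $X$ (including $\varnothing$), ordered by $\supseteq$, with the topology generated by $\{A\mid A\cap U\ne\varnothing\}$ ($U$ open lower) and $\{A\mid A\cap K=\varnothing\}$ ($K$ closed lower). $Vf(A)$ is the smallest closed upper set containing $f[A]$; unit $x\mapsto\{y\mid y\ge x\}$, multiplication union. $\mathsf{PosCompDist}$ is the Kleisli category of $\mathbb{V}$: a morphism from $X$ to $Y$ is a relation $\varphi\subseteq X\times Y$ such that $x\mapsto\{y\mid x\,\varphi\,y\}$ is a morphism $X\to VY$ in $\mathsf{PosComp}$; composition is relational composition, identities are the order relations. The canonical functor sends $f$ to the relation $\{(x,y)\mid f(x)\le y\}$. *)

theory Defs
  imports "HOL-Analysis.Analysis"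
begin

text \<open>
  All structures are carrier-based, so that the objects of each category range over all carrier
  sets inside an arbitrary type.  Morphisms are extensional functions on the carrier
  (\<^const>\<open>PiE\<close>), so that equality of morphisms is equality in HOL; composition is
  \<^const>\<open>compose\<close> and the identity on \<open>S\<close> is \<open>\<lambda>x\<in>S. x\<close>.
\<close>

section \<open>The unit interval and continuous t-norms\<close>

text \<open>Infima and suprema in the complete lattice \<open>[0,1]\<close>; thus the empty supremum is \<open>0\<close>
  and the empty infimum is \<open>1\<close>.\<close>

definition sup01 :: "real set \<Rightarrow> real" where
  "sup01 S = Sup (insert 0 S)"

definition inf01 :: "real set \<Rightarrow> real" where
  "inf01 S = Inf (insert 1 S)"

definition continuous_tnorm :: "(real \<Rightarrow> real \<Rightarrow> real) \<Rightarrow> bool" where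
  "continuous_tnorm T \<longleftrightarrow>
     (\<forall>u\<in>{0..1}. \<forall>v\<in>{0..1}. T u v \<in> {0..1}) \<and>
     (\<forall>u\<in>{0..1}. \<forall>v\<in>{0..1}. \<forall>w\<in>{0..1}. T (T u v) w = T u (T v w)) \<and>
     (\<forall>u\<in>{0..1}. \<forall>v\<in>{0..1}. T u v = T v u) \<and>
     (\<forall>u\<in>{0..1}. T 1 u = u \<and> T u 1 = u) \<and>
     (\<forall>u\<in>{0..1}. \<forall>S\<subseteq>{0..1}. T u (sup01 S) = sup01 ((\<lambda>v. T u v) ` S)) \<and>
     (\<forall>u\<in>{0..1}. \<forall>S\<subseteq>{0..1}. T (sup01 S) u = sup01 ((\<lambda>v. T v u) ` S)) \<and>
     continuous_on ({0..1} \<times> {0..1}) (\<lambda>(u, v). T u v)"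

text \<open>The right adjoint \<open>hom(u,-)\<close> of \<open>T u\<close>; the adjunction itself is \<open>hom01_adjoint\<close> below.\<close>

definition hom01 :: "(real \<Rightarrow> real \<Rightarrow> real) \<Rightarrow> real \<Rightarrow> real \<Rightarrow> real" where
  "hom01 T u w = sup01 {v \<in> {0..1}. T u v \<le> w}"

lemma sup01_upper:
  assumes "S \<subseteq> {0..1}" "x \<in> S"
  shows "x \<le> sup01 S"
proof -
  have "bdd_above (insert 0 S)"
    by (rule bdd_above_mono[of "{0..1}"]) (use assms in auto)
  then show ?thesis
    unfolding sup01_def using assms(2) by (intro cSup_upper) simp_all
qed

lemma sup01_least:
  assumes "\<And>x. x \<in> S \<Longrightarrow> x \<le> w" "0 \<le> w"
  shows "sup01 S \<le> w"
proof -
  have "x \<le> w" if "x \<in> insert 0 S" for x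
    using that assms by (cases "x = 0") simp_all
  then show ?thesis
    unfolding sup01_def by (intro cSup_least) simp_all
qed

lemma hom01_adjoint:
  assumes T: "continuous_tnorm T" and u: "u \<in> {0..1}" and v: "v \<in> {0..1}" and w: "w \<in> {0..1}"
  shows "T u v \<le> w \<longleftrightarrow> v \<le> hom01 T u w"
proof
  assume "T u v \<le> w"
  then have mem: "v \<in> {v \<in> {0..1}. T u v \<le> w}" using v by simp
  have "{v \<in> {0..1}. T u v \<le> w} \<subseteq> {0..1}" by (rule Collect_restrict)
  from sup01_upper[OF this mem] show "v \<le> hom01 T u w"
    unfolding hom01_def .
next
  define S where "S = {v \<in> {0..1}. T u v \<le> w}"
  define h where "h = hom01 T u w"
  have hS: "h = sup01 S" by (simp add: h_def hom01_def S_def)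
  have sub: "S \<subseteq> {0..1}" unfolding S_def by blast
  assume "v \<le> hom01 T u w"
  then have le: "v \<le> h" by (simp add: h_def)
  have "h \<le> 1" unfolding hS by (rule sup01_least) (use sub in auto)
  then have h: "h \<in> {0..1}" using le v by simp
  have "\<forall>u\<in>{0..1}. \<forall>S\<subseteq>{0..1}. T u (sup01 S) = sup01 ((\<lambda>v. T u v) ` S)"
    using T unfolding continuous_tnorm_def by (elim conjE)
  from bspec[OF this u] have T_sup: "T u (sup01 S) = sup01 ((\<lambda>v. T u v) ` S)"
    if "S \<subseteq> {0..1}" for S using that by (elim allE impE)
  have "\<forall>u\<in>{0..1}. \<forall>v\<in>{0..1}. T u v \<in> {0..1}"
    using T unfolding continuous_tnorm_def by (elim conjE)
  from bspec[OF this u] have cl: "T u x \<in> {0..1}" if "x \<in> {0..1}" for x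
    using that by (rule bspec)
  have "T u h = sup01 ((\<lambda>v. T u v) ` S)"
    unfolding hS by (rule T_sup[OF sub])
  also have "\<dots> \<le> w"
  proof (rule sup01_least)
    show "x \<le> w" if "x \<in> (\<lambda>v. T u v) ` S" for x
      using that unfolding S_def by blast
  qed (use w in simp)
  finally have hw: "T u h \<le> w" .
  have "sup01 {v, h} = h"
  proof (rule antisym)
    show "sup01 {v, h} \<le> h" by (rule sup01_least) (use le h in auto)
    show "h \<le> sup01 {v, h}" by (rule sup01_upper) (use v h in auto)
  qed
  moreover have "T u (sup01 {v, h}) = sup01 ((\<lambda>v. T u v) ` {v, h})"
    by (rule T_sup) (use v h in simp)
  ultimately have "T u h = sup01 {T u v, T u h}" by simp
  moreover have "T u v \<le> sup01 {T u v, T u h}"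
  proof (rule sup01_upper)
    have "T u v \<in> {0..1}" "T u h \<in> {0..1}" by (rule cl[OF v], rule cl[OF h])
    then show "{T u v, T u h} \<subseteq> {0..1}" by simp
  qed simp
  ultimately show "T u v \<le> w" using hw by linarith
qed


section \<open>Categories enriched in the unit interval\<close>

record 'a ucat =
  pts :: "'a set"
  uhom :: "'a \<Rightarrow> 'a \<Rightarrow> real"

definition ucategory :: "(real \<Rightarrow> real \<Rightarrow> real) \<Rightarrow> ('a, 'm) ucat_scheme \<Rightarrow> bool" where
  "ucategory T A \<longleftrightarrow>
     (\<forall>x\<in>pts A. \<forall>y\<in>pts A. uhom A x y \<in> {0..1}) \<and>
     (\<forall>x\<in>pts A. uhom A x x = 1) \<and>
     (\<forall>x\<in>pts A. \<forall>y\<in>pts A. \<forall>z\<in>pts A. T (uhom A x y) (uhom A y z) \<le> uhom A x z)"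

definition ufunctor :: "('a, 'm) ucat_scheme \<Rightarrow> ('b, 'n) ucat_scheme \<Rightarrow> ('a \<Rightarrow> 'b) \<Rightarrow> bool" where
  "ufunctor A B f \<longleftrightarrow> f \<in> pts A \<rightarrow> pts B \<and>
     (\<forall>x\<in>pts A. \<forall>y\<in>pts A. uhom A x y \<le> uhom B (f x) (f y))"

definition nat_le :: "('a, 'm) ucat_scheme \<Rightarrow> 'a \<Rightarrow> 'a \<Rightarrow> bool" where
  "nat_le A x y \<longleftrightarrow> uhom A x y = 1"

definition useparated :: "('a, 'm) ucat_scheme \<Rightarrow> bool" where
  "useparated A \<longleftrightarrow> (\<forall>x\<in>pts A. \<forall>y\<in>pts A. nat_le A x y \<and> nat_le A y x \<longrightarrow> x = y)"

text \<open>A weighted diagram in \<open>A\<close> is a functor \<open>h\<close> from a category \<open>D\<close> to \<open>A\<close> together with a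
  weight, i.e. a distributor from \<open>D\<close> to the one-point category.  For finite diagrams it is no
  restriction to take the points of \<open>D\<close> among the natural numbers.\<close>

definition uweight :: "(real \<Rightarrow> real \<Rightarrow> real) \<Rightarrow> ('i, 'm) ucat_scheme \<Rightarrow> ('i \<Rightarrow> real) \<Rightarrow> bool" where
  "uweight T D w \<longleftrightarrow> (\<forall>i\<in>pts D. w i \<in> {0..1}) \<and>
     (\<forall>i\<in>pts D. \<forall>j\<in>pts D. T (uhom D i j) (w j) \<le> w i)"

definition fin_diagram ::
  "(real \<Rightarrow> real \<Rightarrow> real) \<Rightarrow> ('a, 'm) ucat_scheme \<Rightarrow> nat ucat \<Rightarrow> (nat \<Rightarrow> 'a) \<Rightarrow> (nat \<Rightarrow> real) \<Rightarrow> bool" where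
  "fin_diagram T A D h w \<longleftrightarrow>
     finite (pts D) \<and> ucategory T D \<and> ufunctor D A h \<and> uweight T D w"

definition is_colimit ::
  "(real \<Rightarrow> real \<Rightarrow> real) \<Rightarrow> ('a, 'm) ucat_scheme \<Rightarrow> nat ucat \<Rightarrow> (nat \<Rightarrow> 'a) \<Rightarrow> (nat \<Rightarrow> real) \<Rightarrow> 'a \<Rightarrow> bool" where
  "is_colimit T A D h w c \<longleftrightarrow> c \<in> pts A \<and>
     (\<forall>y\<in>pts A. uhom A c y = inf01 {hom01 T (w i) (uhom A (h i) y) | i. i \<in> pts D})"

definition fin_cocomplete :: "(real \<Rightarrow> real \<Rightarrow> real) \<Rightarrow> ('a, 'm) ucat_scheme \<Rightarrow> bool" where
  "fin_cocomplete T A \<longleftrightarrow> (\<forall>D h w. fin_diagram T A D h w \<longrightarrow> (\<exists>c. is_colimit T A D h w c))"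

definition fin_cocontinuous ::
  "(real \<Rightarrow> real \<Rightarrow> real) \<Rightarrow> ('a, 'm) ucat_scheme \<Rightarrow> ('b, 'n) ucat_scheme \<Rightarrow> ('a \<Rightarrow> 'b) \<Rightarrow> bool" where
  "fin_cocontinuous T A B f \<longleftrightarrow> ufunctor A B f \<and>
     (\<forall>D h w c. fin_diagram T A D h w \<and> is_colimit T A D h w c
        \<longrightarrow> is_colimit T B D (f \<circ> h) w (f c))"

definition finsup_obj :: "(real \<Rightarrow> real \<Rightarrow> real) \<Rightarrow> ('a, 'm) ucat_scheme \<Rightarrow> bool" where
  "finsup_obj T A \<longleftrightarrow> ucategory T A \<and> useparated A \<and> fin_cocomplete T A"

definition is_copower ::
  "(real \<Rightarrow> real \<Rightarrow> real) \<Rightarrow> ('a, 'm) ucat_scheme \<Rightarrow> 'a \<Rightarrow> real \<Rightarrow> 'a \<Rightarrow> bool" where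
  "is_copower T A x u c \<longleftrightarrow> c \<in> pts A \<and> (\<forall>y\<in>pts A. uhom A c y = hom01 T u (uhom A x y))"

definition is_binary_sup :: "('a, 'm) ucat_scheme \<Rightarrow> 'a \<Rightarrow> 'a \<Rightarrow> 'a \<Rightarrow> bool" where
  "is_binary_sup A x y s \<longleftrightarrow> s \<in> pts A \<and>
     (\<forall>z\<in>pts A. nat_le A s z \<longleftrightarrow> nat_le A x z \<and> nat_le A y z) \<and>
     (\<forall>z\<in>pts A. uhom A s z = min (uhom A x z) (uhom A y z))"

definition is_bottom :: "('a, 'm) ucat_scheme \<Rightarrow> 'a \<Rightarrow> bool" where
  "is_bottom A b \<longleftrightarrow> b \<in> pts A \<and> (\<forall>x\<in>pts A. nat_le A b x)"


section \<open>Monoids with an action of truncated minus\<close>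

record 'a umon = "'a ucat" +
  mul :: "'a \<Rightarrow> 'a \<Rightarrow> 'a"
  unt :: 'a

record 'a amon = "'a umon" +
  tminus :: "'a \<Rightarrow> real \<Rightarrow> 'a"

definition umon_obj :: "(real \<Rightarrow> real \<Rightarrow> real) \<Rightarrow> ('a, 'm) umon_scheme \<Rightarrow> bool" where
  "umon_obj T A \<longleftrightarrow> finsup_obj T A \<and>
     (\<forall>x\<in>pts A. \<forall>y\<in>pts A. mul A x y \<in> pts A) \<and>
     (\<forall>x\<in>pts A. \<forall>y\<in>pts A. \<forall>z\<in>pts A. mul A (mul A x y) z = mul A x (mul A y z)) \<and>
     (\<forall>x\<in>pts A. \<forall>y\<in>pts A. mul A x y = mul A y x) \<and>
     unt A \<in> pts A \<and> (\<forall>x\<in>pts A. nat_le A x (unt A)) \<and>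
     (\<forall>x\<in>pts A. mul A (unt A) x = x) \<and>
     (\<forall>x\<in>pts A. fin_cocontinuous T A A (mul A x))"

text \<open>The common objects of \<open>Mon\<close> and \<open>LaxMon\<close>, both with \<open>\<ominus>\<close>.\<close>

definition MonObj :: "(real \<Rightarrow> real \<Rightarrow> real) \<Rightarrow> 'a amon set" where
  "MonObj T = {A. umon_obj T A \<and> (\<forall>x\<in>pts A. \<forall>u\<in>{0..1}. tminus A x u \<in> pts A)}"

definition lax_hom :: "(real \<Rightarrow> real \<Rightarrow> real) \<Rightarrow> 'a amon \<Rightarrow> 'b amon \<Rightarrow> ('a \<Rightarrow> 'b) set" where
  "lax_hom T A B = {f \<in> pts A \<rightarrow>\<^sub>E pts B. fin_cocontinuous T A B f \<and>
     (\<forall>x\<in>pts A. \<forall>y\<in>pts A. nat_le B (f (mul A x y)) (mul B (f x) (f y))) \<and>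
     (\<forall>x\<in>pts A. \<forall>u\<in>{0..1}. f (tminus A x u) = tminus B (f x) u)}"

definition mon_hom :: "(real \<Rightarrow> real \<Rightarrow> real) \<Rightarrow> 'a amon \<Rightarrow> 'b amon \<Rightarrow> ('a \<Rightarrow> 'b) set" where
  "mon_hom T A B = {f \<in> pts A \<rightarrow>\<^sub>E pts B. fin_cocontinuous T A B f \<and>
     f (unt A) = unt B \<and>
     (\<forall>x\<in>pts A. \<forall>y\<in>pts A. f (mul A x y) = mul B (f x) (f y)) \<and>
     (\<forall>x\<in>pts A. \<forall>u\<in>{0..1}. f (tminus A x u) = tminus B (f x) u)}"

definition unit_mon :: "(real \<Rightarrow> real \<Rightarrow> real) \<Rightarrow> real amon" where
  "unit_mon T = \<lparr>pts = {0..1}, uhom = hom01 T, mul = T, unt = 1, tminus = (\<lambda>u v. max (u - v) 0)\<rparr>"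


section \<open>Partially ordered compact spaces\<close>

record 'a pospace =
  tp :: "'a topology"
  ple :: "('a \<times> 'a) set"

abbreviation sp :: "'a pospace \<Rightarrow> 'a set" where
  "sp X \<equiv> topspace (tp X)"

definition PosComp :: "'a pospace set" where
  "PosComp = {X. compact_space (tp X) \<and> partial_order_on (sp X) (ple X) \<and>
     closedin (prod_topology (tp X) (tp X)) (ple X)}"

definition pos_hom :: "'a pospace \<Rightarrow> 'b pospace \<Rightarrow> ('a \<Rightarrow> 'b) set" where
  "pos_hom X Y = {f \<in> sp X \<rightarrow>\<^sub>E sp Y. continuous_map (tp X) (tp Y) f \<and>
     (\<forall>(x, y)\<in>ple X. (f x, f y) \<in> ple Y)}"

definition unit_op :: "real pospace" where
  "unit_op = \<lparr>tp = top_of_set {0..1}, ple = {(u, v). u \<in> {0..1} \<and> v \<in> {0..1} \<and> v \<le> u}\<rparr>"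

definition is_pos_iso :: "'a pospace \<Rightarrow> 'b pospace \<Rightarrow> ('a \<Rightarrow> 'b) \<Rightarrow> bool" where
  "is_pos_iso X Y f \<longleftrightarrow> f \<in> pos_hom X Y \<and>
     (\<exists>g\<in>pos_hom Y X. compose (sp X) g f = (\<lambda>x\<in>sp X. x) \<and> compose (sp Y) f g = (\<lambda>y\<in>sp Y. y))"


section \<open>The functors induced by the dualising object\<close>

text \<open>The enriched structure of \<open>C X\<close> is the pointwise one: \<open>uhom \<psi> \<phi>\<close> is the largest \<open>u\<close> with
  \<open>\<psi>(x) \<otimes> u \<le> \<phi>(x)\<close> for all \<open>x\<close>.\<close>

definition C_obj :: "(real \<Rightarrow> real \<Rightarrow> real) \<Rightarrow> 'a pospace \<Rightarrow> ('a \<Rightarrow> real) amon" where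
  "C_obj T X = \<lparr>
     pts = pos_hom X unit_op,
     uhom = (\<lambda>\<psi> \<phi>. inf01 {hom01 T (\<psi> x) (\<phi> x) | x. x \<in> sp X}),
     mul = (\<lambda>\<psi> \<phi>. \<lambda>x\<in>sp X. T (\<psi> x) (\<phi> x)),
     unt = (\<lambda>x\<in>sp X. 1),
     tminus = (\<lambda>\<psi> u. \<lambda>x\<in>sp X. max (\<psi> x - u) 0)\<rparr>"

definition C_map :: "'a pospace \<Rightarrow> 'b pospace \<Rightarrow> ('a \<Rightarrow> 'b) \<Rightarrow> (('b \<Rightarrow> real) \<Rightarrow> ('a \<Rightarrow> real))" where
  "C_map X Y f = (\<lambda>\<psi>\<in>pos_hom Y unit_op. compose (sp X) \<psi> f)"

definition initial_topology :: "'p set \<Rightarrow> 'i set \<Rightarrow> 'q topology \<Rightarrow> ('i \<Rightarrow> 'p \<Rightarrow> 'q) \<Rightarrow> 'p topology" where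
  "initial_topology S I Y e = topology_generated_by
     (insert S {{p \<in> S. e i p \<in> U} | i U. i \<in> I \<and> openin Y U})"

definition G_obj :: "(real \<Rightarrow> real \<Rightarrow> real) \<Rightarrow> 'b amon \<Rightarrow> ('b \<Rightarrow> real) pospace" where
  "G_obj T A = \<lparr>
     tp = initial_topology (lax_hom T A (unit_mon T)) (pts A) (tp unit_op) (\<lambda>a \<Phi>. \<Phi> a),
     ple = {(\<Phi>, \<Phi>'). \<Phi> \<in> lax_hom T A (unit_mon T) \<and> \<Phi>' \<in> lax_hom T A (unit_mon T) \<and>
        (\<forall>a\<in>pts A. (\<Phi> a, \<Phi>' a) \<in> ple unit_op)}\<rparr>"

definition G_map ::
  "(real \<Rightarrow> real \<Rightarrow> real) \<Rightarrow> 'a amon \<Rightarrow> 'b amon \<Rightarrow> ('a \<Rightarrow> 'b) \<Rightarrow> (('b \<Rightarrow> real) \<Rightarrow> ('a \<Rightarrow> real))" where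
  "G_map T A B h = (\<lambda>\<Phi>\<in>lax_hom T B (unit_mon T). compose (pts A) \<Phi> h)"

definition ev_space :: "(real \<Rightarrow> real \<Rightarrow> real) \<Rightarrow> 'a pospace \<Rightarrow> ('a \<Rightarrow> (('a \<Rightarrow> real) \<Rightarrow> real))" where
  "ev_space T X = (\<lambda>x\<in>sp X. \<lambda>\<psi>\<in>pts (C_obj T X). \<psi> x)"

definition ev_mon :: "(real \<Rightarrow> real \<Rightarrow> real) \<Rightarrow> 'b amon \<Rightarrow> ('b \<Rightarrow> (('b \<Rightarrow> real) \<Rightarrow> real))" where
  "ev_mon T A = (\<lambda>a\<in>pts A. \<lambda>\<Phi>\<in>sp (G_obj T A). \<Phi> a)"


section \<open>The Vietoris monad and its Kleisli category\<close>

definition upper_in :: "'a pospace \<Rightarrow> 'a set \<Rightarrow> bool" where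
  "upper_in X A \<longleftrightarrow> A \<subseteq> sp X \<and> (\<forall>(x, y)\<in>ple X. x \<in> A \<longrightarrow> y \<in> A)"

definition lower_in :: "'a pospace \<Rightarrow> 'a set \<Rightarrow> bool" where
  "lower_in X A \<longleftrightarrow> A \<subseteq> sp X \<and> (\<forall>(x, y)\<in>ple X. y \<in> A \<longrightarrow> x \<in> A)"

definition closed_upper :: "'a pospace \<Rightarrow> 'a set set" where
  "closed_upper X = {A. closedin (tp X) A \<and> upper_in X A}"

definition V_obj :: "'a pospace \<Rightarrow> 'a set pospace" where
  "V_obj X = \<lparr>
     tp = topology_generated_by
       ({{A \<in> closed_upper X. A \<inter> U \<noteq> {}} | U. openin (tp X) U \<and> lower_in X U} \<union>
        {{A \<in> closed_upper X. A \<inter> K = {}} | K. closedin (tp X) K \<and> lower_in X K}),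
     ple = {(A, B). A \<in> closed_upper X \<and> B \<in> closed_upper X \<and> A \<supseteq> B}\<rparr>"

definition V_map :: "'a pospace \<Rightarrow> 'b pospace \<Rightarrow> ('a \<Rightarrow> 'b) \<Rightarrow> ('a set \<Rightarrow> 'b set)" where
  "V_map X Y f = (\<lambda>A\<in>closed_upper X. \<Inter>{B \<in> closed_upper Y. f ` A \<subseteq> B})"

definition V_unit :: "'a pospace \<Rightarrow> ('a \<Rightarrow> 'a set)" where
  "V_unit X = (\<lambda>x\<in>sp X. {y. (x, y) \<in> ple X})"

definition V_mult :: "'a pospace \<Rightarrow> ('a set set \<Rightarrow> 'a set)" where
  "V_mult X = (\<lambda>\<A>\<in>closed_upper (V_obj X). \<Union>\<A>)"

text \<open>In the Kleisli category the identity of \<open>X\<close> is \<^term>\<open>ple X\<close> and the composite of \<open>\<phi>\<close>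
  followed by \<open>\<theta>\<close> is \<^term>\<open>\<phi> O \<theta>\<close>.\<close>

definition dist_hom :: "'a pospace \<Rightarrow> 'b pospace \<Rightarrow> ('a \<times> 'b) set set" where
  "dist_hom X Y = {\<phi>. \<phi> \<subseteq> sp X \<times> sp Y \<and> (\<lambda>x\<in>sp X. {y. (x, y) \<in> \<phi>}) \<in> pos_hom X (V_obj Y)}"

definition dist_of :: "'a pospace \<Rightarrow> 'b pospace \<Rightarrow> ('a \<Rightarrow> 'b) \<Rightarrow> ('a \<times> 'b) set" where
  "dist_of X Y f = {(x, y). x \<in> sp X \<and> y \<in> sp Y \<and> (f x, y) \<in> ple Y}"

definition C_dist :: "'a pospace \<Rightarrow> 'b pospace \<Rightarrow> ('a \<times> 'b) set \<Rightarrow> (('b \<Rightarrow> real) \<Rightarrow> ('a \<Rightarrow> real))" where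
  "C_dist X Y \<phi> = (\<lambda>\<psi>\<in>pos_hom Y unit_op. \<lambda>x\<in>sp X. sup01 {\<psi> y | y. (x, y) \<in> \<phi>})"

text \<open>The counit at \<open>X\<close> of the Kleisli adjunction: the morphism from \<open>V X\<close> to \<open>X\<close> in the Kleisli
  category that corresponds to the identity map of \<open>V X\<close>.\<close>

definition V_counit :: "'a pospace \<Rightarrow> ('a set \<times> 'a) set" where
  "V_counit X = {(A, x). A \<in> closed_upper X \<and> x \<in> A}"

text \<open>The monad morphism induced by an extension of the left adjoint \<open>C\<close> to the Kleisli category:
  apply the extension to the counit of the Kleisli adjunction and transpose along \<open>C \<stileturn> G\<close>.\<close>

definition j_map :: "(real \<Rightarrow> real \<Rightarrow> real) \<Rightarrow> 'a pospace \<Rightarrow> ('a set \<Rightarrow> (('a \<Rightarrow> real) \<Rightarrow> real))" where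
  "j_map T X = compose (sp (V_obj X))
     (G_map T (C_obj T X) (C_obj T (V_obj X)) (C_dist (V_obj X) X (V_counit X)))
     (ev_space T (V_obj X))"

text \<open>The monad on \<open>PosComp\<close> induced by \<open>C \<stileturn> G\<close>; its unit is \<^const>\<open>ev_space\<close>.\<close>

definition GC_obj :: "(real \<Rightarrow> real \<Rightarrow> real) \<Rightarrow> 'a pospace \<Rightarrow> (('a \<Rightarrow> real) \<Rightarrow> real) pospace" where
  "GC_obj T X = G_obj T (C_obj T X)"

definition GC_map ::
  "(real \<Rightarrow> real \<Rightarrow> real) \<Rightarrow> 'a pospace \<Rightarrow> 'b pospace \<Rightarrow> ('a \<Rightarrow> 'b) \<Rightarrow>
   ((('a \<Rightarrow> real) \<Rightarrow> real) \<Rightarrow> (('b \<Rightarrow> real) \<Rightarrow> real))" where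
  "GC_map T X Y f = G_map T (C_obj T Y) (C_obj T X) (C_map X Y f)"

definition GC_mult ::
  "(real \<Rightarrow> real \<Rightarrow> real) \<Rightarrow> 'a pospace \<Rightarrow>
   ((((('a \<Rightarrow> real) \<Rightarrow> real) \<Rightarrow> real) \<Rightarrow> real) \<Rightarrow> (('a \<Rightarrow> real) \<Rightarrow> real))" where
  "GC_mult T X = G_map T (C_obj T X) (C_obj T (GC_obj T X)) (ev_mon T (C_obj T X))"

end

theory Submission
  imports Defs
begin

text \<open>
  Colimits in \<open>[0,1]\<close> and in \<open>C X\<close> are pointwise weighted suprema, so that a map into \<open>C X\<close> is a lax
  morphism iff its composites with all evaluations are; this gives \<open>C\<close>, \<open>G\<close>, the units, and the
  extension of \<open>C\<close> to distributors.  The spaces \<open>G A\<close> are compact because the conditions on a lax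
  functional are closed in a cube.

  The main point is that every lax functional \<open>\<Phi>\<close> on \<open>C X\<close> is \<open>\<psi> \<mapsto> sup\<^bsub>x \<in> A\<^esub> \<psi> x\<close>, where \<open>A\<close> is the set
  of common zeros of all \<open>\<rho>\<close> with \<open>\<Phi> \<rho> = 0\<close>.  The inequality \<open>\<psi> x \<le> \<Phi> \<psi>\<close> on \<open>A\<close> holds since
  \<open>\<Phi> (\<psi> \<ominus> \<Phi> \<psi>) = 0\<close>.  Conversely, if \<open>\<psi> < u\<close> on \<open>A\<close>, then by compactness a single \<open>\<rho>\<close> with
  \<open>\<Phi> \<rho> = 0\<close> is bounded below on \<open>{\<psi> \<ge> u}\<close>, and laxness forces the infimum of \<open>\<Phi> \<xi>\<close> over all \<open>\<xi>\<close>
  equal to \<open>1\<close> on that set to vanish; as \<open>\<psi> \<ominus> u\<close> is below each such \<open>\<xi>\<close>, it follows that \<open>\<Phi> \<psi> \<le> u\<close>.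
  With Nachbin's ordered Urysohn lemma the bijection \<open>A \<leftrightarrow> \<Phi>\<close> is an isomorphism \<open>V X \<cong> G (C X)\<close>, which also
  yields compactness of \<open>V X\<close>.  If \<open>\<Phi>\<close> preserves unit and multiplication, then \<open>A\<close> is principal.
\<close>

section \<open>Suprema, infima and the t-norm\<close>

text \<open>The obstacle in the representation is that a continuous t-norm may have zero divisors. A
  function \<open>\<xi>\<close> with \<open>T (\<xi> x) r \<le> \<rho> x\<close> and
  \<open>\<Phi> \<rho> = 0\<close> yields only \<open>T (\<Phi> \<xi>) r = 0\<close>, which for
  positive \<open>r\<close> does not force \<open>\<Phi> \<xi> = 0\<close>. Idempotents do not have
  this defect: if \<open>T e e = e\<close>, then by continuity \<open>T e\<close> is the identity on
  \<open>[0,e]\<close>, so \<open>T e r = 0\<close> with \<open>r > 0\<close> forces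
  \<open>e = 0\<close>. A single value \<open>\<Phi> \<xi>\<close> has no reason to be idempotent,
  but the infimum over a family of functions closed under \<open>T\<close> is. This is where laxness
  and continuity of \<open>T\<close> meet. A second constraint is an apparent circle: compactness of
  \<open>V X\<close> is deduced from that of \<open>G (C X)\<close>, while the functions
  \<open>A \<mapsto> sup_on A \<psi>\<close> on \<open>V X\<close> are obtained by applying the
  extension of \<open>C\<close> to the counit. The basic lemmas on distributors therefore assume of
  the domain only that its order relates points of the space.\<close>

lemma sup01_le_iff:
  assumes "\<And>i. P i \<Longrightarrow> f i \<in> {0..1}" "0 \<le> w"
  shows "sup01 {f i | i. P i} \<le> w \<longleftrightarrow> (\<forall>i. P i \<longrightarrow> f i \<le> w)"
proof
  assume *: "sup01 {f i | i. P i} \<le> w"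
  have "f i \<le> sup01 {f i | i. P i}" if "P i" for i
    by (rule sup01_upper) (use assms that in auto)
  with * show "\<forall>i. P i \<longrightarrow> f i \<le> w" by (meson order_trans)
next
  assume "\<forall>i. P i \<longrightarrow> f i \<le> w"
  then show "sup01 {f i | i. P i} \<le> w"
    using assms(2) by (intro sup01_least) auto
qed

lemma sup01_nonneg:
  assumes "\<And>i. P i \<Longrightarrow> f i \<in> {0..1}"
  shows "0 \<le> sup01 {f i | i. P i}"
proof -
  have "bdd_above (insert 0 {f i | i. P i})"
    by (rule bdd_above_mono[of "{0..1}"]) (use assms in auto)
  then show ?thesis unfolding sup01_def by (intro cSup_upper) auto
qed

lemma sup01_mem:
  assumes "\<And>i. P i \<Longrightarrow> f i \<in> {0..1}"
  shows "sup01 {f i | i. P i} \<in> {0..1}"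
  using sup01_nonneg[of P f] sup01_le_iff[of P f 1] assms by auto

text \<open>Suprema are identified through their upper bounds. Only nonnegative bounds are tested
  because the empty supremum is 0.\<close>

lemma sup01_eqI:
  assumes "\<And>i. P i \<Longrightarrow> f i \<in> {0..1}" "0 \<le> s"
    "\<And>w. 0 \<le> w \<Longrightarrow> s \<le> w \<longleftrightarrow> (\<forall>i. P i \<longrightarrow> f i \<le> w)"
  shows "sup01 {f i | i. P i} = s"
  using sup01_le_iff[of P f] sup01_nonneg[of P f] assms by (meson order_antisym order_refl)

lemma le_inf01_iff:
  assumes "\<And>i. P i \<Longrightarrow> f i \<in> {0..1}" "w \<le> 1"
  shows "w \<le> inf01 {f i | i. P i} \<longleftrightarrow> (\<forall>i. P i \<longrightarrow> w \<le> f i)"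
proof -
  have "bdd_below (insert 1 {f i | i. P i})"
    by (rule bdd_below_mono[of "{0..1}"]) (use assms in auto)
  then have "w \<le> inf01 {f i | i. P i} \<longleftrightarrow> (\<forall>x\<in>insert 1 {f i | i. P i}. w \<le> x)"
    unfolding inf01_def by (subst le_cInf_iff) auto
  then show ?thesis using assms(2) by auto
qed

lemma inf01_mem:
  assumes "\<And>i. P i \<Longrightarrow> f i \<in> {0..1}"
  shows "inf01 {f i | i. P i} \<in> {0..1}"
proof -
  have "bdd_below (insert 1 {f i | i. P i})"
    by (rule bdd_below_mono[of "{0..1}"]) (use assms in auto)
  then have "inf01 {f i | i. P i} \<le> 1"
    unfolding inf01_def by (intro cInf_lower) auto
  moreover have "0 \<le> inf01 {f i | i. P i}" using le_inf01_iff[of P f 0] assms by auto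
  ultimately show ?thesis by simp
qed

text \<open>Values of \<open>hom01\<close> and \<open>inf01\<close> are controlled through the
  elements below them, by adjunction, so equations between such values are proved in this
  form.\<close>

lemma unit_eq_via_le:
  fixes a b :: real
  assumes "a \<in> {0..1}" "b \<in> {0..1}" "\<And>v. v \<in> {0..1} \<Longrightarrow> v \<le> a \<longleftrightarrow> v \<le> b"
  shows "a = b"
  using assms by (meson order_antisym order_refl)

locale tnorm =
  fixes T :: "real \<Rightarrow> real \<Rightarrow> real"
  assumes T: "continuous_tnorm T"
begin

lemmas T_axioms = T[unfolded continuous_tnorm_def]

lemma T_mem [simp]: "u \<in> {0..1} \<Longrightarrow> v \<in> {0..1} \<Longrightarrow> T u v \<in> {0..1}"
  by (rule T_axioms[THEN conjunct1, rule_format])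

lemma T_assoc: "u \<in> {0..1} \<Longrightarrow> v \<in> {0..1} \<Longrightarrow> w \<in> {0..1} \<Longrightarrow> T (T u v) w = T u (T v w)"
  by (rule T_axioms[THEN conjunct2, THEN conjunct1, rule_format])

lemma T_comm: "u \<in> {0..1} \<Longrightarrow> v \<in> {0..1} \<Longrightarrow> T u v = T v u"
  by (rule T_axioms[THEN conjunct2, THEN conjunct2, THEN conjunct1, rule_format])

lemma T_1_left: "u \<in> {0..1} \<Longrightarrow> T 1 u = u"
  by (rule T_axioms[THEN conjunct2, THEN conjunct2, THEN conjunct2, THEN conjunct1, rule_format, THEN conjunct1])

lemma T_1_right: "u \<in> {0..1} \<Longrightarrow> T u 1 = u"
  by (rule T_axioms[THEN conjunct2, THEN conjunct2, THEN conjunct2, THEN conjunct1, rule_format, THEN conjunct2])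

lemma T_sup: "u \<in> {0..1} \<Longrightarrow> S \<subseteq> {0..1} \<Longrightarrow> T u (sup01 S) = sup01 ((\<lambda>v. T u v) ` S)"
  using T_axioms by (elim conjE) (drule (1) bspec, drule spec, erule (1) mp)

lemma T_cont: "continuous_on ({0..1} \<times> {0..1}) (\<lambda>(u, v). T u v)"
  using T_axioms by (elim conjE)

lemma T_bounds: "u \<in> {0..1} \<Longrightarrow> v \<in> {0..1} \<Longrightarrow> 0 \<le> T u v \<and> T u v \<le> 1"
  using T_mem[of u v] by (simp del: T_mem)

lemma T_left_comm:
  assumes "u \<in> {0..1}" "v \<in> {0..1}" "w \<in> {0..1}"
  shows "T u (T v w) = T v (T u w)"
  using T_assoc[OF assms] T_assoc[OF assms(2,1,3)] T_comm[OF assms(1,2)] by simp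

lemma T_sup01:
  assumes "u \<in> {0..1}" "\<And>i. P i \<Longrightarrow> f i \<in> {0..1}"
  shows "T u (sup01 {f i | i. P i}) = sup01 {T u (f i) | i. P i}"
proof -
  have "(\<lambda>v. T u v) ` {f i | i. P i} = {T u (f i) | i. P i}" by blast
  moreover have "{f i | i. P i} \<subseteq> {0..1}" using assms(2) by blast
  ultimately show ?thesis using T_sup[of u "{f i | i. P i}"] assms(1) by simp
qed

text \<open>Monotonicity is not among the axioms of \<open>continuous_tnorm\<close>; it comes from
  preservation of the supremum of the two-element set \<open>{v, v'}\<close>.\<close>

lemma T_mono_right:
  assumes "u \<in> {0..1}" "v \<in> {0..1}" "v' \<in> {0..1}" "v \<le> v'"
  shows "T u v \<le> T u v'"
proof -
  have eq: "{v, v'} = {x | x. x = v \<or> x = v'}" "(\<lambda>v. T u v) ` {v, v'} = {T u x | x. x = v \<or> x = v'}"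
    by auto
  have "sup01 {v, v'} = v'"
    unfolding eq by (rule sup01_eqI) (use assms in auto)
  then have "T u v' = sup01 ((\<lambda>v. T u v) ` {v, v'})" using T_sup[of u "{v, v'}"] assms by auto
  moreover have "T u v \<le> \<dots>"
    by (rule sup01_upper) (use assms in \<open>auto simp: T_bounds\<close>)
  ultimately show ?thesis by simp
qed

lemma T_mono:
  assumes "u \<in> {0..1}" "u' \<in> {0..1}" "v \<in> {0..1}" "v' \<in> {0..1}" "u \<le> u'" "v \<le> v'"
  shows "T u v \<le> T u' v'"
proof -
  have "T u v \<le> T u v'" by (rule T_mono_right) (use assms in auto)
  also have "\<dots> = T v' u" by (rule T_comm) (use assms in auto)
  also have "\<dots> \<le> T v' u'" by (rule T_mono_right) (use assms in auto)
  also have "\<dots> = T u' v'" by (rule T_comm) (use assms in auto)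
  finally show ?thesis .
qed

lemma T_le_left: "u \<in> {0..1} \<Longrightarrow> v \<in> {0..1} \<Longrightarrow> T u v \<le> u"
  using T_mono_right[of u v 1] by (simp add: T_1_right)

lemma T_le_right: "u \<in> {0..1} \<Longrightarrow> v \<in> {0..1} \<Longrightarrow> T u v \<le> v"
  using T_le_left[of v u] by (simp add: T_comm)

lemma T_0_left: "u \<in> {0..1} \<Longrightarrow> T 0 u = 0"
  using T_le_left[of 0 u] T_bounds[of 0 u] by auto

lemma T_0_right: "u \<in> {0..1} \<Longrightarrow> T u 0 = 0"
  using T_le_right[of u 0] T_bounds[of u 0] by auto

lemma T_max_left:
  assumes "u \<in> {0..1}" "v \<in> {0..1}" "w \<in> {0..1}"
  shows "T (max v w) u = max (T v u) (T w u)"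
  using T_mono[of v w u u] T_mono[of w v u u] assms by (auto simp: max_def)

text \<open>By the intermediate value theorem every \<open>v\<close> between
  \<open>T e 0 = 0\<close> and \<open>T e 1 = e\<close> is some \<open>T e w\<close>, and a further
  factor \<open>e\<close> is absorbed by idempotence. The lemma serves to conclude
  \<open>e = 0\<close> from \<open>T e r \<le> 0\<close> with \<open>r\<close> positive.\<close>

lemma T_idempotent:
  assumes e: "e \<in> {0..1}" "T e e = e" and v: "0 \<le> v" "v \<le> e"
  shows "T e v = v"
proof -
  have "continuous_on {0..1} (\<lambda>w. (\<lambda>(u, v). T u v) (e, w))"
    by (rule continuous_on_compose2[OF T_cont]) (use e in \<open>auto intro!: continuous_intros\<close>)
  then have "\<exists>w\<ge>0. w \<le> 1 \<and> T e w = v"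
    by (intro IVT') (use e v in \<open>auto simp: T_0_right T_1_right\<close>)
  then obtain w where w: "w \<in> {0..1}" "T e w = v" by auto
  have "T e v = T (T e e) w" using T_assoc[OF e(1) e(1) w(1)] w(2) by simp
  then show ?thesis using e w by simp
qed

lemma hom_mem [simp]:
  assumes "u \<in> {0..1}" "w \<in> {0..1}" shows "hom01 T u w \<in> {0..1}"
  using sup01_mem[of "\<lambda>v. v \<in> {0..1} \<and> T u v \<le> w" "\<lambda>v. v"] unfolding hom01_def by simp

lemmas adj = hom01_adjoint[OF T]

lemma hom_eq_1_iff: "u \<in> {0..1} \<Longrightarrow> w \<in> {0..1} \<Longrightarrow> hom01 T u w = 1 \<longleftrightarrow> u \<le> w"
  using adj[of u 1 w] hom_mem[of u w] by (auto simp: T_1_right simp del: hom_mem)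

end

section \<open>Categories with a pointwise structure\<close>

text \<open>A common frame for \<open>[0,1]\<close>, with a single evaluation, and for
  \<open>C X\<close>, with one evaluation per point. \<open>e_sup\<close> says only that some
  element has the weighted suprema as its evaluations; that this element is a colimit is derived in
  \<open>is_colimit_iff\<close>.\<close>

locale pointwise = tnorm T for T +
  fixes A :: "('a, 'm) ucat_scheme" and S :: "'s set" and e :: "'s \<Rightarrow> 'a \<Rightarrow> real"
  assumes e_mem: "x \<in> S \<Longrightarrow> a \<in> pts A \<Longrightarrow> e x a \<in> {0..1}"
    and e_inj: "a \<in> pts A \<Longrightarrow> b \<in> pts A \<Longrightarrow> (\<And>x. x \<in> S \<Longrightarrow> e x a = e x b) \<Longrightarrow> a = b"
    and uhom_eq: "a \<in> pts A \<Longrightarrow> b \<in> pts A \<Longrightarrow> uhom A a b = inf01 {hom01 T (e x a) (e x b) | x. x \<in> S}"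
    and e_sup: "finite N \<Longrightarrow> (\<And>i. i \<in> N \<Longrightarrow> w i \<in> {0..1} \<and> h i \<in> pts A) \<Longrightarrow>
      \<exists>c\<in>pts A. \<forall>x\<in>S. e x c = sup01 {T (w i) (e x (h i)) | i. i \<in> (N :: nat set)}"
begin

lemma uhom_mem [simp]: "a \<in> pts A \<Longrightarrow> b \<in> pts A \<Longrightarrow> uhom A a b \<in> {0..1}"
  using inf01_mem[of "\<lambda>x. x \<in> S" "\<lambda>x. hom01 T (e x a) (e x b)"] by (simp add: uhom_eq e_mem del: atLeastAtMost_iff)

lemma le_uhom_iff:
  assumes "a \<in> pts A" "b \<in> pts A" "v \<in> {0..1}"
  shows "v \<le> uhom A a b \<longleftrightarrow> (\<forall>x\<in>S. T (e x a) v \<le> e x b)"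
proof -
  have "v \<le> uhom A a b \<longleftrightarrow> (\<forall>x. x \<in> S \<longrightarrow> v \<le> hom01 T (e x a) (e x b))"
    unfolding uhom_eq[OF assms(1,2)] using assms
    by (intro le_inf01_iff) (simp_all add: e_mem del: atLeastAtMost_iff, simp)
  then show ?thesis using assms adj e_mem by blast
qed

lemma nat_le_pointwise_iff:
  assumes "a \<in> pts A" "b \<in> pts A"
  shows "nat_le A a b \<longleftrightarrow> (\<forall>x\<in>S. e x a \<le> e x b)"
proof -
  have "nat_le A a b \<longleftrightarrow> 1 \<le> uhom A a b"
    using uhom_mem[OF assms] unfolding nat_le_def by (auto simp del: uhom_mem)
  also have "\<dots> \<longleftrightarrow> (\<forall>x\<in>S. T (e x a) 1 \<le> e x b)" using assms by (intro le_uhom_iff) auto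
  finally show ?thesis using assms by (simp add: T_1_right e_mem del: atLeastAtMost_iff)
qed

lemma e_uhom_le:
  assumes "a \<in> pts A" "b \<in> pts A" "x \<in> S"
  shows "T (e x a) (uhom A a b) \<le> e x b"
  using le_uhom_iff[of a b "uhom A a b"] assms by (simp del: atLeastAtMost_iff)

lemma ucategory: "ucategory T A"
  unfolding ucategory_def
proof (intro conjI ballI)
  fix a b c assume *: "a \<in> pts A" "b \<in> pts A" "c \<in> pts A"
  show "uhom A a b \<in> {0..1}" using * by (simp del: atLeastAtMost_iff)
  show "uhom A a a = 1" using nat_le_pointwise_iff[of a a] * unfolding nat_le_def by simp
  have "T (e x a) (T (uhom A a b) (uhom A b c)) \<le> e x c" if x: "x \<in> S" for x
  proof -
    have "T (e x a) (T (uhom A a b) (uhom A b c)) = T (T (e x a) (uhom A a b)) (uhom A b c)"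
      using * x by (simp add: T_assoc e_mem del: atLeastAtMost_iff)
    also have "\<dots> \<le> T (e x b) (uhom A b c)"
      using * x by (intro T_mono e_uhom_le) (simp_all add: e_mem del: atLeastAtMost_iff)
    also have "\<dots> \<le> e x c" using * x by (intro e_uhom_le)
    finally show ?thesis .
  qed
  then show "T (uhom A a b) (uhom A b c) \<le> uhom A a c"
    using * by (subst le_uhom_iff) (simp_all del: atLeastAtMost_iff)
qed

lemma useparated: "useparated A"
  unfolding useparated_def by (auto simp: nat_le_pointwise_iff intro!: e_inj antisym)

text \<open>The pointwise candidate has the universal property because \<open>T v\<close> preserves
  suprema and every inequality can be transposed past the weight. Conversely, \<open>e_sup\<close>
  provides such a candidate, and in a separated category a diagram has at most one colimit.\<close>

lemma is_colimit_iff: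
  assumes h: "\<And>i. i \<in> pts D \<Longrightarrow> h i \<in> pts A" and w: "\<And>i. i \<in> pts D \<Longrightarrow> w i \<in> {0..1}"
    and fin: "finite (pts D)"
  shows "is_colimit T A D h w c \<longleftrightarrow>
    c \<in> pts A \<and> (\<forall>x\<in>S. e x c = sup01 {T (w i) (e x (h i)) | i. i \<in> pts D})"
proof -
  have *: "is_colimit T A D h w c"
    if c: "c \<in> pts A" and eq: "\<And>x. x \<in> S \<Longrightarrow> e x c = sup01 {T (w i) (e x (h i)) | i. i \<in> pts D}" for c
    unfolding is_colimit_def
  proof (intro conjI ballI c)
    fix y assume y: "y \<in> pts A"
    show "uhom A c y = inf01 {hom01 T (w i) (uhom A (h i) y) | i. i \<in> pts D}"
    proof (rule unit_eq_via_le)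
      show "uhom A c y \<in> {0..1}" using c y by (rule uhom_mem)
      show "inf01 {hom01 T (w i) (uhom A (h i) y) | i. i \<in> pts D} \<in> {0..1}"
        by (rule inf01_mem) (simp add: h w y del: atLeastAtMost_iff)
      fix v :: real assume v: "v \<in> {0..1}"
      have "T (e x c) v \<le> e x y \<longleftrightarrow> (\<forall>i\<in>pts D. T (e x (h i)) (T (w i) v) \<le> e x y)" if x: "x \<in> S" for x
      proof -
        have hi: "e x (h i) \<in> {0..1}" if "i \<in> pts D" for i using that h x by (simp add: e_mem del: atLeastAtMost_iff)
        have "T (e x c) v = T v (e x c)" using c x v by (intro T_comm e_mem)
        also have "\<dots> = sup01 {T v (T (w i) (e x (h i))) | i. i \<in> pts D}"
          unfolding eq[OF x] by (rule T_sup01) (simp_all add: v w hi del: atLeastAtMost_iff)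
        finally have "T (e x c) v \<le> e x y \<longleftrightarrow> (\<forall>i. i \<in> pts D \<longrightarrow> T v (T (w i) (e x (h i))) \<le> e x y)"
          using e_mem[OF x y] by (simp only:) (rule sup01_le_iff, simp_all add: v w hi del: atLeastAtMost_iff, simp)
        moreover have "T v (T (w i) (e x (h i))) = T (e x (h i)) (T (w i) v)" if "i \<in> pts D" for i
          using T_left_comm[OF v w[OF that] hi[OF that]] T_left_comm[OF hi[OF that] w[OF that] v]
          T_comm[OF v hi[OF that]] by simp
        ultimately show ?thesis by (simp add: Ball_def)
      qed
      then have "v \<le> uhom A c y \<longleftrightarrow> (\<forall>i\<in>pts D. \<forall>x\<in>S. T (e x (h i)) (T (w i) v) \<le> e x y)"
        using c y v by (auto simp add: le_uhom_iff simp del: atLeastAtMost_iff)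
      also have "\<dots> \<longleftrightarrow> (\<forall>i\<in>pts D. T (w i) v \<le> uhom A (h i) y)"
        using h w y v by (simp add: le_uhom_iff del: atLeastAtMost_iff)
      also have "\<dots> \<longleftrightarrow> (\<forall>i. i \<in> pts D \<longrightarrow> v \<le> hom01 T (w i) (uhom A (h i) y))"
        using h w y v by (auto simp add: adj simp del: atLeastAtMost_iff)
      also have "\<dots> \<longleftrightarrow> v \<le> inf01 {hom01 T (w i) (uhom A (h i) y) | i. i \<in> pts D}"
        by (rule le_inf01_iff[symmetric]) (use v in \<open>simp_all add: h w y del: atLeastAtMost_iff\<close>, simp)
      finally show "v \<le> uhom A c y \<longleftrightarrow> v \<le> inf01 {hom01 T (w i) (uhom A (h i) y) | i. i \<in> pts D}" .
    qed
  qed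
  obtain c' where c': "c' \<in> pts A" "\<And>x. x \<in> S \<Longrightarrow> e x c' = sup01 {T (w i) (e x (h i)) | i. i \<in> pts D}"
    using e_sup[of "pts D" w h] fin h w by blast
  have "c = c'" if c: "is_colimit T A D h w c"
  proof -
    have cA: "c \<in> pts A" using c unfolding is_colimit_def by blast
    have "uhom A c y = uhom A c' y" if "y \<in> pts A" for y
      using c *[OF c'] that unfolding is_colimit_def by simp
    moreover have "uhom A c c = 1" "uhom A c' c' = 1"
      using ucategory cA c' unfolding ucategory_def by blast+
    ultimately show ?thesis
      using useparated cA c'(1) unfolding useparated_def nat_le_def by metis
  qed
  then show ?thesis using * c' by blast
qed

lemma fin_cocomplete: "fin_cocomplete T A"
  unfolding fin_cocomplete_def fin_diagram_def ufunctor_def uweight_def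
proof (intro allI impI, elim conjE)
  fix D :: "nat ucat" and h and w :: "nat \<Rightarrow> real"
  assume *: "finite (pts D)" "h \<in> pts D \<rightarrow> pts A" "\<forall>i\<in>pts D. w i \<in> {0..1}"
  then show "\<exists>c. is_colimit T A D h w c"
    using e_sup[of "pts D" w h] by (subst is_colimit_iff) auto
qed

lemma finsup_obj: "finsup_obj T A"
  unfolding finsup_obj_def using ucategory useparated fin_cocomplete by blast

end

context tnorm begin

lemma pointwise_unit_mon: "pointwise T (unit_mon T) {()} (\<lambda>_ a. a)"
proof unfold_locales
  fix a b assume "a \<in> pts (unit_mon T)" "b \<in> pts (unit_mon T)"
  then have ab: "a \<in> {0..1}" "b \<in> {0..1}" by (simp_all add: unit_mon_def)
  have "inf01 {hom01 T a b | x. x \<in> {()}} = hom01 T a b"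
  proof (rule unit_eq_via_le)
    show "inf01 {hom01 T a b | x. x \<in> {()}} \<in> {0..1}"
      by (rule inf01_mem) (simp add: ab del: atLeastAtMost_iff)
    show "hom01 T a b \<in> {0..1}" using ab by (rule hom_mem)
    show "v \<le> inf01 {hom01 T a b | x. x \<in> {()}} \<longleftrightarrow> v \<le> hom01 T a b" if "v \<in> {0..1}" for v
      using le_inf01_iff[of "\<lambda>x. x \<in> {()}" "\<lambda>x. hom01 T a b" v] that ab hom_mem by simp
  qed
  then show "uhom (unit_mon T) a b = inf01 {hom01 T a b | x. x \<in> {()}}" by (simp add: unit_mon_def)
next
  fix N :: "nat set" and w h :: "nat \<Rightarrow> real"
  assume "\<And>i. i \<in> N \<Longrightarrow> w i \<in> {0..1} \<and> h i \<in> pts (unit_mon T)"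
  then have "sup01 {T (w i) (h i) | i. i \<in> N} \<in> {0..1}"
    by (intro sup01_mem) (simp add: unit_mon_def del: atLeastAtMost_iff)
  then show "\<exists>c\<in>pts (unit_mon T). \<forall>x\<in>{()}. c = sup01 {T (w i) (h i) | i. i \<in> N}"
    by (simp add: unit_mon_def)
qed (auto simp: unit_mon_def)

lemma pts_unit [simp]: "pts (unit_mon T) = {0..1}"
  and uhom_unit [simp]: "uhom (unit_mon T) = hom01 T"
  and mul_unit [simp]: "mul (unit_mon T) = T"
  and unt_unit [simp]: "unt (unit_mon T) = 1"
  and tminus_unit [simp]: "tminus (unit_mon T) = (\<lambda>u v. max (u - v) 0)"
  by (simp_all add: unit_mon_def)

lemma nat_le_unit: "u \<in> {0..1} \<Longrightarrow> v \<in> {0..1} \<Longrightarrow> nat_le (unit_mon T) u v \<longleftrightarrow> u \<le> v"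
  by (simp add: nat_le_def hom_eq_1_iff)

lemma is_colimit_unit_iff:
  assumes "\<And>i. i \<in> pts D \<Longrightarrow> h i \<in> {0..1}" "\<And>i. i \<in> pts D \<Longrightarrow> w i \<in> {0..1}" "finite (pts D)"
  shows "is_colimit T (unit_mon T) D h w c \<longleftrightarrow> c = sup01 {T (w i) (h i) | i. i \<in> pts D}"
proof -
  have "sup01 {T (w i) (h i) | i. i \<in> pts D} \<in> {0..1}"
    by (rule sup01_mem) (simp add: assms del: atLeastAtMost_iff)
  then show ?thesis
    using pointwise.is_colimit_iff[OF pointwise_unit_mon, of D h w c] assms by auto
qed

text \<open>Functoriality is transposed to \<open>T (f a) (uhom B a b) \<le> f b\<close> because
  \<open>hom01 T\<close> need not be continuous; for fixed \<open>a\<close> and \<open>b\<close> the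
  transposed form is a closed condition on \<open>f\<close>.\<close>

lemma fin_cocontinuous_unit_iff:
  assumes B: "ucategory T B"
  shows "fin_cocontinuous T B (unit_mon T) f \<longleftrightarrow>
    f \<in> pts B \<rightarrow> {0..1} \<and> (\<forall>a\<in>pts B. \<forall>b\<in>pts B. T (f a) (uhom B a b) \<le> f b) \<and>
    (\<forall>D h w c. fin_diagram T B D h w \<and> is_colimit T B D h w c \<longrightarrow>
      f c = sup01 {T (w i) (f (h i)) | i. i \<in> pts D})" (is "?l = ?r")
proof -
  have uh: "uhom B a b \<in> {0..1}" if "a \<in> pts B" "b \<in> pts B" for a b
    using B that unfolding ucategory_def by blast
  have col: "is_colimit T (unit_mon T) D (f \<circ> h) w (f c) \<longleftrightarrow> f c = sup01 {T (w i) (f (h i)) | i. i \<in> pts D}"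
    if "f \<in> pts B \<rightarrow> {0..1}" "fin_diagram T B D h w" for D h w c
    using that is_colimit_unit_iff[of D "f \<circ> h" w "f c"]
    unfolding fin_diagram_def ufunctor_def uweight_def by (simp add: Pi_iff)
  have fun_iff: "ufunctor B (unit_mon T) f \<longleftrightarrow>
    f \<in> pts B \<rightarrow> {0..1} \<and> (\<forall>a\<in>pts B. \<forall>b\<in>pts B. T (f a) (uhom B a b) \<le> f b)"
    unfolding ufunctor_def pts_unit uhom_unit
    using uh by (intro conj_cong refl ball_cong) (auto simp add: adj Pi_iff simp del: atLeastAtMost_iff)
  show ?thesis unfolding fin_cocontinuous_def fun_iff using col by blast
qed

end

context pointwise begin

lemma fin_cocontinuous_iff:
  assumes B: "ucategory T B"
  shows "fin_cocontinuous T B A f \<longleftrightarrow>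
    f \<in> pts B \<rightarrow> pts A \<and> (\<forall>x\<in>S. fin_cocontinuous T B (unit_mon T) (\<lambda>b. e x (f b)))"
proof -
  have uh: "uhom B a b \<in> {0..1}" if "a \<in> pts B" "b \<in> pts B" for a b
    using B that unfolding ucategory_def by blast
  have col: "is_colimit T A D (f \<circ> h) w (f c) \<longleftrightarrow>
     (\<forall>x\<in>S. e x (f c) = sup01 {T (w i) (e x (f (h i))) | i. i \<in> pts D})"
    if "f \<in> pts B \<rightarrow> pts A" "fin_diagram T B D h w" "is_colimit T B D h w c" for D h w c
    using that is_colimit_iff[of D "f \<circ> h" w "f c"]
    unfolding fin_diagram_def ufunctor_def uweight_def is_colimit_def by (simp add: Pi_iff)
  have fun_iff: "ufunctor B A f \<longleftrightarrow>
    f \<in> pts B \<rightarrow> pts A \<and> (\<forall>a\<in>pts B. \<forall>b\<in>pts B. \<forall>x\<in>S. T (e x (f a)) (uhom B a b) \<le> e x (f b))"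
    unfolding ufunctor_def
    using uh by (intro conj_cong refl ball_cong) (auto simp add: le_uhom_iff Pi_iff simp del: atLeastAtMost_iff)
  show ?thesis
    unfolding fin_cocontinuous_def[of T B A] fun_iff fin_cocontinuous_unit_iff[OF B]
    using col e_mem by (auto simp add: Pi_iff simp del: atLeastAtMost_iff)
qed

text \<open>Multiplication by \<open>k x\<close> under each evaluation commutes with weighted
  suprema by \<open>T_sup01\<close> and \<open>T_left_comm\<close>. This covers the multiplications
  of \<open>[0,1]\<close> and of \<open>C X\<close> at once.\<close>

lemma fin_cocontinuous_mult:
  assumes f: "f \<in> pts A \<rightarrow> pts A" and k: "\<And>x. x \<in> S \<Longrightarrow> k x \<in> {0..1}"
    and eq: "\<And>x a. x \<in> S \<Longrightarrow> a \<in> pts A \<Longrightarrow> e x (f a) = T (k x) (e x a)"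
  shows "fin_cocontinuous T A A f"
  unfolding fin_cocontinuous_iff[OF ucategory] fin_cocontinuous_unit_iff[OF ucategory]
proof (intro conjI ballI f allI impI)
  fix x assume x: "x \<in> S"
  show "(\<lambda>b. e x (f b)) \<in> pts A \<rightarrow> {0..1}" using f x e_mem by fastforce
  {
    fix a b assume *: "a \<in> pts A" "b \<in> pts A"
    have "T (T (k x) (e x a)) (uhom A a b) = T (k x) (T (e x a) (uhom A a b))"
      using * x k by (simp add: T_assoc e_mem del: atLeastAtMost_iff)
    also have "\<dots> \<le> T (k x) (e x b)"
      using * x k by (intro T_mono e_uhom_le) (simp_all add: e_mem del: atLeastAtMost_iff)
    finally show "T (e x (f a)) (uhom A a b) \<le> e x (f b)" using * x by (simp add: eq)
  }
  fix D h w c assume *: "fin_diagram T A D h w \<and> is_colimit T A D h w c"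
  then have h: "h i \<in> pts A" "w i \<in> {0..1}" if "i \<in> pts D" for i
    using that unfolding fin_diagram_def ufunctor_def uweight_def by auto
  have c: "c \<in> pts A" using * unfolding is_colimit_def by blast
  have "e x (f c) = T (k x) (sup01 {T (w i) (e x (h i)) | i. i \<in> pts D})"
    using * is_colimit_iff[of D h w c] h c x by (simp add: eq fin_diagram_def)
  also have "\<dots> = sup01 {T (k x) (T (w i) (e x (h i))) | i. i \<in> pts D}"
    by (rule T_sup01) (simp_all add: h k x e_mem del: atLeastAtMost_iff)
  also have "{T (k x) (T (w i) (e x (h i))) | i. i \<in> pts D} = {T (w i) (e x (f (h i))) | i. i \<in> pts D}"
  proof -
    have "T (k x) (T (w i) (e x (h i))) = T (w i) (e x (f (h i)))" if "i \<in> pts D" for i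
      unfolding eq[OF x h(1)[OF that]] using h[OF that] k[OF x] e_mem[OF x h(1)[OF that]] by (intro T_left_comm)
    then show ?thesis by (intro Collect_cong iff_exI) auto
  qed
  finally show "e x (f c) = sup01 {T (w i) (e x (f (h i))) | i. i \<in> pts D}" .
qed

end


section \<open>Partially ordered compact spaces\<close>

lemma PosComp_compact: "X \<in> PosComp \<Longrightarrow> compact_space (tp X)"
  and PosComp_closed: "X \<in> PosComp \<Longrightarrow> closedin (prod_topology (tp X) (tp X)) (ple X)"
  by (simp_all add: PosComp_def)

lemma PosComp_order:
  assumes "X \<in> PosComp"
  shows ple_subset: "ple X \<subseteq> sp X \<times> sp X"
    and ple_refl: "x \<in> sp X \<Longrightarrow> (x, x) \<in> ple X"
    and ple_trans: "(x, y) \<in> ple X \<Longrightarrow> (y, z) \<in> ple X \<Longrightarrow> (x, z) \<in> ple X"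
    and ple_antisym: "(x, y) \<in> ple X \<Longrightarrow> (y, x) \<in> ple X \<Longrightarrow> x = y"
  using assms unfolding PosComp_def partial_order_on_def preorder_on_def refl_on_def
  by (auto elim: transE antisymD)

lemma ple_points:
  assumes "X \<in> PosComp" "(x, y) \<in> ple X" shows "x \<in> sp X" "y \<in> sp X"
  using ple_subset[OF assms(1)] assms(2) by auto

lemma sp_unit_op [simp]: "sp unit_op = {0..1}"
  by (simp add: unit_op_def)

lemma ple_unit_op: "(u, v) \<in> ple unit_op \<longleftrightarrow> u \<in> {0..1} \<and> v \<in> {0..1} \<and> v \<le> u"
  by (simp add: unit_op_def)

lemma continuous_map_unit_op:
  "continuous_map X (tp unit_op) f \<longleftrightarrow> continuous_map X euclideanreal f \<and> f \<in> topspace X \<rightarrow> {0..1}"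
  by (auto simp: unit_op_def continuous_map_in_subtopology)

lemma closedin_le_fun:
  fixes f g :: "'a \<Rightarrow> real"
  assumes "continuous_map X euclideanreal f" "continuous_map X euclideanreal g"
  shows "closedin X {x \<in> topspace X. f x \<le> g x}"
proof -
  have "continuous_map X euclideanreal (\<lambda>x. g x - f x)"
    by (intro continuous_map_diff assms)
  then have "closedin X {x \<in> topspace X. (\<lambda>x. g x - f x) x \<in> {0..}}"
    by (rule closedin_continuous_map_preimage) simp
  then show ?thesis by simp
qed

lemma openin_less_fun:
  fixes f g :: "'a \<Rightarrow> real"
  assumes "continuous_map X euclideanreal f" "continuous_map X euclideanreal g"
  shows "openin X {x \<in> topspace X. f x < g x}"
proof -
  have "{x \<in> topspace X. f x < g x} = topspace X - {x \<in> topspace X. g x \<le> f x}" by auto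
  then show ?thesis using closedin_le_fun[OF assms(2,1)] by auto
qed

lemma unit_op_PosComp: "unit_op \<in> PosComp"
proof -
  let ?X = "top_of_set {0..1::real}"
  have "{(u, v). u \<in> {0..1} \<and> v \<in> {0..1} \<and> v \<le> u} = {p \<in> topspace (prod_topology ?X ?X). snd p \<le> (fst p :: real)}"
    by auto
  moreover have "closedin (prod_topology ?X ?X) \<dots>"
    by (rule closedin_le_fun)
      (auto intro: continuous_on_fst[OF continuous_on_id] continuous_on_snd[OF continuous_on_id])
  ultimately show ?thesis
    unfolding PosComp_def unit_op_def
    by (auto simp: partial_order_on_def preorder_on_def refl_on_def trans_def antisym_def
        compact_space_subtopology)
qed

lemma prod_topology_euclidean:
  "prod_topology euclidean euclidean = (euclidean :: ('a::topological_space \<times> 'b::topological_space) topology)"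
  unfolding topology_eq openin_prod_topology_alt
  by (simp add: open_prod_def Ball_def)

text \<open>The hypothesis is this weak so that the characterisation applies to
  \<open>V_obj X\<close> before that space is known to lie in \<open>PosComp\<close>.\<close>

lemma pos_hom_unit_iff_relation:
  assumes "ple X \<subseteq> sp X \<times> sp X"
  shows "\<psi> \<in> pos_hom X unit_op \<longleftrightarrow> \<psi> \<in> extensional (sp X) \<and> (\<forall>x\<in>sp X. \<psi> x \<in> {0..1}) \<and>
    continuous_map (tp X) euclideanreal \<psi> \<and> (\<forall>(x, y)\<in>ple X. \<psi> y \<le> \<psi> x)"
proof -
  have "(\<forall>(x, y)\<in>ple X. (\<psi> x, \<psi> y) \<in> ple unit_op) \<longleftrightarrow> (\<forall>(x, y)\<in>ple X. \<psi> y \<le> \<psi> x)"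
    if "\<forall>x\<in>sp X. \<psi> x \<in> {0..1}"
    using that assms unfolding ple_unit_op by blast
  then show ?thesis
    unfolding pos_hom_def continuous_map_unit_op sp_unit_op mem_Collect_eq PiE_iff Pi_iff by blast
qed

lemmas pos_hom_unit_iff = pos_hom_unit_iff_relation[OF ple_subset]

context
  fixes X :: "'a pospace" assumes X: "X \<in> PosComp"
begin

lemma C_mem: "\<psi> \<in> pos_hom X unit_op \<Longrightarrow> x \<in> sp X \<Longrightarrow> \<psi> x \<in> {0..1}"
  and C_cont: "\<psi> \<in> pos_hom X unit_op \<Longrightarrow> continuous_map (tp X) euclideanreal \<psi>"
  and C_antimono: "\<psi> \<in> pos_hom X unit_op \<Longrightarrow> (x, y) \<in> ple X \<Longrightarrow> \<psi> y \<le> \<psi> x"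
  and C_ext: "\<psi> \<in> pos_hom X unit_op \<Longrightarrow> \<psi> \<in> extensional (sp X)"
  using pos_hom_unit_iff[OF X] by blast+

lemma C_const: "u \<in> {0..1} \<Longrightarrow> (\<lambda>x\<in>sp X. u) \<in> pos_hom X unit_op"
  using ple_points[OF X] continuous_map_eq[of "tp X" euclideanreal "\<lambda>_. u" "\<lambda>x\<in>sp X. u"]
  by (auto simp: pos_hom_unit_iff[OF X])

lemma C_op2:
  assumes \<psi>: "\<psi> \<in> pos_hom X unit_op" and \<phi>: "\<phi> \<in> pos_hom X unit_op"
    and mem: "\<And>u v. u \<in> {0..1} \<Longrightarrow> v \<in> {0..1} \<Longrightarrow> g u v \<in> {0..1}"
    and cont: "continuous_on ({0..1} \<times> {0..1}) (\<lambda>(u, v). g u v)"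
    and mono: "\<And>u u' v v'. u \<in> {0..1} \<Longrightarrow> u' \<in> {0..1} \<Longrightarrow> v \<in> {0..1} \<Longrightarrow> v' \<in> {0..1} \<Longrightarrow>
      u \<le> u' \<Longrightarrow> v \<le> v' \<Longrightarrow> g u v \<le> g u' v'"
  shows "(\<lambda>x\<in>sp X. g (\<psi> x) (\<phi> x)) \<in> pos_hom X unit_op"
  unfolding pos_hom_unit_iff[OF X]
proof (intro conjI ballI)
  have "continuous_map (tp X) (top_of_set ({0..1} \<times> {0..1})) (\<lambda>x. (\<psi> x, \<phi> x))"
    unfolding continuous_map_in_subtopology
    using continuous_map_pairedI[OF C_cont[OF \<psi>] C_cont[OF \<phi>], unfolded prod_topology_euclidean]
      C_mem[OF \<psi>] C_mem[OF \<phi>]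
    by (auto simp del: atLeastAtMost_iff)
  then have "continuous_map (tp X) euclideanreal ((\<lambda>(u, v). g u v) \<circ> (\<lambda>x. (\<psi> x, \<phi> x)))"
    by (rule continuous_map_compose) (use cont in simp)
  then show "continuous_map (tp X) euclideanreal (\<lambda>x\<in>sp X. g (\<psi> x) (\<phi> x))"
    by (rule continuous_map_eq) simp
  show "(\<lambda>x\<in>sp X. g (\<psi> x) (\<phi> x)) x \<in> {0..1}" if "x \<in> sp X" for x
    using that mem[OF C_mem[OF \<psi> that] C_mem[OF \<phi> that]] by simp
  show "case p of (x, y) \<Rightarrow> (\<lambda>x\<in>sp X. g (\<psi> x) (\<phi> x)) y \<le> (\<lambda>x\<in>sp X. g (\<psi> x) (\<phi> x)) x" if "p \<in> ple X" for p
  proof (cases p)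
    case (Pair x y)
    then have xy: "x \<in> sp X" "y \<in> sp X" "(x, y) \<in> ple X" using that ple_points[OF X] by auto
    have "g (\<psi> y) (\<phi> y) \<le> g (\<psi> x) (\<phi> x)"
      by (intro mono C_mem \<psi> \<phi> xy C_antimono)
    then show ?thesis using Pair xy by simp
  qed
qed simp

lemma C_op1:
  assumes \<psi>: "\<psi> \<in> pos_hom X unit_op"
    and mem: "\<And>u. u \<in> {0..1} \<Longrightarrow> g u \<in> {0..1}"
    and cont: "continuous_on {0..1} g"
    and mono: "\<And>u u'. u \<in> {0..1} \<Longrightarrow> u' \<in> {0..1} \<Longrightarrow> u \<le> u' \<Longrightarrow> g u \<le> g u'"
  shows "(\<lambda>x\<in>sp X. g (\<psi> x)) \<in> pos_hom X unit_op"
proof (rule C_op2[OF \<psi> \<psi>, of "\<lambda>u v. g u"])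
  have "continuous_on ({0..1} \<times> {0..1}) (\<lambda>p. g (fst p))"
    by (rule continuous_on_compose2[OF cont]) (auto intro!: continuous_intros)
  then show "continuous_on ({0..1} \<times> {0..1}) (\<lambda>(u, v). g u)" by (simp add: split_def)
qed (use mem mono in auto)

lemma C_max:
  assumes "\<psi> \<in> pos_hom X unit_op" "\<phi> \<in> pos_hom X unit_op"
  shows "(\<lambda>x\<in>sp X. max (\<psi> x) (\<phi> x)) \<in> pos_hom X unit_op"
  by (rule C_op2[OF assms]) (auto simp: split_def intro!: continuous_intros)

lemma C_tminus:
  assumes "\<psi> \<in> pos_hom X unit_op" "u \<in> {0..1}"
  shows "(\<lambda>x\<in>sp X. max (\<psi> x - u) 0) \<in> pos_hom X unit_op"
  by (rule C_op1[OF assms(1)]) (use assms(2) in \<open>auto intro!: continuous_intros\<close>)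

end

lemma C_eqI:
  assumes "\<psi> \<in> pos_hom X unit_op" "\<phi> \<in> pos_hom X unit_op" "\<And>x. x \<in> sp X \<Longrightarrow> \<psi> x = \<phi> x"
  shows "\<psi> = \<phi>"
  using assms unfolding pos_hom_def by (auto intro: PiE_ext)

section \<open>The object \<open>C X\<close> and its pointwise colimits\<close>

context tnorm begin

lemma pts_C [simp]: "pts (C_obj T X) = pos_hom X unit_op"
  and mul_C [simp]: "mul (C_obj T X) = (\<lambda>\<psi> \<phi>. \<lambda>x\<in>sp X. T (\<psi> x) (\<phi> x))"
  and unt_C [simp]: "unt (C_obj T X) = (\<lambda>x\<in>sp X. 1)"
  and tminus_C [simp]: "tminus (C_obj T X) = (\<lambda>\<psi> u. \<lambda>x\<in>sp X. max (\<psi> x - u) 0)"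
  by (simp_all add: C_obj_def)

lemma C_T:
  assumes "X \<in> PosComp" "\<psi> \<in> pos_hom X unit_op" "\<phi> \<in> pos_hom X unit_op"
  shows "(\<lambda>x\<in>sp X. T (\<psi> x) (\<phi> x)) \<in> pos_hom X unit_op"
  by (rule C_op2[OF assms T_mem T_cont T_mono])

lemma C_copower:
  assumes X: "X \<in> PosComp" and "\<psi> \<in> pos_hom X unit_op" "u \<in> {0..1}"
  shows "(\<lambda>x\<in>sp X. T (\<psi> x) u) \<in> pos_hom X unit_op"
proof -
  have "(\<lambda>x\<in>sp X. T (\<psi> x) ((\<lambda>x\<in>sp X. u) x)) \<in> pos_hom X unit_op"
    by (rule C_T[OF assms(1,2) C_const[OF X assms(3)]])
  then show ?thesis by (simp cong: restrict_cong)
qed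

lemma C_finite_sup:
  assumes X: "X \<in> PosComp" and "finite N"
    and "\<And>i. i \<in> N \<Longrightarrow> w i \<in> {0..1} \<and> h i \<in> pos_hom X unit_op"
  shows "(\<lambda>x\<in>sp X. sup01 {T (w i) (h i x) | i. i \<in> N}) \<in> pos_hom X unit_op"
  using assms(2,3)
proof (induction N)
  case empty
  have eq: "(\<lambda>x\<in>sp X. sup01 {T (w i) (h i x) | i. i \<in> {}}) = (\<lambda>x\<in>sp X. 0)"
    by (rule restrict_ext) (simp add: sup01_def)
  show ?case unfolding eq by (rule C_const[OF X]) simp
next
  case (insert j N)
  let ?s = "\<lambda>x. sup01 {T (w i) (h i x) | i. i \<in> N}"
  have "(\<lambda>x\<in>sp X. max (T (h j x) (w j)) ((\<lambda>x\<in>sp X. ?s x) x)) = (\<lambda>x\<in>sp X. sup01 {T (w i) (h i x) | i. i \<in> insert j N})"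
  proof (rule restrict_ext)
    fix x assume x: "x \<in> sp X"
    have m: "T (w i) (h i x) \<in> {0..1}" if "i \<in> insert j N" for i
      using insert.prems[OF that] C_mem[OF X _ x] by (intro T_mem) auto
    then have s: "?s x \<in> {0..1}" by (intro sup01_mem) auto
    have "sup01 {T (w i) (h i x) | i. i \<in> insert j N} = max (T (w j) (h j x)) (?s x)"
    proof (rule sup01_eqI)
      show "T (w i) (h i x) \<in> {0..1}" if "i \<in> insert j N" for i using m that .
      show "0 \<le> max (T (w j) (h j x)) (?s x)" using s by auto
      fix v :: real assume "0 \<le> v"
      then have "?s x \<le> v \<longleftrightarrow> (\<forall>i. i \<in> N \<longrightarrow> T (w i) (h i x) \<le> v)"
        using m by (intro sup01_le_iff) auto
      then show "max (T (w j) (h j x)) (?s x) \<le> v \<longleftrightarrow> (\<forall>i. i \<in> insert j N \<longrightarrow> T (w i) (h i x) \<le> v)"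
        by auto
    qed
    moreover have "T (w j) (h j x) = T (h j x) (w j)"
      using insert.prems[of j] C_mem[OF X _ x] by (intro T_comm) auto
    ultimately show "max (T (h j x) (w j)) ((\<lambda>x\<in>sp X. ?s x) x) = sup01 {T (w i) (h i x) | i. i \<in> insert j N}"
      using x by simp
  qed
  moreover have "(\<lambda>x\<in>sp X. max ((\<lambda>x\<in>sp X. T (h j x) (w j)) x) ((\<lambda>x\<in>sp X. ?s x) x)) \<in> pos_hom X unit_op"
    using insert by (intro C_max[OF X] C_copower[OF X]) auto
  moreover have "(\<lambda>x\<in>sp X. max ((\<lambda>x\<in>sp X. T (h j x) (w j)) x) ((\<lambda>x\<in>sp X. ?s x) x)) =
     (\<lambda>x\<in>sp X. max (T (h j x) (w j)) ((\<lambda>x\<in>sp X. ?s x) x))"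
    by (rule restrict_ext) simp
  ultimately show ?case by (simp only:)
qed

lemma pointwise_C:
  assumes X: "X \<in> PosComp"
  shows "pointwise T (C_obj T X) (sp X) (\<lambda>x \<psi>. \<psi> x)"
proof unfold_locales
  fix N :: "nat set" and w :: "nat \<Rightarrow> real" and h
  assume "finite N" "\<And>i. i \<in> N \<Longrightarrow> w i \<in> {0..1} \<and> h i \<in> pts (C_obj T X)"
  then have "(\<lambda>x\<in>sp X. sup01 {T (w i) (h i x) | i. i \<in> N}) \<in> pos_hom X unit_op"
    by (intro C_finite_sup[OF X]) auto
  then show "\<exists>c\<in>pts (C_obj T X). \<forall>x\<in>sp X. c x = sup01 {T (w i) (h i x) | i. i \<in> N}"
    by (intro bexI[of _ "\<lambda>x\<in>sp X. sup01 {T (w i) (h i x) | i. i \<in> N}"]) auto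
next
  fix \<psi> \<phi> assume "\<psi> \<in> pts (C_obj T X)" "\<phi> \<in> pts (C_obj T X)" "\<And>x. x \<in> sp X \<Longrightarrow> \<psi> x = \<phi> x"
  then show "\<psi> = \<phi>" by (intro C_eqI[of \<psi> X \<phi>]) simp_all
next
  show "\<psi> x \<in> {0..1}" if "x \<in> sp X" "\<psi> \<in> pts (C_obj T X)" for x \<psi>
    using that by (intro C_mem[OF X]) simp_all
qed (simp add: C_obj_def)

lemma nat_le_C:
  assumes "X \<in> PosComp" "\<psi> \<in> pos_hom X unit_op" "\<phi> \<in> pos_hom X unit_op"
  shows "nat_le (C_obj T X) \<psi> \<phi> \<longleftrightarrow> (\<forall>x\<in>sp X. \<psi> x \<le> \<phi> x)"
  using pointwise.nat_le_pointwise_iff[OF pointwise_C[OF assms(1)], of \<psi> \<phi>] assms by simp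

lemma unit_mon_MonObj: "unit_mon T \<in> MonObj T"
proof -
  interpret U: pointwise T "unit_mon T" "{()}" "\<lambda>_ a. a" by (rule pointwise_unit_mon)
  have "fin_cocontinuous T (unit_mon T) (unit_mon T) (T x)" if "x \<in> {0..1}" for x
    by (rule U.fin_cocontinuous_mult[of _ "\<lambda>_. x"]) (use that T_mem in auto)
  then show ?thesis
    unfolding MonObj_def umon_obj_def mem_Collect_eq pts_unit mul_unit unt_unit tminus_unit
  proof (intro conjI ballI U.finsup_obj)
    show "nat_le (unit_mon T) x 1" if "x \<in> {0..1}" for x
      using nat_le_unit[of x 1] that by simp
  next
    show "T (T x y) z = T x (T y z)" if "x \<in> {0..1}" "y \<in> {0..1}" "z \<in> {0..1}" for x y z
      using that by (rule T_assoc)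
    show "T x y = T y x" if "x \<in> {0..1}" "y \<in> {0..1}" for x y
      using that by (rule T_comm)
  qed (simp_all add: T_1_left del: atLeastAtMost_iff, simp_all)
qed

lemma C_obj_MonObj:
  assumes X: "X \<in> PosComp"
  shows "C_obj T X \<in> MonObj T"
proof -
  interpret P: pointwise T "C_obj T X" "sp X" "\<lambda>x \<psi>. \<psi> x" using X by (rule pointwise_C)
  note m = C_mem[OF X]
  note c1 = C_const[OF X, of 1, simplified]
  show ?thesis
    unfolding MonObj_def umon_obj_def mem_Collect_eq pts_C unt_C tminus_C
  proof (intro conjI ballI P.finsup_obj c1 C_tminus[OF X])
    fix \<psi> assume \<psi>: "\<psi> \<in> pos_hom X unit_op"
    show "fin_cocontinuous T (C_obj T X) (C_obj T X) (mul (C_obj T X) \<psi>)"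
      by (rule P.fin_cocontinuous_mult[of _ \<psi>]) (use \<psi> m C_T[OF X] in auto)
    show "nat_le (C_obj T X) \<psi> (\<lambda>x\<in>sp X. 1)"
      using nat_le_C[OF X \<psi> c1] m[OF \<psi>] by auto
    show "mul (C_obj T X) (\<lambda>x\<in>sp X. 1) \<psi> = \<psi>"
      using m[OF \<psi>] C_ext[OF X \<psi>]
      by (intro extensionalityI[of _ "sp X"]) (auto simp: T_1_left simp del: atLeastAtMost_iff)
    fix \<phi> assume \<phi>: "\<phi> \<in> pos_hom X unit_op"
    show "mul (C_obj T X) \<psi> \<phi> \<in> pos_hom X unit_op"
      unfolding mul_C by (rule C_T[OF X \<psi> \<phi>])
    show "mul (C_obj T X) \<psi> \<phi> = mul (C_obj T X) \<phi> \<psi>"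
      unfolding mul_C by (rule restrict_ext) (simp add: T_comm[OF m m] \<psi> \<phi>)
    fix \<theta> assume \<theta>: "\<theta> \<in> pos_hom X unit_op"
    show "mul (C_obj T X) (mul (C_obj T X) \<psi> \<phi>) \<theta> = mul (C_obj T X) \<psi> (mul (C_obj T X) \<phi> \<theta>)"
      unfolding mul_C by (rule restrict_ext) (simp add: T_assoc[OF m m m] \<psi> \<phi> \<theta>)
  qed
qed

lemma C_bottom: "X \<in> PosComp \<Longrightarrow> is_bottom (C_obj T X) (\<lambda>x\<in>sp X. 0)"
  unfolding is_bottom_def using C_const[of X 0] C_mem[of X] by (auto simp: nat_le_C)

lemma C_binary_sup:
  assumes X: "X \<in> PosComp" and \<psi>: "\<psi> \<in> pos_hom X unit_op" and \<phi>: "\<phi> \<in> pos_hom X unit_op"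
  shows "is_binary_sup (C_obj T X) \<psi> \<phi> (\<lambda>x\<in>sp X. max (\<psi> x) (\<phi> x))"
proof -
  interpret P: pointwise T "C_obj T X" "sp X" "\<lambda>x \<psi>. \<psi> x" using X by (rule pointwise_C)
  let ?s = "\<lambda>x\<in>sp X. max (\<psi> x) (\<phi> x)"
  have s: "?s \<in> pos_hom X unit_op" by (rule C_max[OF assms])
  have "uhom (C_obj T X) ?s z = min (uhom (C_obj T X) \<psi> z) (uhom (C_obj T X) \<phi> z)"
    if z: "z \<in> pos_hom X unit_op" for z
  proof (rule unit_eq_via_le)
    show "uhom (C_obj T X) ?s z \<in> {0..1}" using s z by (intro P.uhom_mem) auto
    have "uhom (C_obj T X) \<psi> z \<in> {0..1}" "uhom (C_obj T X) \<phi> z \<in> {0..1}"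
      using \<psi> \<phi> z by (auto simp only: P.uhom_mem pts_C)
    then show "min (uhom (C_obj T X) \<psi> z) (uhom (C_obj T X) \<phi> z) \<in> {0..1}" by auto
    fix v :: real assume v: "v \<in> {0..1}"
    have "T (max (\<psi> x) (\<phi> x)) v = max (T (\<psi> x) v) (T (\<phi> x) v)" if "x \<in> sp X" for x
      using v that by (intro T_max_left C_mem[OF X \<psi>] C_mem[OF X \<phi>])
    then show "v \<le> uhom (C_obj T X) ?s z \<longleftrightarrow> v \<le> min (uhom (C_obj T X) \<psi> z) (uhom (C_obj T X) \<phi> z)"
      using s \<psi> \<phi> z v by (auto simp add: P.le_uhom_iff simp del: atLeastAtMost_iff)
  qed
  then show ?thesis
    unfolding is_binary_sup_def using s \<psi> \<phi> by (auto simp: nat_le_C[OF X])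
qed

lemma C_is_copower:
  assumes X: "X \<in> PosComp" and \<psi>: "\<psi> \<in> pos_hom X unit_op" and u: "u \<in> {0..1}"
  shows "is_copower T (C_obj T X) \<psi> u (\<lambda>x\<in>sp X. T (\<psi> x) u)"
proof -
  interpret P: pointwise T "C_obj T X" "sp X" "\<lambda>x \<psi>. \<psi> x" using X by (rule pointwise_C)
  let ?s = "\<lambda>x\<in>sp X. T (\<psi> x) u"
  have s: "?s \<in> pos_hom X unit_op" by (rule C_copower[OF assms])
  have "uhom (C_obj T X) ?s z = hom01 T u (uhom (C_obj T X) \<psi> z)"
    if z: "z \<in> pos_hom X unit_op" for z
  proof (rule unit_eq_via_le)
    show "uhom (C_obj T X) ?s z \<in> {0..1}" using s z by (intro P.uhom_mem) auto
    have h: "uhom (C_obj T X) \<psi> z \<in> {0..1}" using \<psi> z by (intro P.uhom_mem) auto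
    then show "hom01 T u (uhom (C_obj T X) \<psi> z) \<in> {0..1}" using u by (intro hom_mem)
    fix v :: real assume v: "v \<in> {0..1}"
    have "v \<le> uhom (C_obj T X) ?s z \<longleftrightarrow> (\<forall>x\<in>sp X. T (T (\<psi> x) u) v \<le> z x)"
      using s z v by (simp add: P.le_uhom_iff del: atLeastAtMost_iff)
    also have "\<dots> \<longleftrightarrow> (\<forall>x\<in>sp X. T (\<psi> x) (T u v) \<le> z x)"
      using C_mem[OF X \<psi>] u v by (simp add: T_assoc del: atLeastAtMost_iff)
    also have "\<dots> \<longleftrightarrow> T u v \<le> uhom (C_obj T X) \<psi> z"
      using \<psi> z u v by (simp add: P.le_uhom_iff del: atLeastAtMost_iff)
    also have "\<dots> \<longleftrightarrow> v \<le> hom01 T u (uhom (C_obj T X) \<psi> z)"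
      using u v h by (rule adj)
    finally show "v \<le> uhom (C_obj T X) ?s z \<longleftrightarrow> v \<le> hom01 T u (uhom (C_obj T X) \<psi> z)" .
  qed
  then show ?thesis unfolding is_copower_def using s by auto
qed

section \<open>Lax homomorphisms\<close>

lemma MonObj_ucategory: "A \<in> MonObj T \<Longrightarrow> ucategory T A"
  by (simp add: MonObj_def umon_obj_def finsup_obj_def)

lemma MonObj_mul: "A \<in> MonObj T \<Longrightarrow> x \<in> pts A \<Longrightarrow> y \<in> pts A \<Longrightarrow> mul A x y \<in> pts A"
  by (simp add: MonObj_def umon_obj_def)

lemma MonObj_tminus: "A \<in> MonObj T \<Longrightarrow> x \<in> pts A \<Longrightarrow> u \<in> {0..1} \<Longrightarrow> tminus A x u \<in> pts A"
  by (simp add: MonObj_def)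

lemma nat_le_trans:
  assumes "ucategory T A" "a \<in> pts A" "b \<in> pts A" "c \<in> pts A" "nat_le A a b" "nat_le A b c"
  shows "nat_le A a c"
proof -
  have "T (uhom A a b) (uhom A b c) \<le> uhom A a c" "uhom A a c \<in> {0..1}"
    using assms(1-4) unfolding ucategory_def by blast+
  then show ?thesis using assms(5,6) by (simp add: nat_le_def T_1_left)
qed

lemma ufunctor_nat_le:
  assumes "ucategory T B" "ufunctor A B f" "a \<in> pts A" "b \<in> pts A" "nat_le A a b"
  shows "nat_le B (f a) (f b)"
proof -
  have "uhom A a b \<le> uhom B (f a) (f b)" "uhom B (f a) (f b) \<in> {0..1}"
    using assms(1-4) unfolding ufunctor_def ucategory_def by auto
  then show ?thesis using assms(5) by (simp add: nat_le_def)
qed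

lemma ufunctor_compose:
  assumes "ufunctor A B f" "ufunctor B D g" shows "ufunctor A D (compose (pts A) g f)"
  using assms unfolding ufunctor_def by (simp add: compose_def Pi_iff) (meson order_trans)

text \<open>Maps built with \<open>compose\<close> are \<open>undefined\<close> off the carrier, so
  composite diagrams can be compared only on \<open>pts D\<close>.\<close>

lemma is_colimit_cong:
  assumes "\<And>i. i \<in> pts D \<Longrightarrow> h i = h' i" "is_colimit T A D h w c"
  shows "is_colimit T A D h' w c"
proof -
  have "{hom01 T (w i) (uhom A (h i) y) | i. i \<in> pts D} = {hom01 T (w i) (uhom A (h' i) y) | i. i \<in> pts D}" for y
    using assms(1) by (intro Collect_cong iff_exI) auto
  then show ?thesis using assms(2) unfolding is_colimit_def by simp
qed

lemma fin_cocontinuous_compose: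
  assumes f: "fin_cocontinuous T A B f" and g: "fin_cocontinuous T B D g"
  shows "fin_cocontinuous T A D (compose (pts A) g f)"
  unfolding fin_cocontinuous_def
proof (intro conjI allI impI; (elim conjE)?)
  show "ufunctor A D (compose (pts A) g f)"
    using f g unfolding fin_cocontinuous_def by (blast intro: ufunctor_compose)
  fix E h w c assume 1: "fin_diagram T A E h w" and 2: "is_colimit T A E h w c"
  have "fin_diagram T B E (f \<circ> h) w"
    using 1 f unfolding fin_diagram_def fin_cocontinuous_def ufunctor_def
    by (auto simp: Pi_iff) (meson order_trans)
  moreover have "is_colimit T B E (f \<circ> h) w (f c)" using f 1 2 unfolding fin_cocontinuous_def by blast
  ultimately have "is_colimit T D E (g \<circ> (f \<circ> h)) w (g (f c))" using g unfolding fin_cocontinuous_def by blast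
  then have "is_colimit T D E (compose (pts A) g f \<circ> h) w (g (f c))"
    by (rule is_colimit_cong[rotated])
      (use 1 in \<open>auto simp: fin_diagram_def ufunctor_def Pi_iff compose_eq\<close>)
  then show "is_colimit T D E (compose (pts A) g f \<circ> h) w (compose (pts A) g f c)"
    using 2 unfolding is_colimit_def[of T A] by (simp add: compose_eq)
qed

lemma lax_homD:
  assumes "f \<in> lax_hom T A B"
  shows lax_hom_PiE: "f \<in> pts A \<rightarrow>\<^sub>E pts B"
    and lax_hom_ext: "f \<in> extensional (pts A)"
    and lax_hom_mem: "x \<in> pts A \<Longrightarrow> f x \<in> pts B"
    and lax_hom_fin_cocontinuous: "fin_cocontinuous T A B f"
    and lax_hom_ufunctor: "ufunctor A B f"
    and lax_hom_mul: "x \<in> pts A \<Longrightarrow> y \<in> pts A \<Longrightarrow> nat_le B (f (mul A x y)) (mul B (f x) (f y))"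
    and lax_hom_tminus: "x \<in> pts A \<Longrightarrow> u \<in> {0..1} \<Longrightarrow> f (tminus A x u) = tminus B (f x) u"
  using assms by (auto simp only: lax_hom_def fin_cocontinuous_def mem_Collect_eq PiE_iff)

lemma lax_hom_compose:
  assumes A: "A \<in> MonObj T" and B: "B \<in> MonObj T" and D: "D \<in> MonObj T"
    and f: "f \<in> lax_hom T A B" and g: "g \<in> lax_hom T B D"
  shows "compose (pts A) g f \<in> lax_hom T A D"
proof -
  note fp = lax_hom_mem[OF f] and gp = lax_hom_mem[OF g]
  note cl = MonObj_mul[OF A] MonObj_tminus[OF A]
  note clB = MonObj_mul[OF B] and clD = MonObj_mul[OF D]
  have "nat_le D (g (f (mul A x y))) (mul D (g (f x)) (g (f y)))" if "x \<in> pts A" "y \<in> pts A" for x y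
  proof (rule nat_le_trans[OF MonObj_ucategory[OF D]])
    show "nat_le D (g (f (mul A x y))) (g (mul B (f x) (f y)))"
      using that by (intro ufunctor_nat_le[OF MonObj_ucategory[OF D] lax_hom_ufunctor[OF g]] lax_hom_mul[OF f] fp clB cl(1))
    show "nat_le D (g (mul B (f x) (f y))) (mul D (g (f x)) (g (f y)))"
      using that by (intro lax_hom_mul[OF g] fp)
  qed (use that in \<open>simp_all add: fp gp clB clD cl\<close>)
  moreover have "g (f (tminus A x u)) = tminus D (g (f x)) u" if "x \<in> pts A" "u \<in> {0..1}" for x u
    unfolding lax_hom_tminus[OF f that] by (rule lax_hom_tminus[OF g fp[OF that(1)] that(2)])
  moreover have "fin_cocontinuous T A D (compose (pts A) g f)"
    by (rule fin_cocontinuous_compose[OF lax_hom_fin_cocontinuous[OF f] lax_hom_fin_cocontinuous[OF g]])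
  ultimately show ?thesis
    unfolding lax_hom_def mem_Collect_eq
    by (intro conjI ballI) (simp_all add: compose_eq cl gp fp compose_def del: atLeastAtMost_iff)
qed

lemma lax_hom_C_iff:
  assumes A: "A \<in> MonObj T" and X: "X \<in> PosComp" and f: "f \<in> pts A \<rightarrow>\<^sub>E pos_hom X unit_op"
  shows "f \<in> lax_hom T A (C_obj T X) \<longleftrightarrow> (\<forall>x\<in>sp X. (\<lambda>a\<in>pts A. f a x) \<in> lax_hom T A (unit_mon T))"
proof -
  interpret P: pointwise T "C_obj T X" "sp X" "\<lambda>x \<psi>. \<psi> x" using X by (rule pointwise_C)
  note uc = MonObj_ucategory[OF A]
  note cl = MonObj_mul[OF A] MonObj_tminus[OF A]
  have fp: "f a \<in> pos_hom X unit_op" if "a \<in> pts A" for a using f that by auto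
  have fm: "f a x \<in> {0..1}" if "a \<in> pts A" "x \<in> sp X" for a x using C_mem[OF X fp] that by blast
  \<comment> \<open>Morphisms are extensional, so the evaluated map must be restricted to
    \<open>pts A\<close>. Cocontinuity is unaffected, since diagrams and their colimits stay in
    \<open>pts A\<close>.\<close>
  have fc: "fin_cocontinuous T A (unit_mon T) (\<lambda>a. f a x) \<longleftrightarrow> fin_cocontinuous T A (unit_mon T) (\<lambda>a\<in>pts A. f a x)"
    for x
  proof -
    have h: "h i \<in> pts A" if "fin_diagram T A D h w" "i \<in> pts D" for D h w i
      using that unfolding fin_diagram_def ufunctor_def by auto
    have eq: "{T (w i) (f (h i) x) | i. i \<in> pts D} = {T (w i) ((\<lambda>a\<in>pts A. f a x) (h i)) | i. i \<in> pts D}"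
      if "fin_diagram T A D h w" for D h w
      using h[OF that] by (intro Collect_cong iff_exI) auto
    have "f c x = sup01 {T (w i) (f (h i) x) | i. i \<in> pts D} \<longleftrightarrow>
        (\<lambda>a\<in>pts A. f a x) c = sup01 {T (w i) ((\<lambda>a\<in>pts A. f a x) (h i)) | i. i \<in> pts D}"
      if "fin_diagram T A D h w \<and> is_colimit T A D h w c" for D h w c
      using that eq[of D h w] by (simp add: is_colimit_def)
    then show ?thesis
      unfolding fin_cocontinuous_unit_iff[OF uc] by (intro conj_cong) (simp_all add: Pi_iff)
  qed
  have "f \<in> lax_hom T A (C_obj T X) \<longleftrightarrow> (\<forall>x\<in>sp X. fin_cocontinuous T A (unit_mon T) (\<lambda>a. f a x)) \<and>
     (\<forall>a\<in>pts A. \<forall>b\<in>pts A. \<forall>x\<in>sp X. f (mul A a b) x \<le> T (f a x) (f b x)) \<and>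
     (\<forall>a\<in>pts A. \<forall>u\<in>{0..1}. \<forall>x\<in>sp X. f (tminus A a u) x = max (f a x - u) 0)"
  proof -
    have "f (tminus A a u) = (\<lambda>x\<in>sp X. max (f a x - u) 0) \<longleftrightarrow> (\<forall>x\<in>sp X. f (tminus A a u) x = max (f a x - u) 0)"
      if "a \<in> pts A" "u \<in> {0..1}" for a u
      using C_eqI[OF fp[OF cl(2)[OF that]] C_tminus[OF X fp[OF that(1)] that(2)]] by auto
    then show ?thesis
      unfolding lax_hom_def P.fin_cocontinuous_iff[OF uc] mem_Collect_eq pts_C mul_C tminus_C
      using f fp cl C_T[OF X]
      by (simp add: nat_le_C[OF X] PiE_iff Pi_iff del: atLeastAtMost_iff)
  qed
  moreover have "(\<lambda>a\<in>pts A. f a x) \<in> lax_hom T A (unit_mon T) \<longleftrightarrow> fin_cocontinuous T A (unit_mon T) (\<lambda>a. f a x) \<and>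
     (\<forall>a\<in>pts A. \<forall>b\<in>pts A. f (mul A a b) x \<le> T (f a x) (f b x)) \<and>
     (\<forall>a\<in>pts A. \<forall>u\<in>{0..1}. f (tminus A a u) x = max (f a x - u) 0)" if "x \<in> sp X" for x
    unfolding lax_hom_def fc using fm[OF _ that] cl
    by (simp add: nat_le_unit PiE_iff del: atLeastAtMost_iff)
  ultimately show ?thesis by auto
qed

lemma lax_hom_id:
  assumes A: "A \<in> MonObj T" shows "(\<lambda>a\<in>pts A. a) \<in> lax_hom T A A"
proof -
  note cl = MonObj_mul[OF A] MonObj_tminus[OF A]
  have uc: "uhom A x x = 1" if "x \<in> pts A" for x using MonObj_ucategory[OF A] that unfolding ucategory_def by auto
  have "fin_cocontinuous T A A (\<lambda>a\<in>pts A. a)"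
    unfolding fin_cocontinuous_def
  proof (intro conjI allI impI)
    fix D h w c assume *: "fin_diagram T A D h w \<and> is_colimit T A D h w c"
    then have "\<And>i. i \<in> pts D \<Longrightarrow> h i = ((\<lambda>a\<in>pts A. a) \<circ> h) i" "(\<lambda>a\<in>pts A. a) c = c"
      unfolding fin_diagram_def ufunctor_def is_colimit_def by auto
    then show "is_colimit T A D ((\<lambda>a\<in>pts A. a) \<circ> h) w ((\<lambda>a\<in>pts A. a) c)"
      using * is_colimit_cong by metis
  qed (simp add: ufunctor_def)
  then show ?thesis
    unfolding lax_hom_def by (simp add: cl uc nat_le_def del: atLeastAtMost_iff)
qed

text \<open>Evaluation at \<open>x\<close> is the component at \<open>x\<close> of the identity
  morphism of \<open>C X\<close>, to which \<open>lax_hom_C_iff\<close> applies.\<close>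

lemma ev_lax_hom:
  assumes X: "X \<in> PosComp" and x: "x \<in> sp X"
  shows "(\<lambda>\<psi>\<in>pos_hom X unit_op. \<psi> x) \<in> lax_hom T (C_obj T X) (unit_mon T)"
proof -
  have "(\<lambda>a\<in>pts (C_obj T X). (\<lambda>a\<in>pts (C_obj T X). a) a x) \<in> lax_hom T (C_obj T X) (unit_mon T)"
    using lax_hom_C_iff[OF C_obj_MonObj[OF X] X, of "\<lambda>a\<in>pts (C_obj T X). a"] lax_hom_id[OF C_obj_MonObj[OF X]] x
    by auto
  then show ?thesis by (simp cong: restrict_cong)
qed

end


section \<open>Order separation in compact pospaces\<close>

text \<open>The image is the projection of \<open>R\<close> cut down to \<open>K\<close>, and
  projection along a compact factor is a closed map.\<close>

lemma closedin_relation_Image: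
  assumes "compact_space X" "closedin (prod_topology X Y) R" "closedin X K"
  shows "closedin Y (R `` K)"
proof -
  have sub: "R \<subseteq> topspace X \<times> topspace Y" using closedin_subset[OF assms(2)] by simp
  have "closedin (prod_topology X Y) (R \<inter> K \<times> topspace Y)"
    using assms by (intro closedin_Int) (auto simp: closedin_prod_Times_iff)
  then have "closedin Y (snd ` (R \<inter> K \<times> topspace Y))"
    using closed_map_snd[OF assms(1)] unfolding closed_map_def by blast
  moreover have "snd ` (R \<inter> K \<times> topspace Y) = R `` K" using sub by force
  ultimately show ?thesis by simp
qed

lemma closedin_converse:
  assumes "closedin (prod_topology X Y) R"
  shows "closedin (prod_topology Y X) (R\<inverse>)"
proof -
  have "continuous_map (prod_topology Y X) (prod_topology X Y) (\<lambda>p. (snd p, fst p))"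
    by (intro continuous_map_pairedI continuous_map_fst continuous_map_snd)
  from closedin_continuous_map_preimage[OF this assms]
  have "closedin (prod_topology Y X) {p \<in> topspace (prod_topology Y X). (snd p, fst p) \<in> R}" .
  moreover have "{p \<in> topspace (prod_topology Y X). (snd p, fst p) \<in> R} = R\<inverse>"
    using closedin_subset[OF assms] by auto
  ultimately show ?thesis by simp
qed

text \<open>By reflexivity and antisymmetry the diagonal is the intersection of the closed order
  with its converse.\<close>

lemma PosComp_Hausdorff:
  assumes X: "X \<in> PosComp" shows "Hausdorff_space (tp X)"
proof -
  have "closedin (prod_topology (tp X) (tp X)) (ple X \<inter> (ple X)\<inverse>)"
    using PosComp_closed[OF X] closedin_converse by (intro closedin_Int) blast+
  moreover have "ple X \<inter> (ple X)\<inverse> = (\<lambda>x. (x, x)) ` sp X"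
    using ple_refl[OF X] ple_antisym[OF X] ple_points[OF X] by auto
  ultimately show ?thesis unfolding Hausdorff_space_closedin_diagonal by simp
qed

lemma closedin_up: "X \<in> PosComp \<Longrightarrow> closedin (tp X) K \<Longrightarrow> closedin (tp X) (ple X `` K)"
  by (rule closedin_relation_Image[OF PosComp_compact PosComp_closed])

lemma closedin_down: "X \<in> PosComp \<Longrightarrow> closedin (tp X) K \<Longrightarrow> closedin (tp X) ((ple X)\<inverse> `` K)"
  by (rule closedin_relation_Image[OF PosComp_compact closedin_converse[OF PosComp_closed]])

lemma closedin_point: "X \<in> PosComp \<Longrightarrow> x \<in> sp X \<Longrightarrow> closedin (tp X) {x}"
  by (simp add: PosComp_Hausdorff closedin_Hausdorff_singleton)

lemma upper_in_up: "X \<in> PosComp \<Longrightarrow> upper_in X (ple X `` K)"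
  unfolding upper_in_def by (auto dest: ple_points ple_trans)

lemma lower_in_down: "X \<in> PosComp \<Longrightarrow> lower_in X ((ple X)\<inverse> `` K)"
  unfolding lower_in_def by (auto dest: ple_points ple_trans)

lemma lower_in_Compl:
  assumes "X \<in> PosComp" shows "upper_in X A \<Longrightarrow> lower_in X (sp X - A)"
  unfolding lower_in_def upper_in_def using ple_points[OF assms] by auto

lemma upper_in_Compl:
  assumes "X \<in> PosComp" shows "lower_in X A \<Longrightarrow> upper_in X (sp X - A)"
  unfolding lower_in_def upper_in_def using ple_points[OF assms] by auto

lemma ordered_normal:
  assumes X: "X \<in> PosComp" and A: "closedin (tp X) A" "upper_in X A"
    and B: "closedin (tp X) B" "lower_in X B" and disj: "A \<inter> B = {}"
  obtains V K where "openin (tp X) V" "lower_in X V" "closedin (tp X) K" "lower_in X K"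
    "B \<subseteq> V" "V \<subseteq> K" "K \<inter> A = {}"
proof -
  have "normal_space (tp X)"
    using PosComp_compact[OF X] PosComp_Hausdorff[OF X] compact_Hausdorff_or_regular_imp_normal_space by blast
  then obtain U W where UW: "openin (tp X) U" "openin (tp X) W" "A \<subseteq> U" "B \<subseteq> W" "disjnt U W"
    using A(1) B(1) disj unfolding normal_space_def disjnt_def by metis
  \<comment> \<open>\<open>V\<close> is the largest lower set inside \<open>W\<close>, and
    \<open>K\<close> is the lower set generated by the complement of \<open>U\<close>. Up-sets and
    down-sets generated by closed sets are closed, so \<open>V\<close> is open and \<open>K\<close>
    is closed.\<close>
  define V where "V = sp X - ple X `` (sp X - W)"
  define K where "K = (ple X)\<inverse> `` (sp X - U)"
  show thesis
  proof
    show "openin (tp X) V" unfolding V_def using closedin_up[OF X, of "sp X - W"] UW by blast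
    show "closedin (tp X) K" unfolding K_def using closedin_down[OF X, of "sp X - U"] UW by blast
    show "lower_in X V" unfolding V_def by (intro lower_in_Compl upper_in_up X)
    show "lower_in X K" unfolding K_def by (intro lower_in_down X)
    show "B \<subseteq> V"
      using B(2) UW(4) closedin_subset[OF B(1)] ple_points[OF X] unfolding V_def lower_in_def by blast
    show "V \<subseteq> K"
    proof
      fix x assume "x \<in> V"
      then have x: "x \<in> sp X" "x \<notin> ple X `` (sp X - W)" unfolding V_def by auto
      then have "x \<in> W" using ple_refl[OF X x(1)] by blast
      then have "x \<in> sp X - U" using UW x(1) unfolding disjnt_def by blast
      then show "x \<in> K" unfolding K_def using ple_refl[OF X x(1)] by blast
    qed
    show "K \<inter> A = {}"
      using A(2) UW(3) unfolding K_def upper_in_def by blast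
  qed
qed

lemma dyadics_dense:
  fixes a b :: real
  assumes "0 \<le> a" "a < b" "b \<le> 1"
  obtains r where "r \<in> dyadics \<inter> {0..1}" "a < r" "r < b"
proof -
  obtain n where n: "(1 / 2 :: real) ^ n < b - a"
    using real_arch_pow_inv[of "b - a" "1 / 2"] assms by auto
  \<comment> \<open>\<open>m / 2 ^ n\<close> is the first fraction with denominator
    \<open>2 ^ n\<close> strictly above \<open>a\<close>; it exceeds \<open>a\<close> by at most
    \<open>1 / 2 ^ n\<close>.\<close>
  define m where "m = nat \<lfloor>a * 2 ^ n\<rfloor> + 1"
  have "0 \<le> a * 2 ^ n" using assms by simp
  then have "real m = of_int \<lfloor>a * 2 ^ n\<rfloor> + 1" by (simp add: m_def)
  then have "a * 2 ^ n < real m" "real m \<le> a * 2 ^ n + 1" by linarith+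
  then have "a < real m / 2 ^ n" "real m / 2 ^ n \<le> a + 1 / 2 ^ n"
    by (simp_all add: field_simps)
  moreover have "a + 1 / 2 ^ n < b" using n by (simp add: power_divide)
  moreover define r where "r = real m / 2 ^ n"
  ultimately have "a < r" "r < b" by linarith+
  moreover have "r \<in> dyadics" unfolding dyadics_def r_def by blast
  ultimately show thesis using assms by (intro that[of r] IntI) simp_all
qed

text \<open>Nachbin's ordered version of Urysohn's lemma; the dyadic family consists of open lower sets.\<close>

lemma ordered_Urysohn:
  assumes X: "X \<in> PosComp" and A: "closedin (tp X) A" "upper_in X A"
    and B: "closedin (tp X) B" "lower_in X B" and disj: "A \<inter> B = {}"
  obtains \<psi> where "\<psi> \<in> pos_hom X unit_op" "\<And>x. x \<in> A \<Longrightarrow> \<psi> x = 0" "\<And>x. x \<in> B \<Longrightarrow> \<psi> x = 1"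
proof -
  \<comment> \<open>The closed lower set \<open>K\<close> plays the part of a closure of
    \<open>U\<close> inside \<open>W\<close>. \<open>R\<close> is transitive and, by
    \<open>ordered_normal\<close>, interpolative, as the recursion over dyadic fractions
    requires.\<close>
  define R where "R U W \<longleftrightarrow> openin (tp X) U \<and> lower_in X U \<and> openin (tp X) W \<and> lower_in X W \<and>
    (\<exists>K. closedin (tp X) K \<and> lower_in X K \<and> U \<subseteq> K \<and> K \<subseteq> W)" for U W
  have step: "\<exists>V. R U V \<and> R V W" if UW: "R U W" for U W
  proof -
    obtain K where K: "closedin (tp X) K" "lower_in X K" "U \<subseteq> K" "K \<subseteq> W" using UW unfolding R_def by blast
    have W: "openin (tp X) U" "lower_in X U" "openin (tp X) W" "lower_in X W" using UW unfolding R_def by simp_all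
    have "closedin (tp X) (sp X - W)" using W by blast
    moreover have "upper_in X (sp X - W)" by (rule upper_in_Compl[OF X W(4)])
    moreover have "(sp X - W) \<inter> K = {}" using K(4) by blast
    ultimately obtain V K' where V: "openin (tp X) V" "lower_in X V" and K': "closedin (tp X) K'" "lower_in X K'"
      and sub: "K \<subseteq> V" "V \<subseteq> K'" "K' \<inter> (sp X - W) = {}"
      using ordered_normal[OF X _ _ K(1,2)] by metis
    have "K' \<subseteq> W" using sub(3) closedin_subset[OF K'(1)] by blast
    then have "R U V" "R V W"
      unfolding R_def using W V K K' sub by auto
    then show ?thesis by blast
  qed
  have trans: "R U W" if UV: "R U V" and VW: "R V W" for U V W
  proof -
    obtain K where "closedin (tp X) K" "lower_in X K" "U \<subseteq> K" "K \<subseteq> V" using UV unfolding R_def by auto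
    moreover have "V \<subseteq> W" using VW unfolding R_def by auto
    ultimately show ?thesis using UV VW unfolding R_def by auto
  qed
  obtain V K where VK: "openin (tp X) V" "lower_in X V" "closedin (tp X) K" "lower_in X K"
    "B \<subseteq> V" "V \<subseteq> K" "K \<inter> A = {}"
    using ordered_normal[OF assms] .
  have "R V (sp X - A)"
    unfolding R_def
  proof (intro conjI exI)
    show "openin (tp X) (sp X - A)" using A(1) by blast
    show "K \<subseteq> sp X - A" using VK(7) closedin_subset[OF VK(3)] by blast
  qed (use VK lower_in_Compl[OF X A(2)] in auto)
  then have "\<exists>G :: real \<Rightarrow> 'a set. G 0 = V \<and> G 1 = sp X - A \<and>
      (\<forall>r\<in>dyadics \<inter> {0..1}. \<forall>s\<in>dyadics \<inter> {0..1}. r < s \<longrightarrow> R (G r) (G s))"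
    by (rule recursion_on_dyadic_fractions) (fact step, fact trans)
  then obtain G :: "real \<Rightarrow> 'a set" where G0: "G 0 = V" and G1: "G 1 = sp X - A"
    and G: "\<And>r s. r \<in> dyadics \<inter> {0..1} \<Longrightarrow> s \<in> dyadics \<inter> {0..1} \<Longrightarrow> r < s \<Longrightarrow> R (G r) (G s)"
    by metis
  have 0: "0 \<in> dyadics \<inter> {0..1::real}" and 1: "1 \<in> dyadics \<inter> {0..1::real}"
    by (force simp: dyadics_def)+
  have Gr: "openin (tp X) (G r)" "lower_in X (G r)" if "r \<in> dyadics \<inter> {0..1}" for r
  proof -
    have "r = 0 \<or> 0 < r" using that by auto
    then show "openin (tp X) (G r)" "lower_in X (G r)"
      using G[OF 0 that] VK(1,2) G0 unfolding R_def by auto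
  qed
  \<comment> \<open>Inserting 1 gives \<open>f\<close> the value 1 at the points outside every
    \<open>G r\<close>.\<close>
  define S where "S x = insert 1 {r \<in> dyadics \<inter> {0..1}. x \<in> G r}" for x
  define f where "f x = Inf (S x)" for x
  have bdd: "bdd_below (S x)" for x by (rule bdd_belowI[of _ 0]) (auto simp: S_def)
  have f_less: "f x < t \<longleftrightarrow> 1 < t \<or> (\<exists>r\<in>dyadics \<inter> {0..1}. r < t \<and> x \<in> G r)" for x t
    unfolding f_def using bdd by (subst cInf_less_iff) (auto simp: S_def)
  have f_mem: "f x \<in> {0..1}" for x
  proof -
    have "\<not> f x < 0" by (auto simp: f_less)
    moreover have "f x \<le> 1" unfolding f_def using bdd by (intro cInf_lower) (auto simp: S_def)
    ultimately show ?thesis by auto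
  qed
  have f_mono: "f x \<le> f y" if "(x, y) \<in> ple X" for x y
    unfolding f_def
  proof (rule cInf_superset_mono)
    show "S y \<subseteq> S x" using Gr(2) that unfolding S_def lower_in_def by blast
  qed (use bdd in \<open>auto simp: S_def\<close>)
  have open1: "openin (tp X) {x \<in> sp X. f x < t}" for t
  proof (cases "1 < t")
    case True
    then have "{x \<in> sp X. f x < t} = sp X" by (auto simp: f_less)
    then show ?thesis by simp
  next
    case False
    then have "{x \<in> sp X. f x < t} = (\<Union>r\<in>{r \<in> dyadics \<inter> {0..1}. r < t}. G r)"
      using openin_subset[OF Gr(1)] by (auto simp: f_less)
    moreover have "openin (tp X) (\<Union>r\<in>{r \<in> dyadics \<inter> {0..1}. r < t}. G r)"
      using Gr(1) by (intro openin_Union) blast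
    ultimately show ?thesis by simp
  qed
  have open2: "openin (tp X) {x \<in> sp X. t < f x}" for t
  proof (subst openin_subopen, intro ballI)
    fix x assume "x \<in> {x \<in> sp X. t < f x}"
    then have x: "x \<in> sp X" "t < f x" by auto
    show "\<exists>U. openin (tp X) U \<and> x \<in> U \<and> U \<subseteq> {x \<in> sp X. t < f x}"
    proof (cases "t < 0")
      case True
      then have "{x \<in> sp X. t < f x} = sp X" using f_mem by (auto intro: less_le_trans)
      then show ?thesis using x by (intro exI[of _ "sp X"]) auto
    next
      case False
      then obtain s where s: "s \<in> dyadics \<inter> {0..1}" "t < s" "s < f x"
        using dyadics_dense[of t "f x"] x f_mem[of x] by auto
      obtain r where r: "r \<in> dyadics \<inter> {0..1}" "t < r" "r < s"
        using dyadics_dense[of t s] s False by auto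
      \<comment> \<open>The complement of \<open>K\<close> is the neighbourhood sought: it contains
        \<open>x\<close>, because \<open>s < f x\<close> keeps \<open>x\<close> out of
        \<open>G s\<close>, and on it \<open>f\<close> is at least \<open>r\<close>, because it
        avoids \<open>G r\<close>.\<close>
      obtain K where K: "closedin (tp X) K" "G r \<subseteq> K" "K \<subseteq> G s" using G[OF r(1) s(1) r(3)] unfolding R_def by blast
      have "x \<notin> G s"
      proof
        assume "x \<in> G s"
        then have "f x \<le> s" unfolding f_def using bdd s by (intro cInf_lower) (auto simp: S_def)
        then show False using s by simp
      qed
      moreover have "t < f y" if "y \<in> sp X - K" for y
      proof -
        have "\<not> f y < r"
        proof
          assume "f y < r"
          then obtain q where q: "q \<in> dyadics \<inter> {0..1}" "q < r" "y \<in> G q" using r by (auto simp: f_less)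
          then have "y \<in> G r" using G[OF q(1) r(1) q(2)] unfolding R_def by blast
          then show False using K that by blast
        qed
        then show ?thesis using r by simp
      qed
      ultimately show ?thesis using K x by (intro exI[of _ "sp X - K"]) auto
    qed
  qed
  have cont: "continuous_map (tp X) euclideanreal f"
    unfolding continuous_map_upper_lower_semicontinuous_lt using open1 open2 by blast
  \<comment> \<open>\<open>f\<close> is monotone because the sets \<open>G r\<close> are lower;
    elements of \<open>C X\<close> reverse the order, hence the passage to
    \<open>1 - f\<close>.\<close>
  have "continuous_map (tp X) euclideanreal (\<lambda>x. 1 - f x)"
    by (intro continuous_map_diff cont) simp
  then have "continuous_map (tp X) euclideanreal (\<lambda>x\<in>sp X. 1 - f x)"
    by (rule continuous_map_eq) simp
  then have mem: "(\<lambda>x\<in>sp X. 1 - f x) \<in> pos_hom X unit_op"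
    using f_mem f_mono ple_points[OF X] by (auto simp: pos_hom_unit_iff[OF X])
  show thesis
  proof (rule that[OF mem])
    show "(\<lambda>x\<in>sp X. 1 - f x) x = 0" if x: "x \<in> A" for x
    proof -
      have "\<not> f x < 1"
      proof
        assume "f x < 1"
        then obtain r where "r \<in> dyadics \<inter> {0..1}" "r < 1" "x \<in> G r" by (auto simp: f_less)
        then have "x \<in> G 1" using G[of r 1] 1 unfolding R_def by blast
        then show False using G1 x by blast
      qed
      then have "f x = 1" using f_mem[of x] by auto
      then show ?thesis using x closedin_subset[OF A(1)] by auto
    qed
    show "(\<lambda>x\<in>sp X. 1 - f x) x = 1" if x: "x \<in> B" for x
    proof -
      have "f x \<le> 0" unfolding f_def using bdd x 0 VK(5) G0 by (intro cInf_lower) (auto simp: S_def)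
      then have "f x = 0" using f_mem[of x] by auto
      then show ?thesis using x closedin_subset[OF B(1)] by auto
    qed
  qed
qed

text \<open>Since \<open>A\<close> is upper and misses \<open>x\<close>, it is disjoint from the
  closed lower set generated by \<open>x\<close>, and \<open>ordered_Urysohn\<close>
  applies.\<close>

lemma separating_function:
  assumes X: "X \<in> PosComp" and A: "A \<in> closed_upper X" and x: "x \<in> sp X" "x \<notin> A"
  obtains \<psi> where "\<psi> \<in> pos_hom X unit_op" "\<And>y. y \<in> A \<Longrightarrow> \<psi> y = 0" "\<psi> x = 1"
proof -
  have "closedin (tp X) ((ple X)\<inverse> `` {x})" "lower_in X ((ple X)\<inverse> `` {x})"
    using closedin_down[OF X closedin_point[OF X x(1)]] lower_in_down[OF X] by auto
  moreover have "A \<inter> (ple X)\<inverse> `` {x} = {}" using A x unfolding closed_upper_def upper_in_def by auto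
  ultimately obtain \<psi> where "\<psi> \<in> pos_hom X unit_op" "\<And>y. y \<in> A \<Longrightarrow> \<psi> y = 0" "\<And>y. y \<in> (ple X)\<inverse> `` {x} \<Longrightarrow> \<psi> y = 1"
    using ordered_Urysohn[OF X _ _ _ _, of A "(ple X)\<inverse> `` {x}"] A unfolding closed_upper_def by blast
  then show thesis using that ple_refl[OF X x(1)] by auto
qed

lemma up_closed_upper:
  assumes "X \<in> PosComp" "x \<in> sp X" shows "{y. (x, y) \<in> ple X} \<in> closed_upper X"
proof -
  have "{y. (x, y) \<in> ple X} = ple X `` {x}" by auto
  then show ?thesis
    unfolding closed_upper_def using closedin_up[OF assms(1) closedin_point[OF assms]] upper_in_up[OF assms(1)] by auto
qed

text \<open>If \<open>a\<close> were not below \<open>b\<close>, a function vanishing above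
  \<open>a\<close> with value 1 at \<open>b\<close> would distinguish them. Applied in both
  directions, this leaves only antisymmetry.\<close>

lemma pos_hom_unit_separates:
  assumes X: "X \<in> PosComp" and xy: "x \<in> sp X" "y \<in> sp X" and "\<And>\<psi>. \<psi> \<in> pos_hom X unit_op \<Longrightarrow> \<psi> x = \<psi> y"
  shows "x = y"
proof -
  have "(a, b) \<in> ple X" if ab: "a \<in> sp X" "b \<in> sp X" "\<And>\<psi>. \<psi> \<in> pos_hom X unit_op \<Longrightarrow> \<psi> a = \<psi> b" for a b
  proof (rule ccontr)
    assume "(a, b) \<notin> ple X"
    then obtain \<psi> where \<psi>: "\<psi> \<in> pos_hom X unit_op" "\<And>y. y \<in> {y. (a, y) \<in> ple X} \<Longrightarrow> \<psi> y = 0" "\<psi> b = 1"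
      using separating_function[OF X up_closed_upper[OF X ab(1)] ab(2)] by auto
    have "\<psi> a = 0" using ple_refl[OF X ab(1)] by (intro \<psi>(2)) simp
    then show False using ab(3)[OF \<psi>(1)] \<psi>(3) by simp
  qed
  from ple_antisym[OF X this[OF xy assms(4)] this[OF xy(2,1) assms(4)[symmetric]]] show ?thesis .
qed

text \<open>A finite subfamily of a directed family is contained in one member. Families of
  functions closed under \<open>max\<close> or \<open>T\<close>, or of lower bounds for one
  function, thus provide a single witness on a compact set.\<close>

lemma compactin_directed_cover:
  assumes K: "compactin X K" and ne: "P \<noteq> {}" and op: "\<And>p. p \<in> P \<Longrightarrow> openin X (Q p)"
    and cover: "\<And>x. x \<in> K \<Longrightarrow> \<exists>p\<in>P. x \<in> Q p"
    and dir: "\<And>p q. p \<in> P \<Longrightarrow> q \<in> P \<Longrightarrow> \<exists>r\<in>P. Q p \<union> Q q \<subseteq> Q r"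
  shows "\<exists>p\<in>P. K \<subseteq> Q p"
proof -
  have "K \<subseteq> \<Union>(Q ` P)" "\<And>U. U \<in> Q ` P \<Longrightarrow> openin X U" using cover op by blast+
  then obtain \<F> where F: "finite \<F>" "\<F> \<subseteq> Q ` P" "K \<subseteq> \<Union>\<F>"
    using K[unfolded compactin_def, THEN conjunct2, rule_format, of "Q ` P"] by auto
  have "\<exists>p\<in>P. \<Union>\<F> \<subseteq> Q p" using F(1,2)
  proof (induction \<F>)
    case empty
    then show ?case using ne by auto
  next
    case (insert U \<F>)
    then obtain p where p: "p \<in> P" "\<Union>\<F> \<subseteq> Q p" using insert.IH by auto
    obtain q where q: "q \<in> P" "U = Q q" using insert.prems by blast
    obtain r where "r \<in> P" "Q p \<union> Q q \<subseteq> Q r" using dir[OF p(1) q(1)] by blast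
    then show ?case using p q by (intro bexI[of _ r]) auto
  qed
  then show ?thesis using F(3) by (meson order_trans)
qed


section \<open>The functors C and G and the evaluation maps\<close>

lemma closedin_Collect_ball:
  assumes "\<And>i. i \<in> I \<Longrightarrow> closedin X {x \<in> topspace X. Q i x}"
  shows "closedin X {x \<in> topspace X. \<forall>i\<in>I. Q i x}"
proof (cases "I = {}")
  case False
  then have "{x \<in> topspace X. \<forall>i\<in>I. Q i x} = (\<Inter>i\<in>I. {x \<in> topspace X. Q i x})" by auto
  then show ?thesis using closedin_INT[OF False assms] by simp
qed simp

lemma closedin_Collect_imp:
  assumes "P \<Longrightarrow> closedin X {x \<in> topspace X. Q x}"
  shows "closedin X {x \<in> topspace X. P \<longrightarrow> Q x}"
  using assms by (cases P) auto

lemma closedin_Collect_conj: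
  assumes "closedin X {x \<in> topspace X. P x}" "closedin X {x \<in> topspace X. Q x}"
  shows "closedin X {x \<in> topspace X. P x \<and> Q x}"
proof -
  have "{x \<in> topspace X. P x \<and> Q x} = {x \<in> topspace X. P x} \<inter> {x \<in> topspace X. Q x}" by auto
  then show ?thesis using closedin_Int[OF assms] by simp
qed

lemma closedin_eq_fun:
  fixes f g :: "'a \<Rightarrow> real"
  assumes "continuous_map X euclideanreal f" "continuous_map X euclideanreal g"
  shows "closedin X {x \<in> topspace X. f x = g x}"
proof -
  have "{x \<in> topspace X. f x = g x} = {x \<in> topspace X. f x \<le> g x \<and> g x \<le> f x}" by auto
  then show ?thesis
    using closedin_Collect_conj[OF closedin_le_fun[OF assms] closedin_le_fun[OF assms(2,1)]] by simp
qed

lemma topspace_initial_topology [simp]: "topspace (initial_topology S I Y e) = S"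
  unfolding initial_topology_def topology_generated_by_topspace by auto

lemma continuous_map_initial_topology:
  assumes e: "\<And>i p. i \<in> I \<Longrightarrow> p \<in> S \<Longrightarrow> e i p \<in> topspace Y"
  shows "continuous_map Z (initial_topology S I Y e) f \<longleftrightarrow>
    f \<in> topspace Z \<rightarrow> S \<and> (\<forall>i\<in>I. continuous_map Z Y (\<lambda>z. e i (f z)))" (is "?l \<longleftrightarrow> ?r")
proof
  assume ?l
  then have "(\<forall>U. U \<in> insert S {{p \<in> S. e i p \<in> U} | i U. i \<in> I \<and> openin Y U} \<longrightarrow>
      openin Z (f -` U \<inter> topspace Z)) \<and>
    f ` topspace Z \<subseteq> \<Union> (insert S {{p \<in> S. e i p \<in> U} | i U. i \<in> I \<and> openin Y U})"
    unfolding initial_topology_def continuous_on_generated_topo_iff .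
  note * = this[THEN conjunct1, rule_format] and fS = this[THEN conjunct2]
  have f: "f \<in> topspace Z \<rightarrow> S" using fS by auto
  have "continuous_map Z Y (\<lambda>z. e i (f z))" if i: "i \<in> I" for i
    unfolding continuous_map_def
  proof (intro conjI allI impI)
    show "(\<lambda>z. e i (f z)) \<in> topspace Z \<rightarrow> topspace Y" using f e i by auto
    fix U assume U: "openin Y U"
    have "openin Z (f -` {p \<in> S. e i p \<in> U} \<inter> topspace Z)" by (rule *) (use i U in blast)
    moreover have "f -` {p \<in> S. e i p \<in> U} \<inter> topspace Z = {x \<in> topspace Z. e i (f x) \<in> U}" using f by auto
    ultimately show "openin Z {x \<in> topspace Z. e i (f x) \<in> U}" by simp
  qed
  then show ?r using f by blast
next
  assume r: ?r
  show ?l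
    unfolding initial_topology_def
  proof (rule continuous_on_generated_topo)
    show "f ` topspace Z \<subseteq> \<Union> (insert S {{p \<in> S. e i p \<in> U} | i U. i \<in> I \<and> openin Y U})" using r by auto
    fix U assume "U \<in> insert S {{p \<in> S. e i p \<in> U} | i U. i \<in> I \<and> openin Y U}"
    then consider "U = S" | i W where "i \<in> I" "openin Y W" "U = {p \<in> S. e i p \<in> W}" by blast
    then show "openin Z (f -` U \<inter> topspace Z)"
    proof cases
      case 1
      then have "f -` U \<inter> topspace Z = topspace Z" using r by auto
      then show ?thesis by simp
    next
      case 2
      then have "f -` U \<inter> topspace Z = {x \<in> topspace Z. e i (f x) \<in> W}" using r by auto
      moreover have "openin Z {x \<in> topspace Z. e i (f x) \<in> W}"
        by (rule openin_continuous_map_preimage[of _ Y]) (use r 2 in auto)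
      ultimately show ?thesis by simp
    qed
  qed
qed

lemma pos_hom_mem: "f \<in> pos_hom X Y \<Longrightarrow> x \<in> sp X \<Longrightarrow> f x \<in> sp Y"
  unfolding pos_hom_def by (auto dest: PiE_mem)

lemma pos_hom_compose:
  assumes f: "f \<in> pos_hom X Y" and g: "g \<in> pos_hom Y Z" and X: "ple X \<subseteq> sp X \<times> sp X"
  shows "compose (sp X) g f \<in> pos_hom X Z"
proof -
  have "continuous_map (tp X) (tp Z) (g \<circ> f)"
    using f g unfolding pos_hom_def by (auto intro: continuous_map_compose)
  then have "continuous_map (tp X) (tp Z) (compose (sp X) g f)"
    by (rule continuous_map_eq) (simp add: compose_eq)
  moreover have "compose (sp X) g f \<in> sp X \<rightarrow>\<^sub>E sp Z"
    using pos_hom_mem[OF f] pos_hom_mem[OF g] by (auto simp: compose_def)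
  moreover have "(compose (sp X) g f x, compose (sp X) g f y) \<in> ple Z" if "(x, y) \<in> ple X" for x y
  proof -
    have "(g (f x), g (f y)) \<in> ple Z" using f g that unfolding pos_hom_def by blast
    then show ?thesis using X that by (auto simp: compose_eq)
  qed
  ultimately show ?thesis unfolding pos_hom_def by blast
qed

context tnorm begin

lemma sp_G [simp]: "sp (G_obj T A) = lax_hom T A (unit_mon T)"
  by (simp add: G_obj_def)

lemma ple_G: "(\<Phi>, \<Phi>') \<in> ple (G_obj T A) \<longleftrightarrow>
    \<Phi> \<in> lax_hom T A (unit_mon T) \<and> \<Phi>' \<in> lax_hom T A (unit_mon T) \<and> (\<forall>a\<in>pts A. \<Phi>' a \<le> \<Phi> a)"
  using lax_hom_mem[of \<Phi> A "unit_mon T"] lax_hom_mem[of \<Phi>' A "unit_mon T"]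
  unfolding G_obj_def by (auto simp add: ple_unit_op simp del: atLeastAtMost_iff)

lemma continuous_map_into_G:
  "continuous_map Z (tp (G_obj T A)) f \<longleftrightarrow>
    f \<in> topspace Z \<rightarrow> lax_hom T A (unit_mon T) \<and> (\<forall>a\<in>pts A. continuous_map Z euclideanreal (\<lambda>z. f z a))"
proof -
  have *: "continuous_map Z (tp (G_obj T A)) f \<longleftrightarrow>
    f \<in> topspace Z \<rightarrow> lax_hom T A (unit_mon T) \<and> (\<forall>a\<in>pts A. continuous_map Z (tp unit_op) (\<lambda>z. f z a))"
    unfolding G_obj_def using lax_hom_mem[of _ A "unit_mon T"]
    by (simp, subst continuous_map_initial_topology) auto
  have "(\<lambda>z. f z a) \<in> topspace Z \<rightarrow> {0..1}" if "f \<in> topspace Z \<rightarrow> lax_hom T A (unit_mon T)" "a \<in> pts A" for a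
    using lax_hom_mem[of _ A "unit_mon T" a] that by fastforce
  then show ?thesis unfolding * continuous_map_unit_op by blast
qed

lemma continuous_map_G_eval: "a \<in> pts A \<Longrightarrow> continuous_map (tp (G_obj T A)) euclideanreal (\<lambda>\<Phi>. \<Phi> a)"
  using continuous_map_into_G[of "tp (G_obj T A)" A "\<lambda>\<Phi>. \<Phi>"] by simp

section \<open>Compactness of the spaces \<open>G A\<close>\<close>

lemma lax_hom_unit_iff:
  assumes A: "A \<in> MonObj T"
  shows "f \<in> lax_hom T A (unit_mon T) \<longleftrightarrow> f \<in> pts A \<rightarrow>\<^sub>E {0..1} \<and>
    (\<forall>a\<in>pts A. \<forall>b\<in>pts A. T (f a) (uhom A a b) \<le> f b) \<and>
    (\<forall>D h w c. fin_diagram T A D h w \<and> is_colimit T A D h w c \<longrightarrow>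
      f c = sup01 {T (w i) (f (h i)) | i. i \<in> pts D}) \<and>
    (\<forall>a\<in>pts A. \<forall>b\<in>pts A. f (mul A a b) \<le> T (f a) (f b)) \<and>
    (\<forall>a\<in>pts A. \<forall>u\<in>{0..1}. f (tminus A a u) = max (f a - u) 0)"
proof -
  have "nat_le (unit_mon T) (f (mul A a b)) (T (f a) (f b)) \<longleftrightarrow> f (mul A a b) \<le> T (f a) (f b)"
    if "f \<in> pts A \<rightarrow>\<^sub>E {0..1}" "a \<in> pts A" "b \<in> pts A" for a b
    using that MonObj_mul[OF A that(2,3)] by (intro nat_le_unit T_mem PiE_mem[OF that(1)])
  moreover have "f \<in> pts A \<rightarrow> {0..1}" if "f \<in> pts A \<rightarrow>\<^sub>E {0..1}" using that by (simp add: PiE_def)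
  ultimately show ?thesis
    unfolding lax_hom_def mem_Collect_eq fin_cocontinuous_unit_iff[OF MonObj_ucategory[OF A]]
      pts_unit mul_unit tminus_unit by blast
qed

lemma cube_PosComp:
  fixes I :: "'i set"
  defines "Z \<equiv> \<lparr>tp = product_topology (\<lambda>_. top_of_set {0..1::real}) I,
    ple = Id_on (I \<rightarrow>\<^sub>E {0..1})\<rparr>"
  shows "Z \<in> PosComp" and "i \<in> I \<Longrightarrow> (\<lambda>f\<in>sp Z. f i) \<in> pos_hom Z unit_op"
proof -
  have sp: "sp Z = I \<rightarrow>\<^sub>E {0..1}" by (simp add: Z_def)
  have H: "Hausdorff_space (tp Z)"
    unfolding Z_def by (auto simp: Hausdorff_space_product_topology Hausdorff_space_subtopology)
  have "ple Z = (\<lambda>x. (x, x)) ` sp Z" unfolding sp by (auto simp: Z_def)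
  then have "closedin (prod_topology (tp Z) (tp Z)) (ple Z)"
    using H unfolding Hausdorff_space_closedin_diagonal by simp
  moreover have "compact_space (tp Z)"
    unfolding Z_def by (auto simp: compact_space_product_topology compact_space_subtopology)
  moreover have "partial_order_on (sp Z) (ple Z)"
    unfolding sp by (auto simp: Z_def partial_order_on_def preorder_on_def refl_on_def trans_def antisym_def)
  ultimately show Z: "Z \<in> PosComp" unfolding PosComp_def by blast
  assume i: "i \<in> I"
  have "continuous_map (tp Z) (top_of_set {0..1}) (\<lambda>f. f i)"
    unfolding Z_def using continuous_map_product_projection[OF i, of "\<lambda>_. top_of_set {0..1::real}"] by simp
  then have "continuous_map (tp Z) euclideanreal (\<lambda>f. f i)" by (rule continuous_map_into_fulltopology)
  then have "continuous_map (tp Z) euclideanreal (\<lambda>f\<in>sp Z. f i)"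
    by (rule continuous_map_eq) simp
  then show "(\<lambda>f\<in>sp Z. f i) \<in> pos_hom Z unit_op"
    unfolding pos_hom_unit_iff[OF Z] sp using i by (auto simp: Z_def)
qed

text \<open>A cube with the discrete order is a pospace; the operations on \<open>C\<close> of it
  show that the conditions defining \<open>G A\<close> are closed.\<close>

lemma compact_space_G:
  assumes A: "A \<in> MonObj T" shows "compact_space (tp (G_obj T A))"
proof -
  define Z where "Z = \<lparr>tp = product_topology (\<lambda>_. top_of_set {0..1::real}) (pts A),
    ple = Id_on (pts A \<rightarrow>\<^sub>E {0..1})\<rparr>"
  have Z: "Z \<in> PosComp" unfolding Z_def by (rule cube_PosComp)
  have sp: "sp Z = pts A \<rightarrow>\<^sub>E {0..1}" by (simp add: Z_def)
  define p where "p a = (\<lambda>f\<in>sp Z. f a)" for a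
  have p: "p a \<in> pos_hom Z unit_op" if "a \<in> pts A" for a
    unfolding p_def Z_def by (rule cube_PosComp) (rule that)
  have cont: "continuous_map (tp Z) euclideanreal g"
    if "\<phi> \<in> pos_hom Z unit_op" "\<And>f. f \<in> sp Z \<Longrightarrow> \<phi> f = g f" for \<phi> g
    by (rule continuous_map_eq[OF C_cont[OF Z that(1)]]) (use that(2) in auto)
  have c1: "continuous_map (tp Z) euclideanreal (\<lambda>f. f a)" if "a \<in> pts A" for a
    by (rule cont[OF p[OF that]]) (simp add: p_def)
  have c2: "continuous_map (tp Z) euclideanreal (\<lambda>f. T (f a) u)" if "a \<in> pts A" "u \<in> {0..1}" for a u
    by (rule cont[OF C_copower[OF Z p that(2)]]) (simp_all add: p_def that)
  have c3: "continuous_map (tp Z) euclideanreal (\<lambda>f. T (f a) (f b))" if "a \<in> pts A" "b \<in> pts A" for a b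
    by (rule cont[OF C_T[OF Z p p]]) (simp_all add: p_def that)
  have c4: "continuous_map (tp Z) euclideanreal (\<lambda>f. max (f a - u) 0)" if "a \<in> pts A" "u \<in> {0..1}" for a u
    by (rule cont[OF C_tminus[OF Z p that(2)]]) (simp_all add: p_def that)
  have c5: "continuous_map (tp Z) euclideanreal (\<lambda>f. sup01 {T (w i) (f (h i)) | i. i \<in> pts D})"
    if "fin_diagram T A D h w" for D h w
  proof (rule cont[OF C_finite_sup[OF Z, of "pts D" w "\<lambda>i. p (h i)"]])
    have h: "h i \<in> pts A" "w i \<in> {0..1}" if "i \<in> pts D" for i
      using \<open>fin_diagram T A D h w\<close> that unfolding fin_diagram_def ufunctor_def uweight_def by auto
    show "finite (pts D)" using that unfolding fin_diagram_def by blast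
    show "w i \<in> {0..1} \<and> p (h i) \<in> pos_hom Z unit_op" if "i \<in> pts D" for i
      using h[OF that] p by blast
    show "(\<lambda>f\<in>sp Z. sup01 {T (w i) (p (h i) f) | i. i \<in> pts D}) f = sup01 {T (w i) (f (h i)) | i. i \<in> pts D}"
      if "f \<in> sp Z" for f
      using that by (simp add: p_def)
  qed
  have uh: "uhom A a b \<in> {0..1}" if "a \<in> pts A" "b \<in> pts A" for a b
    using MonObj_ucategory[OF A] that unfolding ucategory_def by blast
  define L where "L = lax_hom T A (unit_mon T)"
  \<comment> \<open>The quantifiers over diagrams are packed into one bounded quantifier over
    tuples, so that \<open>closedin_Collect_ball\<close> treats all conditions alike.\<close>
  have L: "L = {f \<in> topspace (tp Z).
    (\<forall>a\<in>pts A. \<forall>b\<in>pts A. T (f a) (uhom A a b) \<le> f b) \<and>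
    (\<forall>(D, h, w, c)\<in>{(D, h, w, c). fin_diagram T A D h w \<and> is_colimit T A D h w c}.
      f c = sup01 {T (w i) (f (h i)) | i. i \<in> pts D}) \<and>
    (\<forall>a\<in>pts A. \<forall>b\<in>pts A. f (mul A a b) \<le> T (f a) (f b)) \<and>
    (\<forall>a\<in>pts A. \<forall>u\<in>{0..1}. f (tminus A a u) = max (f a - u) 0)}"
    unfolding L_def set_eq_iff lax_hom_unit_iff[OF A] mem_Collect_eq sp by simp
  have colim: "c \<in> pts A" if "is_colimit T A D h w c" for D h w c using that unfolding is_colimit_def by blast
  have "closedin (tp Z) L"
    unfolding L
    by (intro closedin_Collect_conj closedin_Collect_ball)
      (auto simp del: atLeastAtMost_iff intro!: closedin_le_fun closedin_eq_fun c1 c2 c3 c4 c5 uh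
        MonObj_mul[OF A] MonObj_tminus[OF A] intro: colim)
  then have comp: "compactin (tp Z) L" using PosComp_compact[OF Z] by (rule closedin_compact_space[rotated])
  have sub: "L \<subseteq> topspace (tp Z)" using L by blast
  \<comment> \<open>Continuity in this direction suffices: it exhibits \<open>G A\<close> as the
    continuous image of a closed subspace of the cube.\<close>
  have "continuous_map (subtopology (tp Z) L) (tp (G_obj T A)) (\<lambda>f. f)"
    unfolding continuous_map_into_G using sub
    by (auto simp: L_def intro!: continuous_map_from_subtopology c1)
  moreover have "compactin (subtopology (tp Z) L) L" using comp by (simp add: compactin_subtopology)
  ultimately have "compactin (tp (G_obj T A)) ((\<lambda>f. f) ` L)" by (rule image_compactin[rotated])
  then show ?thesis unfolding compact_space_def by (simp add: L_def)
qed

lemma G_obj_PosComp: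
  assumes A: "A \<in> MonObj T" shows "G_obj T A \<in> PosComp"
proof -
  let ?G = "tp (G_obj T A)" let ?L = "lax_hom T A (unit_mon T)"
  have "ple (G_obj T A) = {p \<in> topspace (prod_topology ?G ?G). \<forall>a\<in>pts A. snd p a \<le> fst p a}"
    by (auto simp: ple_G)
  moreover have "closedin (prod_topology ?G ?G) \<dots>"
    by (intro closedin_Collect_ball closedin_le_fun
        continuous_map_compose[OF continuous_map_snd continuous_map_G_eval, unfolded comp_def]
        continuous_map_compose[OF continuous_map_fst continuous_map_G_eval, unfolded comp_def])
  moreover have "antisym (ple (G_obj T A))"
  proof (rule antisymI)
    fix \<Phi> \<Phi>' assume "(\<Phi>, \<Phi>') \<in> ple (G_obj T A)" "(\<Phi>', \<Phi>) \<in> ple (G_obj T A)"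
    then have "\<Phi> \<in> ?L" "\<Phi>' \<in> ?L" "\<And>a. a \<in> pts A \<Longrightarrow> \<Phi> a = \<Phi>' a" by (auto simp: ple_G intro: antisym)
    then show "\<Phi> = \<Phi>'" using lax_hom_PiE by (metis PiE_ext)
  qed
  moreover have "trans (ple (G_obj T A))"
    by (rule transI) (auto simp: ple_G intro: order_trans)
  ultimately show ?thesis
    unfolding PosComp_def partial_order_on_def preorder_on_def refl_on_def
    using compact_space_G[OF A] by (auto simp: ple_G)
qed

section \<open>The functors \<open>G\<close> and \<open>C\<close> on morphisms\<close>

lemma G_map_pos_hom:
  assumes A: "A \<in> MonObj T" and B: "B \<in> MonObj T" and h: "h \<in> lax_hom T A B"
  shows "G_map T A B h \<in> pos_hom (G_obj T B) (G_obj T A)"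
proof -
  have mem: "compose (pts A) \<Phi> h \<in> lax_hom T A (unit_mon T)" if "\<Phi> \<in> lax_hom T B (unit_mon T)" for \<Phi>
    by (rule lax_hom_compose[OF A B unit_mon_MonObj h that])
  note hm = lax_hom_mem[OF h]
  have "continuous_map (tp (G_obj T B)) (tp (G_obj T A)) (\<lambda>\<Phi>. compose (pts A) \<Phi> h)"
    unfolding continuous_map_into_G using mem hm by (auto simp: compose_eq continuous_map_G_eval)
  then have "continuous_map (tp (G_obj T B)) (tp (G_obj T A)) (G_map T A B h)"
    by (rule continuous_map_eq) (simp add: G_map_def)
  moreover have "(G_map T A B h \<Phi>, G_map T A B h \<Phi>') \<in> ple (G_obj T A)" if "(\<Phi>, \<Phi>') \<in> ple (G_obj T B)" for \<Phi> \<Phi>'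
    using that mem hm unfolding ple_G by (simp add: G_map_def compose_eq)
  moreover have "G_map T A B h \<in> sp (G_obj T B) \<rightarrow>\<^sub>E sp (G_obj T A)"
    using mem by (auto simp: G_map_def)
  ultimately show ?thesis unfolding pos_hom_def by blast
qed

lemma G_map_apply:
  "\<Phi> \<in> lax_hom T B (unit_mon T) \<Longrightarrow> a \<in> pts A \<Longrightarrow> G_map T A B h \<Phi> a = \<Phi> (h a)"
  by (simp add: G_map_def compose_eq)

lemma G_map_id: "A \<in> MonObj T \<Longrightarrow> G_map T A A (\<lambda>a\<in>pts A. a) = (\<lambda>\<Phi>\<in>sp (G_obj T A). \<Phi>)"
  unfolding G_map_def sp_G by (rule restrict_ext) (auto simp: compose_def dest: lax_hom_ext intro!: extensionalityI[of _ "pts A"])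

lemma G_map_compose:
  assumes A: "A \<in> MonObj T" and B: "B \<in> MonObj T" and D: "D \<in> MonObj T"
    and h: "h \<in> lax_hom T A B" and k: "k \<in> lax_hom T B D"
  shows "G_map T A D (compose (pts A) k h) = compose (sp (G_obj T D)) (G_map T A B h) (G_map T B D k)"
  using lax_hom_mem[OF h] lax_hom_compose[OF B D unit_mon_MonObj k]
  unfolding G_map_def sp_G compose_def[of "lax_hom T D (unit_mon T)"]
  by (intro restrict_ext) (auto simp: compose_def fun_eq_iff)

lemma C_map_apply: "\<psi> \<in> pos_hom Y unit_op \<Longrightarrow> x \<in> sp X \<Longrightarrow> C_map X Y f \<psi> x = \<psi> (f x)"
  by (simp add: C_map_def compose_eq)

lemma C_map_mem:
  assumes "X \<in> PosComp" and f: "f \<in> pos_hom X Y" and "\<psi> \<in> pos_hom Y unit_op"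
  shows "C_map X Y f \<psi> \<in> pos_hom X unit_op"
  using pos_hom_compose[OF f assms(3) ple_subset[OF assms(1)]] assms(3) by (simp add: C_map_def)

lemma C_map_lax_hom:
  assumes X: "X \<in> PosComp" and Y: "Y \<in> PosComp" and f: "f \<in> pos_hom X Y"
  shows "C_map X Y f \<in> lax_hom T (C_obj T Y) (C_obj T X)"
proof (subst lax_hom_C_iff[OF C_obj_MonObj[OF Y] X])
  show "C_map X Y f \<in> pts (C_obj T Y) \<rightarrow>\<^sub>E pos_hom X unit_op"
    using C_map_mem[OF X f] by (auto simp: C_map_def)
  show "\<forall>x\<in>sp X. (\<lambda>a\<in>pts (C_obj T Y). C_map X Y f a x) \<in> lax_hom T (C_obj T Y) (unit_mon T)"
  proof
    fix x assume x: "x \<in> sp X"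
    have "(\<lambda>a\<in>pts (C_obj T Y). C_map X Y f a x) = (\<lambda>\<psi>\<in>pos_hom Y unit_op. \<psi> (f x))"
      unfolding pts_C by (rule restrict_ext) (simp add: C_map_apply x)
    then show "(\<lambda>a\<in>pts (C_obj T Y). C_map X Y f a x) \<in> lax_hom T (C_obj T Y) (unit_mon T)"
      using ev_lax_hom[OF Y pos_hom_mem[OF f x]] by (simp only:)
  qed
qed

lemma C_map_id:
  assumes X: "X \<in> PosComp"
  shows "C_map X X (\<lambda>x\<in>sp X. x) = (\<lambda>\<psi>\<in>pts (C_obj T X). \<psi>)"
  unfolding C_map_def pts_C
  by (rule restrict_ext) (auto simp: compose_def dest: C_ext[OF X] intro!: extensionalityI[of _ "sp X"])

lemma C_map_compose:
  assumes "X \<in> PosComp" "Y \<in> PosComp" and f: "f \<in> pos_hom X Y" and g: "g \<in> pos_hom Y Z"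
  shows "C_map X Z (compose (sp X) g f) = compose (pts (C_obj T Z)) (C_map X Y f) (C_map Y Z g)"
  using pos_hom_mem[OF f] C_map_mem[OF assms(2) g] unfolding pts_C C_map_def compose_def[of "pos_hom Z unit_op"]
  by (intro restrict_ext) (auto simp: compose_def fun_eq_iff)

section \<open>Evaluation maps and triangle identities\<close>

lemma ev_space_apply: "x \<in> sp X \<Longrightarrow> ev_space T X x = (\<lambda>\<psi>\<in>pos_hom X unit_op. \<psi> x)"
  by (simp add: ev_space_def)

lemma ev_space_pos_hom:
  assumes X: "X \<in> PosComp" shows "ev_space T X \<in> pos_hom X (G_obj T (C_obj T X))"
proof -
  have mem: "ev_space T X x \<in> lax_hom T (C_obj T X) (unit_mon T)" if "x \<in> sp X" for x
    unfolding ev_space_apply[OF that] by (rule ev_lax_hom[OF X that])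
  have "continuous_map (tp X) euclideanreal (\<lambda>x. ev_space T X x \<psi>)" if "\<psi> \<in> pos_hom X unit_op" for \<psi>
    by (rule continuous_map_eq[OF C_cont[OF X that]]) (simp add: ev_space_def that)
  then have "continuous_map (tp X) (tp (G_obj T (C_obj T X))) (ev_space T X)"
    unfolding continuous_map_into_G using mem by simp
  moreover have "(ev_space T X x, ev_space T X y) \<in> ple (G_obj T (C_obj T X))" if "(x, y) \<in> ple X" for x y
    unfolding ple_G using mem ple_points[OF X that] C_antimono[OF X _ that] by (simp add: ev_space_def)
  moreover have "ev_space T X \<in> sp X \<rightarrow>\<^sub>E sp (G_obj T (C_obj T X))"
    using mem by (auto simp: ev_space_def)
  ultimately show ?thesis unfolding pos_hom_def by blast
qed

lemma ev_space_natural: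
  assumes X: "X \<in> PosComp" and Y: "Y \<in> PosComp" and f: "f \<in> pos_hom X Y"
  shows "compose (sp X) (ev_space T Y) f
    = compose (sp X) (G_map T (C_obj T Y) (C_obj T X) (C_map X Y f)) (ev_space T X)"
  unfolding compose_def[of "sp X"]
proof (rule restrict_ext)
  fix x assume x: "x \<in> sp X"
  note ev = pos_hom_mem[OF ev_space_pos_hom[OF X] x, simplified]
  show "ev_space T Y (f x) = G_map T (C_obj T Y) (C_obj T X) (C_map X Y f) (ev_space T X x)"
    using ev C_map_mem[OF X f] unfolding G_map_def ev_space_apply[OF x] ev_space_apply[OF pos_hom_mem[OF f x]]
    by (auto simp: compose_def fun_eq_iff C_map_apply x)
qed

lemma ev_mon_apply: "a \<in> pts A \<Longrightarrow> ev_mon T A a = (\<lambda>\<Phi>\<in>lax_hom T A (unit_mon T). \<Phi> a)"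
  by (simp add: ev_mon_def)

lemma ev_mon_mem:
  assumes A: "A \<in> MonObj T" and a: "a \<in> pts A"
  shows "ev_mon T A a \<in> pos_hom (G_obj T A) unit_op"
proof -
  have "continuous_map (tp (G_obj T A)) euclideanreal (ev_mon T A a)"
    by (rule continuous_map_eq[OF continuous_map_G_eval[OF a]]) (simp add: ev_mon_apply a)
  then show ?thesis
    using lax_hom_mem[of _ A "unit_mon T" a] a
    unfolding pos_hom_unit_iff[OF G_obj_PosComp[OF A]] ev_mon_apply[OF a] by (auto simp: ple_G)
qed

text \<open>The component of \<open>ev_mon T A\<close> at a point \<open>\<Phi>\<close> of
  \<open>G A\<close> is \<open>\<Phi>\<close> itself, which is lax by membership.\<close>

lemma ev_mon_lax_hom:
  assumes A: "A \<in> MonObj T"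
  shows "ev_mon T A \<in> lax_hom T A (C_obj T (G_obj T A))"
proof (subst lax_hom_C_iff[OF A G_obj_PosComp[OF A]])
  show "ev_mon T A \<in> pts A \<rightarrow>\<^sub>E pos_hom (G_obj T A) unit_op"
    using ev_mon_mem[OF A] by (auto simp: ev_mon_def)
  show "\<forall>\<Phi>\<in>sp (G_obj T A). (\<lambda>a\<in>pts A. ev_mon T A a \<Phi>) \<in> lax_hom T A (unit_mon T)"
  proof
    fix \<Phi> assume \<Phi>: "\<Phi> \<in> sp (G_obj T A)"
    then have "(\<lambda>a\<in>pts A. ev_mon T A a \<Phi>) = \<Phi>"
      using lax_hom_ext[of \<Phi> A] by (intro extensionalityI[of _ "pts A"]) (auto simp: ev_mon_apply)
    then show "(\<lambda>a\<in>pts A. ev_mon T A a \<Phi>) \<in> lax_hom T A (unit_mon T)" using \<Phi> by simp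
  qed
qed

lemma ev_mon_natural:
  assumes A: "A \<in> MonObj T" and B: "B \<in> MonObj T" and h: "h \<in> lax_hom T A B"
  shows "compose (pts A) (ev_mon T B) h
    = compose (pts A) (C_map (G_obj T B) (G_obj T A) (G_map T A B h)) (ev_mon T A)"
  unfolding compose_def[of "pts A"]
proof (rule restrict_ext)
  fix a assume a: "a \<in> pts A"
  show "ev_mon T B (h a) = C_map (G_obj T B) (G_obj T A) (G_map T A B h) (ev_mon T A a)"
  proof (rule C_eqI)
    show "ev_mon T B (h a) \<in> pos_hom (G_obj T B) unit_op" by (rule ev_mon_mem[OF B lax_hom_mem[OF h a]])
    show "C_map (G_obj T B) (G_obj T A) (G_map T A B h) (ev_mon T A a) \<in> pos_hom (G_obj T B) unit_op"
      by (rule C_map_mem[OF G_obj_PosComp[OF B] G_map_pos_hom[OF A B h] ev_mon_mem[OF A a]])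
    fix \<Phi> assume \<Phi>: "\<Phi> \<in> sp (G_obj T B)"
    then show "ev_mon T B (h a) \<Phi> = C_map (G_obj T B) (G_obj T A) (G_map T A B h) (ev_mon T A a) \<Phi>"
      using pos_hom_mem[OF G_map_pos_hom[OF A B h] \<Phi>] G_map_apply[of \<Phi> B a A h] a
      unfolding C_map_apply[OF ev_mon_mem[OF A a] \<Phi>]
      unfolding ev_mon_apply[OF lax_hom_mem[OF h a]] ev_mon_apply[OF a] by simp
  qed
qed

lemma triangle_C:
  assumes X: "X \<in> PosComp"
  shows "compose (pts (C_obj T X)) (C_map X (G_obj T (C_obj T X)) (ev_space T X)) (ev_mon T (C_obj T X))
    = (\<lambda>\<psi>\<in>pts (C_obj T X). \<psi>)"
  unfolding compose_def[of "pts (C_obj T X)"]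
proof (rule restrict_ext)
  fix \<psi> assume "\<psi> \<in> pts (C_obj T X)"
  then have \<psi>: "\<psi> \<in> pos_hom X unit_op" "\<psi> \<in> pts (C_obj T X)" by simp_all
  note m = ev_mon_mem[OF C_obj_MonObj[OF X] \<psi>(2)]
  show "C_map X (G_obj T (C_obj T X)) (ev_space T X) (ev_mon T (C_obj T X) \<psi>) = \<psi>"
  proof (rule C_eqI[OF C_map_mem[OF X ev_space_pos_hom[OF X] m] \<psi>(1)])
    fix x assume x: "x \<in> sp X"
    show "C_map X (G_obj T (C_obj T X)) (ev_space T X) (ev_mon T (C_obj T X) \<psi>) x = \<psi> x"
      using pos_hom_mem[OF ev_space_pos_hom[OF X] x] \<psi>(1)
      unfolding C_map_apply[OF m x] unfolding ev_mon_apply[OF \<psi>(2)] by (simp add: ev_space_apply[OF x])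
  qed
qed

lemma triangle_G:
  assumes A: "A \<in> MonObj T"
  shows "compose (sp (G_obj T A)) (G_map T A (C_obj T (G_obj T A)) (ev_mon T A)) (ev_space T (G_obj T A))
    = (\<lambda>\<Phi>\<in>sp (G_obj T A). \<Phi>)"
  unfolding compose_def[of "sp (G_obj T A)"]
proof (rule restrict_ext)
  note G = G_obj_PosComp[OF A]
  fix \<Phi> assume \<Phi>: "\<Phi> \<in> sp (G_obj T A)"
  note ev = pos_hom_mem[OF ev_space_pos_hom[OF G] \<Phi>, simplified]
  have "\<Phi> \<in> extensional (pts A)" using \<Phi> by (simp add: lax_hom_ext)
  then show "G_map T A (C_obj T (G_obj T A)) (ev_mon T A) (ev_space T (G_obj T A) \<Phi>) = \<Phi>"
    using ev \<Phi> ev_mon_mem[OF A] unfolding G_map_def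
    by (intro extensionalityI[of _ "pts A"]) (auto simp: compose_eq ev_space_apply ev_mon_apply)
qed

end


section \<open>The Vietoris space and the functor on distributors\<close>

definition sup_on :: "'a set \<Rightarrow> ('a \<Rightarrow> real) \<Rightarrow> real" where
  "sup_on A \<psi> = sup01 {\<psi> x | x. x \<in> A}"

context
  fixes \<psi> :: "'a \<Rightarrow> real" and A
  assumes mem: "\<psi> \<in> A \<rightarrow> {0..1}"
begin

lemma sup_on_mem: "sup_on A \<psi> \<in> {0..1}"
  unfolding sup_on_def by (rule sup01_mem) (use mem in auto)

lemma sup_on_nonneg: "0 \<le> sup_on A \<psi>"
  using sup_on_mem by simp

lemma sup_on_le_iff: "0 \<le> w \<Longrightarrow> sup_on A \<psi> \<le> w \<longleftrightarrow> (\<forall>x\<in>A. \<psi> x \<le> w)"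
  unfolding sup_on_def using sup01_le_iff[of "\<lambda>x. x \<in> A" \<psi> w] mem
  by (auto simp add: Pi_iff simp del: atLeastAtMost_iff)

lemma less_sup_on_iff: "0 \<le> w \<Longrightarrow> w < sup_on A \<psi> \<longleftrightarrow> (\<exists>x\<in>A. w < \<psi> x)"
  using sup_on_le_iff[of w] by (auto simp: not_le[symmetric])

lemma sup_on_ge: "x \<in> A \<Longrightarrow> \<psi> x \<le> sup_on A \<psi>"
  using sup_on_le_iff[OF sup_on_nonneg] by blast

end

lemma C_Pi: "X \<in> PosComp \<Longrightarrow> \<psi> \<in> pos_hom X unit_op \<Longrightarrow> A \<subseteq> sp X \<Longrightarrow> \<psi> \<in> A \<rightarrow> {0..1}"
  using C_mem[of X \<psi>] by blast

lemma closed_upperD: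
  assumes "A \<in> closed_upper X"
  shows closed_upper_closed: "closedin (tp X) A"
    and closed_upper_subset: "A \<subseteq> sp X"
    and closed_upper_upper: "x \<in> A \<Longrightarrow> (x, y) \<in> ple X \<Longrightarrow> y \<in> A"
  using assms unfolding closed_upper_def upper_in_def by auto

text \<open>By compactness the supremum over a nonempty \<open>A\<close> is attained, so strictness
  survives. Positivity of \<open>t\<close> takes care of an empty \<open>A\<close>, whose supremum
  is 0.\<close>

lemma sup_on_less_iff:
  assumes X: "X \<in> PosComp" and A: "A \<in> closed_upper X" and \<psi>: "\<psi> \<in> pos_hom X unit_op" and t: "0 < t"
  shows "sup_on A \<psi> < t \<longleftrightarrow> (\<forall>x\<in>A. \<psi> x < t)"
proof
  note mem = C_Pi[OF X \<psi> closed_upper_subset[OF A]]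
  show "\<forall>x\<in>A. \<psi> x < t" if "sup_on A \<psi> < t"
    using sup_on_ge[OF mem] that by (auto intro: le_less_trans)
  assume *: "\<forall>x\<in>A. \<psi> x < t"
  show "sup_on A \<psi> < t"
  proof (cases "A = {}")
    case True
    then show ?thesis using t by (simp add: sup_on_def sup01_def)
  next
    case False
    have "compactin (tp X) A" using PosComp_compact[OF X] closed_upper_closed[OF A] by (rule closedin_compact_space)
    then have "compact (\<psi> ` A)"
      using image_compactin[OF _ C_cont[OF X \<psi>]] by (simp add: compactin_euclidean_iff)
    then obtain x where "x \<in> A" "\<And>y. y \<in> A \<Longrightarrow> \<psi> y \<le> \<psi> x"
      using compact_attains_sup[of "\<psi> ` A"] False by auto
    then have "sup_on A \<psi> \<le> \<psi> x" using sup_on_le_iff[OF mem, of "\<psi> x"] mem by (auto simp: Pi_iff)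
    then show ?thesis using * \<open>x \<in> A\<close> by fastforce
  qed
qed

lemma sp_V [simp]: "sp (V_obj X) = closed_upper X"
proof -
  have "closed_upper X \<in> {{A \<in> closed_upper X. A \<inter> K = {}} | K. closedin (tp X) K \<and> lower_in X K}"
    unfolding mem_Collect_eq by (rule exI[of _ "{}"]) (simp add: lower_in_def)
  then show ?thesis
    unfolding V_obj_def pospace.simps topology_generated_by_topspace by (intro equalityI) auto
qed

lemma ple_V: "(A, B) \<in> ple (V_obj X) \<longleftrightarrow> A \<in> closed_upper X \<and> B \<in> closed_upper X \<and> B \<subseteq> A"
  by (simp add: V_obj_def)

lemma ple_V_subset: "ple (V_obj X) \<subseteq> sp (V_obj X) \<times> sp (V_obj X)"
  by (auto simp: ple_V)

lemma openin_V_hit: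
  "openin (tp X) U \<Longrightarrow> lower_in X U \<Longrightarrow> openin (tp (V_obj X)) {A \<in> closed_upper X. A \<inter> U \<noteq> {}}"
  unfolding V_obj_def by (simp, rule topology_generated_by_Basis) blast

lemma openin_V_miss:
  "closedin (tp X) K \<Longrightarrow> lower_in X K \<Longrightarrow> openin (tp (V_obj X)) {A \<in> closed_upper X. A \<inter> K = {}}"
  unfolding V_obj_def by (simp, rule topology_generated_by_Basis) blast

lemma continuous_map_into_V:
  "continuous_map Z (tp (V_obj X)) f \<longleftrightarrow> f \<in> topspace Z \<rightarrow> closed_upper X \<and>
    (\<forall>U. openin (tp X) U \<and> lower_in X U \<longrightarrow> openin Z {z \<in> topspace Z. f z \<inter> U \<noteq> {}}) \<and>
    (\<forall>K. closedin (tp X) K \<and> lower_in X K \<longrightarrow> openin Z {z \<in> topspace Z. f z \<inter> K = {}})" (is "?l \<longleftrightarrow> ?r")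
proof
  assume l: ?l
  then have f: "f \<in> topspace Z \<rightarrow> closed_upper X" using continuous_map_funspace[of Z "tp (V_obj X)" f] sp_V by metis
  have eq: "{z \<in> topspace Z. f z \<in> {A \<in> closed_upper X. P A}} = {z \<in> topspace Z. P (f z)}" for P
    using f by auto
  show ?r
  proof (intro conjI allI impI f; elim conjE)
    show "openin Z {z \<in> topspace Z. f z \<inter> U \<noteq> {}}" if "openin (tp X) U" "lower_in X U" for U
      using openin_continuous_map_preimage[OF l openin_V_hit[OF that]] unfolding eq .
    show "openin Z {z \<in> topspace Z. f z \<inter> K = {}}" if "closedin (tp X) K" "lower_in X K" for K
      using openin_continuous_map_preimage[OF l openin_V_miss[OF that]] unfolding eq .
  qed
next
  assume r: ?r
  then have f: "f \<in> topspace Z \<rightarrow> closed_upper X" by blast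
  have eq: "f -` {A \<in> closed_upper X. P A} \<inter> topspace Z = {z \<in> topspace Z. P (f z)}" for P
    using f by auto
  show ?l
    unfolding V_obj_def pospace.simps
  proof (rule continuous_on_generated_topo)
    show "f ` topspace Z \<subseteq> \<Union> ({{A \<in> closed_upper X. A \<inter> U \<noteq> {}} | U. openin (tp X) U \<and> lower_in X U} \<union>
        {{A \<in> closed_upper X. A \<inter> K = {}} | K. closedin (tp X) K \<and> lower_in X K})"
      using f sp_V[of X] unfolding V_obj_def by auto
    fix W assume "W \<in> {{A \<in> closed_upper X. A \<inter> U \<noteq> {}} | U. openin (tp X) U \<and> lower_in X U} \<union>
        {{A \<in> closed_upper X. A \<inter> K = {}} | K. closedin (tp X) K \<and> lower_in X K}"
    then consider U where "openin (tp X) U" "lower_in X U" "W = {A \<in> closed_upper X. A \<inter> U \<noteq> {}}"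
      | K where "closedin (tp X) K" "lower_in X K" "W = {A \<in> closed_upper X. A \<inter> K = {}}" by blast
    then show "openin Z (f -` W \<inter> topspace Z)"
    proof cases
      case 1
      show ?thesis unfolding 1(3) eq using r 1(1,2) by simp
    next
      case 2
      show ?thesis unfolding 2(3) eq using r 2(1,2) by simp
    qed
  qed
qed

section \<open>Distributors and the extension of \<open>C\<close> to them\<close>

lemma dist_hom_iff:
  assumes X: "ple X \<subseteq> sp X \<times> sp X"
  shows "\<phi> \<in> dist_hom X Y \<longleftrightarrow> \<phi> \<subseteq> sp X \<times> sp Y \<and> (\<forall>x\<in>sp X. \<phi> `` {x} \<in> closed_upper Y) \<and>
    (\<forall>(x, y)\<in>ple X. \<phi> `` {y} \<subseteq> \<phi> `` {x}) \<and>
    (\<forall>U. openin (tp Y) U \<and> lower_in Y U \<longrightarrow> openin (tp X) {x \<in> sp X. \<phi> `` {x} \<inter> U \<noteq> {}}) \<and>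
    (\<forall>K. closedin (tp Y) K \<and> lower_in Y K \<longrightarrow> openin (tp X) {x \<in> sp X. \<phi> `` {x} \<inter> K = {}})"
proof -
  let ?f = "\<lambda>x\<in>sp X. {y. (x, y) \<in> \<phi>}"
  have f: "?f x = \<phi> `` {x}" if "x \<in> sp X" for x using that by auto
  have c: "continuous_map (tp X) (tp (V_obj Y)) ?f \<longleftrightarrow> continuous_map (tp X) (tp (V_obj Y)) (\<lambda>x. \<phi> `` {x})"
  proof
    show "continuous_map (tp X) (tp (V_obj Y)) (\<lambda>x. \<phi> `` {x})" if "continuous_map (tp X) (tp (V_obj Y)) ?f"
      using that by (rule continuous_map_eq) (rule f)
    show "continuous_map (tp X) (tp (V_obj Y)) ?f" if "continuous_map (tp X) (tp (V_obj Y)) (\<lambda>x. \<phi> `` {x})"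
      using that by (rule continuous_map_eq) (rule f[symmetric])
  qed
  have o: "(\<forall>(x, y)\<in>ple X. (?f x, ?f y) \<in> ple (V_obj Y)) \<longleftrightarrow> (\<forall>(x, y)\<in>ple X. \<phi> `` {y} \<subseteq> \<phi> `` {x})"
    if "\<forall>x\<in>sp X. \<phi> `` {x} \<in> closed_upper Y"
  proof -
    have "(?f x, ?f y) \<in> ple (V_obj Y) \<longleftrightarrow> \<phi> `` {y} \<subseteq> \<phi> `` {x}" if xy: "(x, y) \<in> ple X" for x y
    proof -
      have "x \<in> sp X" "y \<in> sp X" using xy X by auto
      then show ?thesis using \<open>\<forall>x\<in>sp X. \<phi> `` {x} \<in> closed_upper Y\<close> unfolding f[OF \<open>x \<in> sp X\<close>] f[OF \<open>y \<in> sp X\<close>] ple_V by blast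
    qed
    then show ?thesis by blast
  qed
  have p: "?f \<in> sp X \<rightarrow>\<^sub>E closed_upper Y \<longleftrightarrow> (\<forall>x\<in>sp X. \<phi> `` {x} \<in> closed_upper Y)"
    using f by (auto simp: PiE_iff)
  show ?thesis
  proof (cases "\<forall>x\<in>sp X. \<phi> `` {x} \<in> closed_upper Y")
    case True
    show ?thesis
      unfolding dist_hom_def pos_hom_def mem_Collect_eq c
      unfolding continuous_map_into_V sp_V p Pi_iff o[OF True]
      using True by (simp only: simp_thms conj_ac)
  next
    case False
    then show ?thesis
      unfolding dist_hom_def pos_hom_def mem_Collect_eq c sp_V p by (simp only: simp_thms)
  qed
qed

lemma dist_homD:
  assumes "ple X \<subseteq> sp X \<times> sp X" "\<phi> \<in> dist_hom X Y"
  shows dist_hom_subset: "\<phi> \<subseteq> sp X \<times> sp Y"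
    and dist_hom_closed_upper: "x \<in> sp X \<Longrightarrow> \<phi> `` {x} \<in> closed_upper Y"
    and dist_hom_antimono: "(x, y) \<in> ple X \<Longrightarrow> \<phi> `` {y} \<subseteq> \<phi> `` {x}"
    and dist_hom_hit: "openin (tp Y) U \<Longrightarrow> lower_in Y U \<Longrightarrow> openin (tp X) {x \<in> sp X. \<phi> `` {x} \<inter> U \<noteq> {}}"
    and dist_hom_miss: "closedin (tp Y) K \<Longrightarrow> lower_in Y K \<Longrightarrow> openin (tp X) {x \<in> sp X. \<phi> `` {x} \<inter> K = {}}"
  using assms(2) unfolding dist_hom_iff[OF assms(1)] by (simp, simp, fast, simp, simp)

lemma C_dist_apply:
  "\<psi> \<in> pos_hom Y unit_op \<Longrightarrow> x \<in> sp X \<Longrightarrow> C_dist X Y \<phi> \<psi> x = sup_on (\<phi> `` {x}) \<psi>"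
  unfolding C_dist_def sup_on_def by simp

text \<open>The hit condition for the open lower sets where \<open>\<psi>\<close> exceeds
  \<open>t\<close>, and the miss condition for the closed lower sets where \<open>\<psi>\<close> is
  at least \<open>t\<close>, give lower and upper semicontinuity. Little is assumed of the domain
  because the lemma is applied to \<open>V_counit X\<close> while compactness of
  \<open>V_obj X\<close> is still to be proved.\<close>

lemma C_dist_mem:
  assumes X: "ple X \<subseteq> sp X \<times> sp X" and Y: "Y \<in> PosComp" and \<phi>: "\<phi> \<in> dist_hom X Y" and \<psi>: "\<psi> \<in> pos_hom Y unit_op"
  shows "C_dist X Y \<phi> \<psi> \<in> pos_hom X unit_op"
proof -
  let ?s = "\<lambda>x. sup_on (\<phi> `` {x}) \<psi>"
  have eq: "C_dist X Y \<phi> \<psi> = (\<lambda>x\<in>sp X. ?s x)"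
    using \<psi> by (auto simp: C_dist_def sup_on_def)
  note cu = dist_hom_closed_upper[OF X \<phi>]
  have mem: "\<psi> \<in> \<phi> `` {x} \<rightarrow> {0..1}" if "x \<in> sp X" for x
    by (rule C_Pi[OF Y \<psi> closed_upper_subset[OF cu[OF that]]])
  have "openin (tp X) {x \<in> sp X. t < ?s x}" for t
  proof (cases "0 \<le> t")
    case True
    have "openin (tp Y) {y \<in> sp Y. t < \<psi> y}" by (rule openin_less_fun) (simp_all add: C_cont[OF Y \<psi>])
    moreover have "lower_in Y {y \<in> sp Y. t < \<psi> y}"
      unfolding lower_in_def using C_antimono[OF Y \<psi>] ple_points[OF Y] by fastforce
    ultimately have "openin (tp X) {x \<in> sp X. \<phi> `` {x} \<inter> {y \<in> sp Y. t < \<psi> y} \<noteq> {}}"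
      by (rule dist_hom_hit[OF X \<phi>])
    moreover have "{x \<in> sp X. \<phi> `` {x} \<inter> {y \<in> sp Y. t < \<psi> y} \<noteq> {}} = {x \<in> sp X. t < ?s x}"
    proof (intro Collect_cong conj_cong refl)
      fix x assume x: "x \<in> sp X"
      show "(\<phi> `` {x} \<inter> {y \<in> sp Y. t < \<psi> y} \<noteq> {}) \<longleftrightarrow> t < ?s x"
        using less_sup_on_iff[OF mem[OF x] True] closed_upper_subset[OF cu[OF x]] by auto
    qed
    ultimately show ?thesis by simp
  next
    case False
    then have "t < ?s x" if "x \<in> sp X" for x using sup_on_nonneg[OF mem[OF that]] by simp
    then have "{x \<in> sp X. t < ?s x} = sp X" by blast
    then show ?thesis by simp
  qed
  moreover have "openin (tp X) {x \<in> sp X. ?s x < t}" for t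
  proof (cases "0 < t")
    case True
    have "closedin (tp Y) {y \<in> sp Y. t \<le> \<psi> y}" by (rule closedin_le_fun) (simp_all add: C_cont[OF Y \<psi>])
    moreover have "lower_in Y {y \<in> sp Y. t \<le> \<psi> y}"
      unfolding lower_in_def using C_antimono[OF Y \<psi>] ple_points[OF Y] by fastforce
    ultimately have "openin (tp X) {x \<in> sp X. \<phi> `` {x} \<inter> {y \<in> sp Y. t \<le> \<psi> y} = {}}"
      by (rule dist_hom_miss[OF X \<phi>])
    moreover have "{x \<in> sp X. \<phi> `` {x} \<inter> {y \<in> sp Y. t \<le> \<psi> y} = {}} = {x \<in> sp X. ?s x < t}"
    proof (intro Collect_cong conj_cong refl)
      fix x assume x: "x \<in> sp X"
      show "(\<phi> `` {x} \<inter> {y \<in> sp Y. t \<le> \<psi> y} = {}) \<longleftrightarrow> ?s x < t"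
        using sup_on_less_iff[OF Y cu[OF x] \<psi> True] closed_upper_subset[OF cu[OF x]]
        by (auto simp: not_le[symmetric])
    qed
    ultimately show ?thesis by simp
  next
    case False
    then have "\<not> ?s x < t" if "x \<in> sp X" for x using sup_on_nonneg[OF mem[OF that]] by simp
    then have "{x \<in> sp X. ?s x < t} = {}" by blast
    then show ?thesis by (simp only: openin_empty)
  qed
  ultimately have "continuous_map (tp X) euclideanreal ?s"
    unfolding continuous_map_upper_lower_semicontinuous_lt by blast
  then have cont: "continuous_map (tp X) euclideanreal (\<lambda>x\<in>sp X. ?s x)" by (rule continuous_map_eq) simp
  have mono: "?s y \<le> ?s x" if xy: "(x, y) \<in> ple X" for x y
  proof -
    have x: "x \<in> sp X" "y \<in> sp X" "\<phi> `` {y} \<subseteq> \<phi> `` {x}" using xy X dist_hom_antimono[OF X \<phi> xy] by auto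
    show ?thesis
      using sup_on_le_iff[OF mem[OF x(2)] sup_on_nonneg[OF mem[OF x(1)]]]
        sup_on_ge[OF mem[OF x(1)]] x(3) by blast
  qed
  show ?thesis
    unfolding eq pos_hom_unit_iff_relation[OF X]
  proof (intro conjI ballI cont)
    show "(\<lambda>x\<in>sp X. ?s x) x \<in> {0..1}" if "x \<in> sp X" for x using sup_on_mem[OF mem[OF that]] that by simp
    show "case p of (x, y) \<Rightarrow> (\<lambda>x\<in>sp X. ?s x) y \<le> (\<lambda>x\<in>sp X. ?s x) x" if "p \<in> ple X" for p
      using mono that X by auto
  qed simp
qed

lemma V_counit_dist_hom: "V_counit X \<in> dist_hom (V_obj X) X"
  unfolding dist_hom_iff[OF ple_V_subset] sp_V
proof (intro conjI allI impI ballI; (elim conjE)?)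
  have eq: "V_counit X `` {A} = A" if "A \<in> closed_upper X" for A using that by (auto simp: V_counit_def)
  show "V_counit X \<subseteq> closed_upper X \<times> sp X" using closed_upper_subset by (fastforce simp: V_counit_def)
  show "V_counit X `` {A} \<in> closed_upper X" if "A \<in> closed_upper X" for A using that by (simp add: eq)
  show "case p of (x, y) \<Rightarrow> V_counit X `` {y} \<subseteq> V_counit X `` {x}" if "p \<in> ple (V_obj X)" for p
    using that by (cases p) (simp add: eq ple_V)
  have "{A \<in> closed_upper X. P (V_counit X `` {A})} = {A \<in> closed_upper X. P A}" for P
    by (intro Collect_cong conj_cong refl) (simp add: eq)
  note eqs = this[of "\<lambda>B. B \<inter> U \<noteq> {}" for U] this[of "\<lambda>B. B \<inter> U = {}" for U]
  show "openin (tp (V_obj X)) {A \<in> closed_upper X. V_counit X `` {A} \<inter> U \<noteq> {}}" if "openin (tp X) U" "lower_in X U" for U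
    unfolding eqs by (rule openin_V_hit[OF that])
  show "openin (tp (V_obj X)) {A \<in> closed_upper X. V_counit X `` {A} \<inter> K = {}}" if "closedin (tp X) K" "lower_in X K" for K
    unfolding eqs by (rule openin_V_miss[OF that])
qed

lemma ple_dist_hom:
  assumes X: "X \<in> PosComp" shows "ple X \<in> dist_hom X X"
  unfolding dist_hom_iff[OF ple_subset[OF X]]
proof (intro conjI allI impI ballI; (elim conjE)?)
  show "ple X `` {x} \<in> closed_upper X" if "x \<in> sp X" for x
    using up_closed_upper[OF X that] by (simp add: Image_singleton)
  show "case p of (x, y) \<Rightarrow> ple X `` {y} \<subseteq> ple X `` {x}" if "p \<in> ple X" for p
    using that ple_trans[OF X] by auto
  have eq: "{x \<in> sp X. ple X `` {x} \<inter> U \<noteq> {}} = U" "{x \<in> sp X. ple X `` {x} \<inter> U = {}} = sp X - U"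
    if "lower_in X U" for U
    using that ple_refl[OF X] ple_points[OF X] unfolding lower_in_def by fast+
  show "openin (tp X) {x \<in> sp X. ple X `` {x} \<inter> U \<noteq> {}}" if "openin (tp X) U" "lower_in X U" for U
    unfolding eq[OF that(2)] by (rule that)
  show "openin (tp X) {x \<in> sp X. ple X `` {x} \<inter> K = {}}" if "closedin (tp X) K" "lower_in X K" for K
    unfolding eq[OF that(2)] using that by blast
qed (rule ple_subset[OF X])

text \<open>An order-reversing function takes its largest value on the principal upper set of
  \<open>x\<close> at \<open>x\<close> itself.\<close>

lemma sup_on_up:
  assumes X: "X \<in> PosComp" and x: "x \<in> sp X" and \<psi>: "\<psi> \<in> pos_hom X unit_op"
  shows "sup_on (ple X `` {x}) \<psi> = \<psi> x"
proof (rule antisym)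
  have "ple X `` {x} \<subseteq> sp X" using ple_points[OF X] by blast
  note mem = C_Pi[OF X \<psi> this]
  have "0 \<le> \<psi> x" using C_mem[OF X \<psi> x] by simp
  then show "sup_on (ple X `` {x}) \<psi> \<le> \<psi> x"
    using sup_on_le_iff[OF mem, of "\<psi> x"] C_antimono[OF X \<psi>] by auto
  show "\<psi> x \<le> sup_on (ple X `` {x}) \<psi>" using sup_on_ge[OF mem] ple_refl[OF X x] by simp
qed

lemma C_dist_ple:
  assumes X: "X \<in> PosComp"
  shows "C_dist X X (ple X) = (\<lambda>\<psi>\<in>pos_hom X unit_op. \<psi>)"
proof -
  have "C_dist X X (ple X) \<psi> = \<psi>" if "\<psi> \<in> pos_hom X unit_op" for \<psi>
    using C_dist_mem[OF ple_subset[OF X] X ple_dist_hom[OF X] that] that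
    by (rule C_eqI) (simp add: C_dist_apply that sup_on_up[OF X])
  then show ?thesis unfolding C_dist_def by (auto intro: restrict_ext)
qed

lemma dist_of_dist_hom:
  assumes X: "X \<in> PosComp" and Y: "Y \<in> PosComp" and f: "f \<in> pos_hom X Y"
  shows "dist_of X Y f \<in> dist_hom X Y"
  unfolding dist_hom_iff[OF ple_subset[OF X]]
proof (intro conjI allI impI ballI; (elim conjE)?)
  have eq: "dist_of X Y f `` {x} = ple Y `` {f x}" if "x \<in> sp X" for x
    using that ple_points[OF Y] by (auto simp: dist_of_def)
  show "dist_of X Y f \<subseteq> sp X \<times> sp Y" by (auto simp: dist_of_def)
  show "dist_of X Y f `` {x} \<in> closed_upper Y" if "x \<in> sp X" for x
    unfolding eq[OF that] using up_closed_upper[OF Y pos_hom_mem[OF f that]] by (simp add: Image_singleton)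
  show "case p of (x, y) \<Rightarrow> dist_of X Y f `` {y} \<subseteq> dist_of X Y f `` {x}" if "p \<in> ple X" for p
  proof (cases p)
    case (Pair x y)
    then have "x \<in> sp X" "y \<in> sp X" "(f x, f y) \<in> ple Y" using that ple_points[OF X] f unfolding pos_hom_def by auto
    then show ?thesis using ple_trans[OF Y] Pair by (auto simp: eq)
  qed
  have cont: "continuous_map (tp X) (tp Y) f" using f unfolding pos_hom_def by blast
  have m: "ple Y `` {f x} \<inter> U \<noteq> {} \<longleftrightarrow> f x \<in> U" if "x \<in> sp X" "lower_in Y U" for x U
    using that(2) ple_refl[OF Y pos_hom_mem[OF f that(1)]] unfolding lower_in_def by blast
  have eq2: "{x \<in> sp X. dist_of X Y f `` {x} \<inter> U \<noteq> {}} = {x \<in> sp X. f x \<in> U}"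
    "{x \<in> sp X. dist_of X Y f `` {x} \<inter> U = {}} = {x \<in> sp X. f x \<in> sp Y - U}"
    if U: "lower_in Y U" for U
  proof -
    have 1: "dist_of X Y f `` {x} \<inter> U \<noteq> {} \<longleftrightarrow> f x \<in> U" if "x \<in> sp X" for x
      using m[OF that U] unfolding eq[OF that] .
    then show "{x \<in> sp X. dist_of X Y f `` {x} \<inter> U \<noteq> {}} = {x \<in> sp X. f x \<in> U}"
      by (intro Collect_cong conj_cong refl)
    show "{x \<in> sp X. dist_of X Y f `` {x} \<inter> U = {}} = {x \<in> sp X. f x \<in> sp Y - U}"
    proof (intro Collect_cong conj_cong refl)
      fix x assume x: "x \<in> sp X"
      show "dist_of X Y f `` {x} \<inter> U = {} \<longleftrightarrow> f x \<in> sp Y - U"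
        using 1[OF x] pos_hom_mem[OF f x] by blast
    qed
  qed
  show "openin (tp X) {x \<in> sp X. dist_of X Y f `` {x} \<inter> U \<noteq> {}}" if "openin (tp Y) U" "lower_in Y U" for U
    unfolding eq2[OF that(2)] using cont that(1) by (rule openin_continuous_map_preimage)
  show "openin (tp X) {x \<in> sp X. dist_of X Y f `` {x} \<inter> K = {}}" if "closedin (tp Y) K" "lower_in Y K" for K
    unfolding eq2[OF that(2)] by (rule openin_continuous_map_preimage[OF cont]) (use that in blast)
qed

lemma C_dist_dist_of:
  assumes X: "X \<in> PosComp" and Y: "Y \<in> PosComp" and f: "f \<in> pos_hom X Y"
  shows "C_dist X Y (dist_of X Y f) = C_map X Y f"
proof -
  have eq: "dist_of X Y f `` {x} = ple Y `` {f x}" if "x \<in> sp X" for x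
    using that ple_points[OF Y] by (auto simp: dist_of_def)
  have "C_dist X Y (dist_of X Y f) \<psi> = compose (sp X) \<psi> f" if \<psi>: "\<psi> \<in> pos_hom Y unit_op" for \<psi>
    using C_dist_mem[OF ple_subset[OF X] Y dist_of_dist_hom[OF assms] \<psi>] pos_hom_compose[OF f \<psi> ple_subset[OF X]]
  proof (rule C_eqI)
    fix x assume x: "x \<in> sp X"
    show "C_dist X Y (dist_of X Y f) \<psi> x = compose (sp X) \<psi> f x"
      unfolding C_dist_apply[OF \<psi> x] compose_eq[OF x] eq[OF x] by (rule sup_on_up[OF Y pos_hom_mem[OF f x] \<psi>])
  qed
  then show ?thesis unfolding C_dist_def C_map_def by (auto intro: restrict_ext)
qed

text \<open>If \<open>y\<close> is outside the section at \<open>x\<close>, some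
  \<open>\<psi>\<close> is 0 on that section and 1 at \<open>y\<close>. The points whose section
  misses the set where \<open>\<psi>\<close> is at least 1/2, times the set where
  \<open>\<psi>\<close> exceeds 1/2, form an open box off \<open>\<phi>\<close>. Closedness ensures
  that images of closed sets are closed, as composition requires.\<close>

lemma dist_hom_closedin:
  assumes X: "X \<in> PosComp" and Y: "Y \<in> PosComp" and \<phi>: "\<phi> \<in> dist_hom X Y"
  shows "closedin (prod_topology (tp X) (tp Y)) \<phi>"
proof -
  note d = dist_homD[OF ple_subset[OF X] \<phi>]
  have "openin (prod_topology (tp X) (tp Y)) (sp X \<times> sp Y - \<phi>)"
    unfolding openin_prod_topology_alt
  proof (intro allI impI)
    fix x y assume "(x, y) \<in> sp X \<times> sp Y - \<phi>"
    then have xy: "x \<in> sp X" "y \<in> sp Y" "y \<notin> \<phi> `` {x}" by auto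
    then obtain \<psi> where \<psi>: "\<psi> \<in> pos_hom Y unit_op" "\<And>z. z \<in> \<phi> `` {x} \<Longrightarrow> \<psi> z = 0" "\<psi> y = 1"
      using separating_function[OF Y d(2)[OF xy(1)] xy(2,3)] by metis
    define K where "K = {z \<in> sp Y. 1/2 \<le> \<psi> z}"
    define V where "V = {z \<in> sp Y. 1/2 < \<psi> z}"
    have "closedin (tp Y) K" unfolding K_def by (rule closedin_le_fun) (simp_all add: C_cont[OF Y \<psi>(1)])
    moreover have "lower_in Y K"
      unfolding lower_in_def K_def using C_antimono[OF Y \<psi>(1)] ple_points[OF Y] by fastforce
    ultimately have "openin (tp X) {x \<in> sp X. \<phi> `` {x} \<inter> K = {}}" by (rule d(5))
    moreover have "openin (tp Y) V" unfolding V_def by (rule openin_less_fun) (simp_all add: C_cont[OF Y \<psi>(1)])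
    moreover have "\<phi> `` {x} \<inter> K = {}" using \<psi>(2) unfolding K_def by fastforce
    moreover have "y \<in> V" using xy \<psi>(3) unfolding V_def by simp
    moreover have "{x \<in> sp X. \<phi> `` {x} \<inter> K = {}} \<times> V \<subseteq> sp X \<times> sp Y - \<phi>"
      unfolding V_def K_def by auto
    ultimately show "\<exists>U V. openin (tp X) U \<and> openin (tp Y) V \<and> x \<in> U \<and> y \<in> V \<and> U \<times> V \<subseteq> sp X \<times> sp Y - \<phi>"
      using xy(1) by (intro exI[of _ "{x \<in> sp X. \<phi> `` {x} \<inter> K = {}}"] exI[of _ V]) auto
  qed
  then show ?thesis using d(1) unfolding closedin_def by simp
qed

lemma dist_hom_comp:
  assumes X: "X \<in> PosComp" and Y: "Y \<in> PosComp" and Z: "Z \<in> PosComp"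
    and \<phi>: "\<phi> \<in> dist_hom X Y" and \<theta>: "\<theta> \<in> dist_hom Y Z"
  shows "\<phi> O \<theta> \<in> dist_hom X Z"
proof -
  note d = dist_homD[OF ple_subset[OF X] \<phi>] and e = dist_homD[OF ple_subset[OF Y] \<theta>]
  have eq: "(\<phi> O \<theta>) `` {x} = \<theta> `` (\<phi> `` {x})" for x by (simp add: relcomp_Image)
  have sub: "\<phi> `` {x} \<subseteq> sp Y" for x using d(1) by blast
  \<comment> \<open>Sections shrink along the order, so the points whose section meets
    \<open>U\<close> form a lower set. The continuity conditions on \<open>\<phi>\<close> can
    therefore be applied to it.\<close>
  have low: "lower_in Y {y \<in> sp Y. \<theta> `` {y} \<inter> U \<noteq> {}}" for U
    unfolding lower_in_def
  proof (intro conjI ballI)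
    fix p assume p: "p \<in> ple Y"
    obtain a b where ab: "p = (a, b)" by (cases p)
    have "\<theta> `` {b} \<subseteq> \<theta> `` {a}" "a \<in> sp Y" using p e(3)[of a b] ple_points[OF Y, of a b] unfolding ab by simp_all
    then show "case p of (x, y) \<Rightarrow> y \<in> {y \<in> sp Y. \<theta> `` {y} \<inter> U \<noteq> {}} \<longrightarrow> x \<in> {y \<in> sp Y. \<theta> `` {y} \<inter> U \<noteq> {}}"
      unfolding ab by blast
  qed blast
  have hit: "\<theta> `` (\<phi> `` {x}) \<inter> U \<noteq> {} \<longleftrightarrow> \<phi> `` {x} \<inter> {y \<in> sp Y. \<theta> `` {y} \<inter> U \<noteq> {}} \<noteq> {}" for x U
    using sub[of x] by blast
  show ?thesis
    unfolding dist_hom_iff[OF ple_subset[OF X]] eq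
  proof (intro conjI allI impI ballI; (elim conjE)?)
    show "\<phi> O \<theta> \<subseteq> sp X \<times> sp Z" using d(1) e(1) by blast
    show "\<theta> `` (\<phi> `` {x}) \<in> closed_upper Z" if x: "x \<in> sp X" for x
    proof -
      have "\<phi> `` {x} \<in> closed_upper Y" by (rule d(2)[OF x])
      from closedin_relation_Image[OF PosComp_compact[OF Y] dist_hom_closedin[OF Y Z \<theta>] closed_upper_closed[OF this]]
      have "closedin (tp Z) (\<theta> `` (\<phi> `` {x}))" .
      moreover have "upper_in Z (\<theta> `` (\<phi> `` {x}))"
        unfolding upper_in_def
      proof (intro conjI ballI)
        show "\<theta> `` (\<phi> `` {x}) \<subseteq> sp Z" using e(1) by blast
        fix p assume p: "p \<in> ple Z"
        show "case p of (a, b) \<Rightarrow> a \<in> \<theta> `` (\<phi> `` {x}) \<longrightarrow> b \<in> \<theta> `` (\<phi> `` {x})"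
        proof (cases p)
          case (Pair a b)
          have "b \<in> \<theta> `` (\<phi> `` {x})" if a: "a \<in> \<theta> `` (\<phi> `` {x})"
          proof -
            obtain y where y: "y \<in> \<phi> `` {x}" "a \<in> \<theta> `` {y}" using a by blast
            then have "\<theta> `` {y} \<in> closed_upper Z" using sub by (intro e(2)) blast
            then have "b \<in> \<theta> `` {y}" using y(2) p unfolding Pair by (rule closed_upper_upper)
            then show ?thesis using y by blast
          qed
          then show ?thesis using Pair by simp
        qed
      qed
      ultimately show ?thesis unfolding closed_upper_def by blast
    qed
    show "case p of (x, y) \<Rightarrow> \<theta> `` (\<phi> `` {y}) \<subseteq> \<theta> `` (\<phi> `` {x})" if "p \<in> ple X" for p
    proof (cases p)
      case (Pair x y)
      then have "\<phi> `` {y} \<subseteq> \<phi> `` {x}" using that by (intro d(3)) simp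
      then show ?thesis using Pair by blast
    qed
    show "openin (tp X) {x \<in> sp X. \<theta> `` (\<phi> `` {x}) \<inter> U \<noteq> {}}" if "openin (tp Z) U" "lower_in Z U" for U
    proof -
      have "openin (tp Y) {y \<in> sp Y. \<theta> `` {y} \<inter> U \<noteq> {}}" by (rule e(4)[OF that])
      then show ?thesis unfolding hit using low[of U] by (rule d(4))
    qed
    show "openin (tp X) {x \<in> sp X. \<theta> `` (\<phi> `` {x}) \<inter> K = {}}" if "closedin (tp Z) K" "lower_in Z K" for K
    proof -
      have "openin (tp Y) {y \<in> sp Y. \<theta> `` {y} \<inter> K = {}}" by (rule e(5)[OF that])
      \<comment> \<open>For closed \<open>K\<close> the miss condition on \<open>\<theta>\<close>,
        read on complements, makes the set of points whose section meets \<open>K\<close> closed, so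
        that the miss condition on \<open>\<phi>\<close> applies.\<close>
      then have "closedin (tp Y) (sp Y - {y \<in> sp Y. \<theta> `` {y} \<inter> K = {}})" by blast
      moreover have "sp Y - {y \<in> sp Y. \<theta> `` {y} \<inter> K = {}} = {y \<in> sp Y. \<theta> `` {y} \<inter> K \<noteq> {}}" by blast
      ultimately have c: "closedin (tp Y) {y \<in> sp Y. \<theta> `` {y} \<inter> K \<noteq> {}}" by simp
      have "{x \<in> sp X. \<theta> `` (\<phi> `` {x}) \<inter> K = {}} = {x \<in> sp X. \<phi> `` {x} \<inter> {y \<in> sp Y. \<theta> `` {y} \<inter> K \<noteq> {}} = {}}"
        using hit[of _ K] by blast
      then show ?thesis using d(5)[OF c low[of K]] by simp
    qed
  qed
qed

lemma C_dist_comp: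
  assumes X: "X \<in> PosComp" and Y: "Y \<in> PosComp" and Z: "Z \<in> PosComp"
    and \<phi>: "\<phi> \<in> dist_hom X Y" and \<theta>: "\<theta> \<in> dist_hom Y Z"
  shows "C_dist X Z (\<phi> O \<theta>) = compose (pos_hom Z unit_op) (C_dist X Y \<phi>) (C_dist Y Z \<theta>)"
proof -
  have "C_dist X Z (\<phi> O \<theta>) \<psi> = C_dist X Y \<phi> (C_dist Y Z \<theta> \<psi>)" if \<psi>: "\<psi> \<in> pos_hom Z unit_op" for \<psi>
  proof (rule C_eqI)
    show "C_dist X Z (\<phi> O \<theta>) \<psi> \<in> pos_hom X unit_op"
      by (rule C_dist_mem[OF ple_subset[OF X] Z dist_hom_comp[OF assms] \<psi>])
    have m: "C_dist Y Z \<theta> \<psi> \<in> pos_hom Y unit_op" by (rule C_dist_mem[OF ple_subset[OF Y] Z \<theta> \<psi>])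
    then show "C_dist X Y \<phi> (C_dist Y Z \<theta> \<psi>) \<in> pos_hom X unit_op"
      by (rule C_dist_mem[OF ple_subset[OF X] Y \<phi>])
    fix x assume x: "x \<in> sp X"
    have "\<theta> `` B \<subseteq> sp Z" for B using \<theta> unfolding dist_hom_def by blast
    note memZ = C_Pi[OF Z \<psi> this]
    have sub: "\<phi> `` {x} \<subseteq> sp Y" using \<phi> unfolding dist_hom_def by blast
    note memY = C_Pi[OF Y m sub]
    have le: "sup_on (\<theta> `` (\<phi> `` {x})) \<psi> \<le> w \<longleftrightarrow> sup_on (\<phi> `` {x}) (C_dist Y Z \<theta> \<psi>) \<le> w" if w: "0 \<le> w" for w
    proof -
      have "sup_on (\<phi> `` {x}) (C_dist Y Z \<theta> \<psi>) \<le> w \<longleftrightarrow> (\<forall>y\<in>\<phi> `` {x}. sup_on (\<theta> `` {y}) \<psi> \<le> w)"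
        using sup_on_le_iff[OF memY w] C_dist_apply[OF \<psi> subsetD[OF sub]] by simp
      also have "\<dots> \<longleftrightarrow> (\<forall>y\<in>\<phi> `` {x}. \<forall>z\<in>\<theta> `` {y}. \<psi> z \<le> w)"
        using sup_on_le_iff[OF memZ w] by simp
      also have "\<dots> \<longleftrightarrow> (\<forall>z\<in>\<theta> `` (\<phi> `` {x}). \<psi> z \<le> w)" by blast
      also have "\<dots> \<longleftrightarrow> sup_on (\<theta> `` (\<phi> `` {x})) \<psi> \<le> w" using sup_on_le_iff[OF memZ w] by simp
      finally show ?thesis by simp
    qed
    have "sup_on (\<theta> `` (\<phi> `` {x})) \<psi> = sup_on (\<phi> `` {x}) (C_dist Y Z \<theta> \<psi>)"
      using le[OF sup_on_nonneg[OF memZ]] le[OF sup_on_nonneg[OF memY]] by (meson antisym order_refl)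
    then show "C_dist X Z (\<phi> O \<theta>) \<psi> x = C_dist X Y \<phi> (C_dist Y Z \<theta> \<psi>) x"
      unfolding C_dist_apply[OF \<psi> x] C_dist_apply[OF m x] relcomp_Image .
  qed
  then show ?thesis unfolding compose_def C_dist_def[of X Z] by (auto intro: restrict_ext)
qed

context tnorm begin

text \<open>\<open>T u\<close>, weighted suprema and truncated minus all commute with suprema over
  points. For products only an inequality remains, since two functions may approach their suprema at
  different points; hence the lax morphisms.\<close>

lemma sup_on_lax_hom:
  assumes X: "X \<in> PosComp" and A: "A \<subseteq> sp X"
  shows "(\<lambda>\<psi>\<in>pos_hom X unit_op. sup_on A \<psi>) \<in> lax_hom T (C_obj T X) (unit_mon T)"
proof -
  interpret P: pointwise T "C_obj T X" "sp X" "\<lambda>x \<psi>. \<psi> x" using X by (rule pointwise_C)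
  let ?s = "\<lambda>\<psi>\<in>pos_hom X unit_op. sup_on A \<psi>"
  note M = C_Pi[OF X _ A]
  have m: "\<psi> x \<in> {0..1}" if "\<psi> \<in> pos_hom X unit_op" "x \<in> A" for \<psi> x
    using C_mem[OF X that(1)] A that(2) by blast
  note sm = sup_on_mem[OF M] and s0 = sup_on_nonneg[OF M] and ge = sup_on_ge[OF M] and le = sup_on_le_iff[OF M]
  have Tsup: "T u (sup_on A \<psi>) = sup_on A (\<lambda>x. T u (\<psi> x))" if "\<psi> \<in> pos_hom X unit_op" "u \<in> {0..1}" for u \<psi>
    unfolding sup_on_def using that m by (intro T_sup01)
  show ?thesis
    unfolding lax_hom_unit_iff[OF C_obj_MonObj[OF X]] pts_C mul_C tminus_C
  proof (intro conjI ballI allI impI; (elim conjE)?)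
    show "?s \<in> pos_hom X unit_op \<rightarrow>\<^sub>E {0..1}" using sm by (auto simp del: atLeastAtMost_iff)
    show "T (?s \<psi>) (uhom (C_obj T X) \<psi> \<phi>) \<le> ?s \<phi>"
      if \<psi>: "\<psi> \<in> pos_hom X unit_op" and \<phi>: "\<phi> \<in> pos_hom X unit_op" for \<psi> \<phi>
    proof -
      let ?u = "uhom (C_obj T X) \<psi> \<phi>"
      have u: "?u \<in> {0..1}" using \<psi> \<phi> by (intro P.uhom_mem) auto
      have "T (sup_on A \<psi>) ?u = sup_on A (\<lambda>x. T ?u (\<psi> x))" using Tsup[OF \<psi> u] T_comm[OF sm[OF \<psi>] u] by simp
      moreover have "sup_on A (\<lambda>x. T ?u (\<psi> x)) \<le> sup_on A \<phi>"
      proof (subst sup_on_le_iff)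
        show "(\<lambda>x. T ?u (\<psi> x)) \<in> A \<rightarrow> {0..1}" using T_mem[OF u m[OF \<psi>]] by blast
        show "\<forall>x\<in>A. T ?u (\<psi> x) \<le> sup_on A \<phi>"
        proof
          fix x assume x: "x \<in> A"
          have "T ?u (\<psi> x) = T (\<psi> x) ?u" using u m[OF \<psi> x] by (rule T_comm)
          also have "\<dots> \<le> \<phi> x" using \<psi> \<phi> x A by (intro P.e_uhom_le) auto
          also have "\<dots> \<le> sup_on A \<phi>" using ge[OF \<phi> x] .
          finally show "T ?u (\<psi> x) \<le> sup_on A \<phi>" .
        qed
      qed (rule s0[OF \<phi>])
      ultimately show ?thesis using \<psi> \<phi> by simp
    qed
    show "?s c = sup01 {T (w i) (?s (h i)) | i. i \<in> pts D}"
      if fd: "fin_diagram T (C_obj T X) D h w" and col: "is_colimit T (C_obj T X) D h w c" for D h w c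
    proof -
      have h: "h i \<in> pos_hom X unit_op" "w i \<in> {0..1}" if "i \<in> pts D" for i
        using fd that unfolding fin_diagram_def ufunctor_def uweight_def by auto
      have c: "c \<in> pos_hom X unit_op" "\<And>x. x \<in> A \<Longrightarrow> c x = sup01 {T (w i) (h i x) | i. i \<in> pts D}"
        using col P.is_colimit_iff[of D h w c] h fd A unfolding fin_diagram_def by auto
      have Tm: "T (w i) (h i x) \<in> {0..1}" if "i \<in> pts D" "x \<in> A" for i x
        using h[OF that(1)] m[OF _ that(2)] by (intro T_mem)
      have "sup01 {T (w i) (?s (h i)) | i. i \<in> pts D} = sup_on A c"
      proof (rule sup01_eqI)
        show "T (w i) (?s (h i)) \<in> {0..1}" if "i \<in> pts D" for i
          using h[OF that] sm by (simp del: atLeastAtMost_iff)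
        show "0 \<le> sup_on A c" using s0[OF c(1)] .
        fix v :: real assume v: "0 \<le> v"
        have "sup_on A c \<le> v \<longleftrightarrow> (\<forall>x\<in>A. \<forall>i. i \<in> pts D \<longrightarrow> T (w i) (h i x) \<le> v)"
        proof -
          have "c x \<le> v \<longleftrightarrow> (\<forall>i. i \<in> pts D \<longrightarrow> T (w i) (h i x) \<le> v)" if "x \<in> A" for x
            unfolding c(2)[OF that] using Tm[OF _ that] v by (rule sup01_le_iff)
          then show ?thesis using le[OF c(1) v] by auto
        qed
        moreover have "T (w i) (?s (h i)) \<le> v \<longleftrightarrow> (\<forall>x\<in>A. T (w i) (h i x) \<le> v)" if i: "i \<in> pts D" for i
        proof -
          have "T (w i) (?s (h i)) = sup_on A (\<lambda>x. T (w i) (h i x))" using Tsup[OF h[OF i]] h[OF i] by simp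
          then show ?thesis using sup_on_le_iff[of "\<lambda>x. T (w i) (h i x)" A v] Tm[OF i] v by (simp add: Pi_iff)
        qed
        ultimately show "sup_on A c \<le> v \<longleftrightarrow> (\<forall>i. i \<in> pts D \<longrightarrow> T (w i) (?s (h i)) \<le> v)" by auto
      qed
      then show ?thesis using c by simp
    qed
    show "?s (\<lambda>x\<in>sp X. T (\<psi> x) (\<phi> x)) \<le> T (?s \<psi>) (?s \<phi>)"
      if \<psi>: "\<psi> \<in> pos_hom X unit_op" and \<phi>: "\<phi> \<in> pos_hom X unit_op" for \<psi> \<phi>
    proof -
      note p = C_T[OF X \<psi> \<phi>]
      have "sup_on A (\<lambda>x\<in>sp X. T (\<psi> x) (\<phi> x)) \<le> T (sup_on A \<psi>) (sup_on A \<phi>)"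
      proof (subst le[OF p])
        show "0 \<le> T (sup_on A \<psi>) (sup_on A \<phi>)" using T_bounds[OF sm[OF \<psi>] sm[OF \<phi>]] by blast
        have "T (\<psi> x) (\<phi> x) \<le> T (sup_on A \<psi>) (sup_on A \<phi>)" if "x \<in> A" for x
          by (intro T_mono m ge sm \<psi> \<phi> that)
        then show "\<forall>x\<in>A. (\<lambda>x\<in>sp X. T (\<psi> x) (\<phi> x)) x \<le> T (sup_on A \<psi>) (sup_on A \<phi>)" using A by auto
      qed
      then show ?thesis using p \<psi> \<phi> by simp
    qed
    show "?s (\<lambda>x\<in>sp X. max (\<psi> x - u) 0) = max (?s \<psi> - u) 0"
      if \<psi>: "\<psi> \<in> pos_hom X unit_op" and u: "u \<in> {0..1}" for \<psi> u
    proof -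
      note p = C_tminus[OF X \<psi> u]
      have *: "sup_on A (\<lambda>x\<in>sp X. max (\<psi> x - u) 0) \<le> v \<longleftrightarrow> max (sup_on A \<psi> - u) 0 \<le> v" if v: "0 \<le> v" for v
      proof -
        have "sup_on A (\<lambda>x\<in>sp X. max (\<psi> x - u) 0) \<le> v \<longleftrightarrow> (\<forall>x\<in>A. \<psi> x \<le> u + v)"
          using le[OF p v] A v by (auto simp: subset_iff diff_le_eq add.commute)
        also have "\<dots> \<longleftrightarrow> sup_on A \<psi> \<le> u + v" using le[OF \<psi>, of "u + v"] u v by auto
        finally show ?thesis using v by auto
      qed
      have "sup_on A (\<lambda>x\<in>sp X. max (\<psi> x - u) 0) = max (sup_on A \<psi> - u) 0"
        using *[OF s0[OF p]] *[of "max (sup_on A \<psi> - u) 0"] by auto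
      then show ?thesis using p \<psi> by simp
    qed
  qed
qed

lemma C_dist_lax_hom:
  assumes X: "X \<in> PosComp" and Y: "Y \<in> PosComp" and \<phi>: "\<phi> \<in> dist_hom X Y"
  shows "C_dist X Y \<phi> \<in> lax_hom T (C_obj T Y) (C_obj T X)"
proof (subst lax_hom_C_iff[OF C_obj_MonObj[OF Y] X])
  show "C_dist X Y \<phi> \<in> pts (C_obj T Y) \<rightarrow>\<^sub>E pos_hom X unit_op"
    using C_dist_mem[OF ple_subset[OF X] Y \<phi>] by (auto simp: C_dist_def)
  show "\<forall>x\<in>sp X. (\<lambda>a\<in>pts (C_obj T Y). C_dist X Y \<phi> a x) \<in> lax_hom T (C_obj T Y) (unit_mon T)"
  proof
    fix x assume x: "x \<in> sp X"
    have "(\<lambda>a\<in>pts (C_obj T Y). C_dist X Y \<phi> a x) = (\<lambda>\<psi>\<in>pos_hom Y unit_op. sup_on (\<phi> `` {x}) \<psi>)"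
      unfolding pts_C by (rule restrict_ext) (simp add: C_dist_apply x)
    moreover have "\<phi> `` {x} \<subseteq> sp Y" using \<phi> unfolding dist_hom_def by blast
    ultimately show "(\<lambda>a\<in>pts (C_obj T Y). C_dist X Y \<phi> a x) \<in> lax_hom T (C_obj T Y) (unit_mon T)"
      using sup_on_lax_hom[OF Y] by simp
  qed
qed

end


section \<open>Representation of lax functionals\<close>

lemma sup01_singleton:
  assumes "f a \<in> {0..1}" shows "sup01 {f i | i. i \<in> {a}} = f a"
  by (rule sup01_eqI) (use assms in auto)

lemma sup01_pair:
  assumes "f a \<in> {0..1}" "f b \<in> {0..1}" shows "sup01 {f i | i. i \<in> {a, b}} = max (f a) (f b)"
  by (rule sup01_eqI) (use assms in auto)

definition zero_set :: "'a pospace \<Rightarrow> (('a \<Rightarrow> real) \<Rightarrow> real) \<Rightarrow> 'a set" where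
  "zero_set X \<Phi> = {x \<in> sp X. \<forall>\<rho>\<in>pos_hom X unit_op. \<Phi> \<rho> = 0 \<longrightarrow> \<rho> x = 0}"

lemma zero_set_closed_upper:
  assumes X: "X \<in> PosComp" shows "zero_set X \<Phi> \<in> closed_upper X"
proof -
  have "closedin (tp X) (zero_set X \<Phi>)"
    unfolding zero_set_def
    by (intro closedin_Collect_ball closedin_Collect_imp closedin_eq_fun) (simp_all add: C_cont[OF X])
  moreover have "y \<in> zero_set X \<Phi>" if x: "x \<in> zero_set X \<Phi>" and xy: "(x, y) \<in> ple X" for x y
  proof -
    have "\<rho> y = 0" if \<rho>: "\<rho> \<in> pos_hom X unit_op" "\<Phi> \<rho> = 0" for \<rho>
    proof -
      have "\<rho> x = 0" using x \<rho> unfolding zero_set_def by blast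
      then show ?thesis using C_antimono[OF X \<rho>(1) xy] C_mem[OF X \<rho>(1) ple_points(2)[OF X xy]] by simp
    qed
    then show ?thesis using ple_points(2)[OF X xy] unfolding zero_set_def by blast
  qed
  ultimately show ?thesis unfolding closed_upper_def upper_in_def zero_set_def by blast
qed

context tnorm begin

context
  fixes X :: "'a pospace" and \<Phi> :: "('a \<Rightarrow> real) \<Rightarrow> real"
  assumes X: "X \<in> PosComp" and \<Phi>: "\<Phi> \<in> lax_hom T (C_obj T X) (unit_mon T)"
begin

lemma functional_mem: "\<psi> \<in> pos_hom X unit_op \<Longrightarrow> \<Phi> \<psi> \<in> {0..1}"
  using lax_hom_mem[OF \<Phi>, of \<psi>] by simp

lemmas functional = \<Phi>[unfolded lax_hom_unit_iff[OF C_obj_MonObj[OF X]] pts_C mul_C tminus_C]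

lemma functional_mono:
  assumes \<psi>: "\<psi> \<in> pos_hom X unit_op" and \<phi>: "\<phi> \<in> pos_hom X unit_op" and le: "\<And>x. x \<in> sp X \<Longrightarrow> \<psi> x \<le> \<phi> x"
  shows "\<Phi> \<psi> \<le> \<Phi> \<phi>"
proof -
  have "uhom (C_obj T X) \<psi> \<phi> = 1" using nat_le_C[OF X \<psi> \<phi>] le by (simp add: nat_le_def)
  moreover have "T (\<Phi> \<psi>) (uhom (C_obj T X) \<psi> \<phi>) \<le> \<Phi> \<phi>" using functional \<psi> \<phi> by blast
  ultimately show ?thesis using T_1_right[OF functional_mem[OF \<psi>]] by simp
qed

lemma functional_mult:
  "\<psi> \<in> pos_hom X unit_op \<Longrightarrow> \<phi> \<in> pos_hom X unit_op \<Longrightarrow> \<Phi> (\<lambda>x\<in>sp X. T (\<psi> x) (\<phi> x)) \<le> T (\<Phi> \<psi>) (\<Phi> \<phi>)"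
  using functional by blast

lemma functional_tminus:
  "\<psi> \<in> pos_hom X unit_op \<Longrightarrow> u \<in> {0..1} \<Longrightarrow> \<Phi> (\<lambda>x\<in>sp X. max (\<psi> x - u) 0) = max (\<Phi> \<psi> - u) 0"
  using functional by blast

lemma functional_finite_sup:
  assumes N: "finite (N :: nat set)" and wh: "\<And>i. i \<in> N \<Longrightarrow> w i \<in> {0..1} \<and> h i \<in> pos_hom X unit_op"
    and c: "c \<in> pos_hom X unit_op" "\<And>x. x \<in> sp X \<Longrightarrow> c x = sup01 {T (w i) (h i x) | i. i \<in> N}"
  shows "\<Phi> c = sup01 {T (w i) (\<Phi> (h i)) | i. i \<in> N}"
proof -
  interpret P: pointwise T "C_obj T X" "sp X" "\<lambda>x \<psi>. \<psi> x" using X by (rule pointwise_C)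
  \<comment> \<open>The discrete category on \<open>N\<close>: its homs between distinct indices are
    0 and \<open>T 0 v = 0\<close>, so every family is a functor and all weights are compatible.
    Cocontinuity thus yields arbitrary finite weighted suprema.\<close>
  define D :: "nat ucat" where "D = \<lparr>pts = N, uhom = (\<lambda>i j. if i = j then 1 else 0)\<rparr>"
  have uh: "uhom (C_obj T X) (h i) (h j) \<in> {0..1}" if "i \<in> N" "j \<in> N" for i j
    using wh[OF that(1)] wh[OF that(2)] by (intro P.uhom_mem) simp_all
  have "uhom (C_obj T X) (h i) (h i) = 1" if "i \<in> N" for i
    using P.ucategory wh[OF that] unfolding ucategory_def by simp
  then have "ufunctor D (C_obj T X) h"
    unfolding ufunctor_def using uh wh by (auto simp: D_def)
  moreover have "ucategory T D"
    unfolding ucategory_def by (auto simp: D_def T_1_left T_0_left T_0_right)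
  moreover have "uweight T D w"
    unfolding uweight_def using wh by (auto simp: D_def T_1_left T_0_left)
  ultimately have fd: "fin_diagram T (C_obj T X) D h w" unfolding fin_diagram_def using N by (simp add: D_def)
  have "is_colimit T (C_obj T X) D h w c"
    using wh c N by (subst P.is_colimit_iff) (simp_all add: D_def)
  then have "\<Phi> c = sup01 {T (w i) (\<Phi> (h i)) | i. i \<in> pts D}" using functional fd by blast
  then show ?thesis by (simp add: D_def)
qed

lemma functional_max:
  assumes \<psi>: "\<psi> \<in> pos_hom X unit_op" and \<phi>: "\<phi> \<in> pos_hom X unit_op"
  shows "\<Phi> (\<lambda>x\<in>sp X. max (\<psi> x) (\<phi> x)) = max (\<Phi> \<psi>) (\<Phi> \<phi>)"
proof -
  define h where "h i = (if i = 0 then \<psi> else \<phi>)" for i :: nat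
  have "\<Phi> (\<lambda>x\<in>sp X. max (\<psi> x) (\<phi> x)) = sup01 {T 1 (\<Phi> (h i)) | i. i \<in> {0, 1}}"
  proof (rule functional_finite_sup)
    fix x assume x: "x \<in> sp X"
    note m = C_mem[OF X \<psi> x] C_mem[OF X \<phi> x]
    show "(\<lambda>x\<in>sp X. max (\<psi> x) (\<phi> x)) x = sup01 {T 1 (h i x) | i. i \<in> {0, 1}}"
      using sup01_pair[of "\<lambda>i. T 1 (h i x)" 0 1] m x T_1_left[OF m(1)] T_1_left[OF m(2)] by (simp add: h_def)
  qed (use \<psi> \<phi> C_max[OF X \<psi> \<phi>] in \<open>auto simp: h_def\<close>)
  also have "\<dots> = max (\<Phi> \<psi>) (\<Phi> \<phi>)"
    using sup01_pair[of "\<lambda>i. T 1 (\<Phi> (h i))" 0 1] functional_mem[OF \<psi>] functional_mem[OF \<phi>]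
      T_1_left[OF functional_mem[OF \<psi>]] T_1_left[OF functional_mem[OF \<phi>]] by (simp add: h_def)
  finally show ?thesis .
qed

lemma functional_copower:
  assumes \<psi>: "\<psi> \<in> pos_hom X unit_op" and u: "u \<in> {0..1}"
  shows "\<Phi> (\<lambda>x\<in>sp X. T (\<psi> x) u) = T (\<Phi> \<psi>) u"
proof -
  have "\<Phi> (\<lambda>x\<in>sp X. T (\<psi> x) u) = sup01 {T u (\<Phi> \<psi>) | i. i \<in> {0::nat}}"
  proof (rule functional_finite_sup)
    fix x assume x: "x \<in> sp X"
    note m = C_mem[OF X \<psi> x]
    show "(\<lambda>x\<in>sp X. T (\<psi> x) u) x = sup01 {T u (\<psi> x) | i. i \<in> {0::nat}}"
      using sup01_singleton[of "\<lambda>i. T u (\<psi> x)" "0::nat", OF T_mem[OF u m]] x T_comm[OF u m] by simp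
  qed (use \<psi> u C_copower[OF X \<psi> u] in auto)
  also have "\<dots> = T (\<Phi> \<psi>) u"
    using sup01_singleton[of "\<lambda>i. T u (\<Phi> \<psi>)" "0::nat", OF T_mem[OF u functional_mem[OF \<psi>]]]
      T_comm[OF u functional_mem[OF \<psi>]] by simp
  finally show ?thesis .
qed

text \<open>For a set \<open>C\<close> on which some \<open>\<rho>\<close> with \<open>\<Phi> \<rho> = 0\<close> is bounded below by \<open>\<epsilon>\<close>, the infimum \<open>e\<close> of
  \<open>\<Phi> \<xi>\<close> over all \<open>\<xi>\<close> equal to \<open>1\<close> on \<open>C\<close> is idempotent because \<open>\<Phi>\<close> is lax, and \<open>e \<otimes> \<epsilon>/2 = 0\<close>.
  Hence \<open>e = 0\<close>.\<close>

lemma functional_Inf_eq_0: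
  assumes \<rho>: "\<rho> \<in> pos_hom X unit_op" "\<Phi> \<rho> = 0" and C: "C \<subseteq> sp X"
    and \<epsilon>: "0 < \<epsilon>" "\<epsilon> \<le> 1" "\<And>x. x \<in> C \<Longrightarrow> \<epsilon> \<le> \<rho> x" and t: "0 < t"
  shows "\<exists>\<xi>\<in>pos_hom X unit_op. (\<forall>x\<in>C. \<xi> x = 1) \<and> \<Phi> \<xi> < t"
proof -
  define E where "E = \<Phi> ` {\<xi> \<in> pos_hom X unit_op. \<forall>x\<in>C. \<xi> x = 1}"
  define e where "e = Inf E"
  have E01: "s \<in> {0..1}" if "s \<in> E" for s using that functional_mem unfolding E_def by blast
  then have bdd: "bdd_below E" by (intro bdd_belowI[of _ 0]) auto
  have c1: "(\<lambda>x\<in>sp X. 1) \<in> pos_hom X unit_op" by (rule C_const[OF X]) simp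
  have "\<Phi> (\<lambda>x\<in>sp X. 1) \<in> E" unfolding E_def using C by (intro imageI CollectI conjI c1) auto
  then have ne: "E \<noteq> {}" by blast
  have e_le: "e \<le> s" if "s \<in> E" for s unfolding e_def using that bdd by (rule cInf_lower)
  have e0: "0 \<le> e" unfolding e_def by (rule cInf_greatest[OF ne]) (use E01 in auto)
  obtain s0 where "s0 \<in> E" using ne by blast
  then have e1: "e \<le> 1" using e_le[of s0] E01[of s0] by simp
  have e: "e \<in> {0..1}" using e0 e1 by simp
  \<comment> \<open>The functions equal to 1 on \<open>C\<close> are closed under \<open>T\<close>,
    so laxness puts \<open>T s s\<close> above a member of \<open>E\<close>.\<close>
  have idem: "e \<le> T s s" if s: "s \<in> E" for s
  proof -
    obtain \<xi> where \<xi>: "\<xi> \<in> pos_hom X unit_op" "\<forall>x\<in>C. \<xi> x = 1" "s = \<Phi> \<xi>" using s unfolding E_def by blast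
    have "T (1::real) 1 = 1" by (rule T_1_left) simp
    then have "\<Phi> (\<lambda>x\<in>sp X. T (\<xi> x) (\<xi> x)) \<in> E"
      unfolding E_def using \<xi>(2) C by (intro imageI CollectI conjI C_T[OF X \<xi>(1) \<xi>(1)]) auto
    then show ?thesis using e_le functional_mult[OF \<xi>(1) \<xi>(1)] \<xi>(3) by fastforce
  qed
  have Tee: "T e e = e"
  proof (rule antisym[OF T_le_left[OF e e]], rule ccontr)
    assume "\<not> e \<le> T e e"
    then have lt: "0 < e - T e e" by simp
    \<comment> \<open>Continuity of squaring at \<open>e\<close>: a member \<open>s\<close> of
      \<open>E\<close> close enough to the infimum would satisfy \<open>T s s < e\<close>, against
      \<open>idem\<close>.\<close>
    have "continuous_on {0..1} (\<lambda>s. (\<lambda>(u, v). T u v) (s, s))"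
      by (rule continuous_on_compose2[OF T_cont]) (auto intro!: continuous_intros)
    then have "continuous_on {0..1} (\<lambda>s. T s s)" by simp
    then obtain \<delta> where \<delta>: "0 < \<delta>" "\<And>s. s \<in> {0..1} \<Longrightarrow> dist s e < \<delta> \<Longrightarrow> dist (T s s) (T e e) < e - T e e"
      using e lt unfolding continuous_on_iff by metis
    have "Inf E < e + \<delta>" using \<delta>(1) by (simp add: e_def)
    then obtain s where s: "s \<in> E" "s < e + \<delta>" using cInf_less_iff[OF ne bdd] by blast
    then have "dist s e < \<delta>" using e_le[OF s(1)] by (simp add: dist_real_def)
    then have "T s s < e" using \<delta>(2)[OF E01[OF s(1)]] by (simp add: dist_real_def)
    then show False using idem[OF s(1)] by simp
  qed
  \<comment> \<open>\<open>g\<close> vanishes up to \<open>\<epsilon> / 2\<close> and equals 1 from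
    \<open>\<epsilon>\<close> on. Hence \<open>\<xi>\<close> is 1 on \<open>C\<close>, and wherever
    \<open>\<xi>\<close> is nonzero \<open>\<rho>\<close> exceeds \<open>\<epsilon> / 2\<close>, so
    that \<open>T (\<xi> x) (\<epsilon> / 2) \<le> \<rho> x\<close> everywhere.\<close>
  define g where "g r = min 1 (max 0 (2 / \<epsilon> * r - 1))" for r :: real
  define \<xi> where "\<xi> = (\<lambda>x\<in>sp X. g (\<rho> x))"
  have \<xi>: "\<xi> \<in> pos_hom X unit_op"
    unfolding \<xi>_def
  proof (rule C_op1[OF X \<rho>(1)])
    show "g u \<in> {0..1}" for u by (simp add: g_def)
    show "continuous_on {0..1} g" unfolding g_def by (intro continuous_intros)
    show "g u \<le> g u'" if "u \<le> u'" for u u'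
    proof -
      have "2 / \<epsilon> * u \<le> 2 / \<epsilon> * u'" using that \<epsilon>(1) by (intro mult_left_mono) auto
      then show ?thesis unfolding g_def by linarith
    qed
  qed
  have "\<xi> x = 1" if "x \<in> C" for x
  proof -
    have "2 \<le> 2 / \<epsilon> * \<rho> x" using \<epsilon>(1) \<epsilon>(3)[OF that] by (simp add: field_simps)
    then have "g (\<rho> x) = 1" unfolding g_def by linarith
    then show ?thesis using that C unfolding \<xi>_def by auto
  qed
  then have "\<Phi> \<xi> \<in> E" unfolding E_def using \<xi> by blast
  have h: "\<epsilon> / 2 \<in> {0..1}" using \<epsilon> by simp
  have "T (\<xi> x) (\<epsilon> / 2) \<le> \<rho> x" if x: "x \<in> sp X" for x
  proof (cases "\<rho> x \<le> \<epsilon> / 2")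
    case True
    then have "2 / \<epsilon> * \<rho> x \<le> 1" using \<epsilon>(1) by (simp add: field_simps)
    then have "\<xi> x = 0" using x unfolding \<xi>_def g_def by simp
    then show ?thesis using T_0_left[OF h] C_mem[OF X \<rho>(1) x] by simp
  next
    case False
    then show ?thesis using T_le_right[OF C_mem[OF X \<xi> x] h] by simp
  qed
  then have "\<Phi> (\<lambda>x\<in>sp X. T (\<xi> x) (\<epsilon> / 2)) \<le> \<Phi> \<rho>"
    by (intro functional_mono C_copower[OF X \<xi> h] \<rho>) simp
  then have "T (\<Phi> \<xi>) (\<epsilon> / 2) \<le> 0" using functional_copower[OF \<xi> h] \<rho>(2) by simp
  moreover have "T e (\<epsilon> / 2) \<le> T (\<Phi> \<xi>) (\<epsilon> / 2)"
    by (intro T_mono e h functional_mem[OF \<xi>] e_le[OF \<open>\<Phi> \<xi> \<in> E\<close>] order_refl)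
  ultimately have Te: "T e (\<epsilon> / 2) \<le> 0" by simp
  have "e = 0"
  proof (rule ccontr)
    assume "e \<noteq> 0"
    then have pos: "0 < min e (\<epsilon> / 2)" using e0 \<epsilon>(1) by simp
    have mm: "min e (\<epsilon> / 2) \<in> {0..1}" using pos e1 by auto
    \<comment> \<open>\<open>T_idempotent\<close> applies only below \<open>e\<close>; the minimum
      moves the second factor there while keeping it positive.\<close>
    have "min e (\<epsilon> / 2) = T e (min e (\<epsilon> / 2))" using T_idempotent[OF e Tee] pos by simp
    also have "\<dots> \<le> T e (\<epsilon> / 2)" by (rule T_mono_right[OF e mm h]) simp
    finally show False using Te pos by simp
  qed
  then have "Inf E < t" using t by (simp add: e_def)
  then obtain s where "s \<in> E" "s < t" using cInf_less_iff[OF ne bdd] by blast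
  then show ?thesis unfolding E_def by blast
qed

lemma functional_eq_sup_on:
  assumes \<psi>: "\<psi> \<in> pos_hom X unit_op"
  shows "\<Phi> \<psi> = sup_on (zero_set X \<Phi>) \<psi>"
proof (rule antisym)
  let ?A = "zero_set X \<Phi>"
  have A: "?A \<in> closed_upper X" by (rule zero_set_closed_upper[OF X])
  note M = C_Pi[OF X \<psi> closed_upper_subset[OF A]]
  note F = functional_mem[OF \<psi>]
  have "\<psi> x \<le> \<Phi> \<psi>" if x: "x \<in> ?A" for x
  proof -
    have "\<Phi> (\<lambda>x\<in>sp X. max (\<psi> x - \<Phi> \<psi>) 0) = 0" using functional_tminus[OF \<psi> F] by simp
    then have "(\<lambda>x\<in>sp X. max (\<psi> x - \<Phi> \<psi>) 0) x = 0"
      using x C_tminus[OF X \<psi> F] unfolding zero_set_def by blast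
    then show ?thesis using x unfolding zero_set_def by (simp split: if_splits)
  qed
  then show "sup_on ?A \<psi> \<le> \<Phi> \<psi>" using sup_on_le_iff[OF M] F by simp
  show "\<Phi> \<psi> \<le> sup_on ?A \<psi>"
  proof (rule ccontr)
    assume "\<not> \<Phi> \<psi> \<le> sup_on ?A \<psi>"
    then have lt: "sup_on ?A \<psi> < \<Phi> \<psi>" by simp
    \<comment> \<open>The midpoint leaves room on both sides: \<open>C\<close> misses the zero set,
      and the gap \<open>\<Phi> \<psi> - u\<close> is the positive bound handed to
      \<open>functional_Inf_eq_0\<close>.\<close>
    define u where "u = (sup_on ?A \<psi> + \<Phi> \<psi>) / 2"
    have u: "sup_on ?A \<psi> < u" "u < \<Phi> \<psi>" "u \<in> {0..1}"
      using lt F sup_on_mem[OF M] unfolding u_def by auto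
    define C where "C = {x \<in> sp X. u \<le> \<psi> x}"
    have C: "closedin (tp X) C" unfolding C_def by (rule closedin_le_fun) (simp_all add: C_cont[OF X \<psi>])
    then have compC: "compactin (tp X) C" using PosComp_compact[OF X] by (intro closedin_compact_space)
    have "\<exists>\<rho>\<in>{\<rho> \<in> pos_hom X unit_op. \<Phi> \<rho> = 0}. C \<subseteq> {x \<in> sp X. 0 < \<rho> x}"
    proof (rule compactin_directed_cover[OF compC])
      \<comment> \<open>Subtracting 1 gives the zero function, a witness that the cover is indexed
        by a nonempty family.\<close>
      have "\<Phi> (\<lambda>x\<in>sp X. max (\<psi> x - 1) 0) = 0" using functional_tminus[OF \<psi>, of 1] F by simp
      then show "{\<rho> \<in> pos_hom X unit_op. \<Phi> \<rho> = 0} \<noteq> {}" using C_tminus[OF X \<psi>, of 1] by fastforce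
      show "openin (tp X) {x \<in> sp X. 0 < \<rho> x}" if "\<rho> \<in> {\<rho> \<in> pos_hom X unit_op. \<Phi> \<rho> = 0}" for \<rho>
        using that by (intro openin_less_fun) (simp_all add: C_cont[OF X])
      show "\<exists>\<rho>\<in>{\<rho> \<in> pos_hom X unit_op. \<Phi> \<rho> = 0}. x \<in> {x \<in> sp X. 0 < \<rho> x}" if x: "x \<in> C" for x
      proof -
        have "x \<notin> ?A" using sup_on_ge[OF M, of x] u(1) x unfolding C_def by auto
        then obtain \<rho> where \<rho>: "\<rho> \<in> pos_hom X unit_op" "\<Phi> \<rho> = 0" "\<rho> x \<noteq> 0"
          using x unfolding C_def zero_set_def by blast
        moreover have "0 < \<rho> x" using \<rho>(3) C_mem[OF X \<rho>(1), of x] x unfolding C_def by auto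
        ultimately show ?thesis using x unfolding C_def by blast
      qed
      show "\<exists>\<tau>\<in>{\<rho> \<in> pos_hom X unit_op. \<Phi> \<rho> = 0}. {x \<in> sp X. 0 < \<rho> x} \<union> {x \<in> sp X. 0 < \<sigma> x} \<subseteq> {x \<in> sp X. 0 < \<tau> x}"
        if "\<rho> \<in> {\<rho> \<in> pos_hom X unit_op. \<Phi> \<rho> = 0}" "\<sigma> \<in> {\<rho> \<in> pos_hom X unit_op. \<Phi> \<rho> = 0}" for \<rho> \<sigma>
        using that functional_max[of \<rho> \<sigma>] C_max[OF X, of \<rho> \<sigma>]
        by (intro bexI[of _ "\<lambda>x\<in>sp X. max (\<rho> x) (\<sigma> x)"]) auto
    qed
    then obtain \<rho> where \<rho>: "\<rho> \<in> pos_hom X unit_op" "\<Phi> \<rho> = 0" "C \<subseteq> {x \<in> sp X. 0 < \<rho> x}" by blast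
    \<comment> \<open>A positive continuous function is bounded away from 0 on a compact set; the
      form with a directed cover includes an empty \<open>C\<close>.\<close>
    have "\<exists>\<epsilon>\<in>{0<..1::real}. C \<subseteq> {x \<in> sp X. \<epsilon> < \<rho> x}"
    proof (rule compactin_directed_cover[OF compC])
      show "openin (tp X) {x \<in> sp X. \<epsilon> < \<rho> x}" for \<epsilon>
        by (intro openin_less_fun) (simp_all add: C_cont[OF X \<rho>(1)])
      show "\<exists>\<epsilon>\<in>{0<..1}. x \<in> {x \<in> sp X. \<epsilon> < \<rho> x}" if "x \<in> C" for x
      proof (rule bexI[of _ "\<rho> x / 2"])
        have "x \<in> sp X" "0 < \<rho> x" using that \<rho>(3) by auto
        then show "\<rho> x / 2 \<in> {0<..1}" "x \<in> {y \<in> sp X. \<rho> x / 2 < \<rho> y}" using C_mem[OF X \<rho>(1), of x] by auto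
      qed
      show "\<exists>\<eta>\<in>{0<..1}. {x \<in> sp X. \<epsilon> < \<rho> x} \<union> {x \<in> sp X. \<delta> < \<rho> x} \<subseteq> {x \<in> sp X. \<eta> < \<rho> x}"
        if "\<epsilon> \<in> {0<..1}" "\<delta> \<in> {0<..1}" for \<epsilon> \<delta>
        using that by (intro bexI[of _ "min \<epsilon> \<delta>"]) auto
    qed simp
    then obtain \<epsilon> where \<epsilon>: "0 < \<epsilon>" "\<epsilon> \<le> 1" "\<And>x. x \<in> C \<Longrightarrow> \<epsilon> \<le> \<rho> x" by force
    have "C \<subseteq> sp X" unfolding C_def by blast
    from functional_Inf_eq_0[OF \<rho>(1,2) this \<epsilon>, of "\<Phi> \<psi> - u"]
    obtain \<xi> where \<xi>: "\<xi> \<in> pos_hom X unit_op" "\<forall>x\<in>C. \<xi> x = 1" "\<Phi> \<xi> < \<Phi> \<psi> - u" using u(2) by auto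
    \<comment> \<open>On \<open>C\<close> the right side is 1, and off \<open>C\<close> the left
      side is 0. Applying \<open>\<Phi>\<close> gives
      \<open>\<Phi> \<psi> - u \<le> \<Phi> \<xi>\<close>, against the choice of
      \<open>\<xi>\<close>.\<close>
    have "(\<lambda>x\<in>sp X. max (\<psi> x - u) 0) x \<le> \<xi> x" if x: "x \<in> sp X" for x
    proof (cases "x \<in> C")
      case True
      then show ?thesis using x \<xi>(2) C_mem[OF X \<psi> x] u(3) by simp
    next
      case False
      then show ?thesis using x C_mem[OF X \<xi>(1) x] unfolding C_def by simp
    qed
    then have "\<Phi> (\<lambda>x\<in>sp X. max (\<psi> x - u) 0) \<le> \<Phi> \<xi>"
      by (rule functional_mono[OF C_tminus[OF X \<psi> u(3)] \<xi>(1)])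
    then show False using functional_tminus[OF \<psi> u(3)] \<xi>(3) by simp
  qed
qed

end

end

text \<open>A point of \<open>B\<close> outside \<open>A\<close> is detected by a function that
  vanishes on \<open>A\<close> and is 1 at that point. In particular a closed upper set is
  determined by its supremum functional.\<close>

lemma sup_on_reflects_subset:
  assumes X: "X \<in> PosComp" and A: "A \<in> closed_upper X" and B: "B \<subseteq> sp X"
    and le: "\<And>\<psi>. \<psi> \<in> pos_hom X unit_op \<Longrightarrow> sup_on B \<psi> \<le> sup_on A \<psi>"
  shows "B \<subseteq> A"
proof (rule ccontr)
  assume "\<not> B \<subseteq> A"
  then obtain x where x: "x \<in> B" "x \<notin> A" by blast
  then have "x \<in> sp X" using B by blast
  then obtain \<psi> where \<psi>: "\<psi> \<in> pos_hom X unit_op" "\<And>y. y \<in> A \<Longrightarrow> \<psi> y = 0" "\<psi> x = 1"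
    using separating_function[OF X A _ x(2)] by metis
  have "sup_on A \<psi> \<le> 0" using sup_on_le_iff[OF C_Pi[OF X \<psi>(1) closed_upper_subset[OF A]]] \<psi>(2) by simp
  moreover have "1 \<le> sup_on B \<psi>" using sup_on_ge[OF C_Pi[OF X \<psi>(1) B] x(1)] \<psi>(3) by simp
  ultimately show False using le[OF \<psi>(1)] by simp
qed

section \<open>The isomorphism between \<open>V X\<close> and \<open>G (C X)\<close>\<close>

context tnorm begin

text \<open>By \<open>functional_eq_sup_on\<close> both closed upper sets have the same supremum
  functional, so \<open>sup_on_reflects_subset\<close> applies in both directions.\<close>

lemma zero_set_sup_on:
  assumes X: "X \<in> PosComp" and A: "A \<in> closed_upper X"
  shows "zero_set X (\<lambda>\<psi>\<in>pos_hom X unit_op. sup_on A \<psi>) = A"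
proof -
  let ?\<Phi> = "\<lambda>\<psi>\<in>pos_hom X unit_op. sup_on A \<psi>"
  note cu = zero_set_closed_upper[OF X, of ?\<Phi>]
  have eq: "sup_on A \<psi> = sup_on (zero_set X ?\<Phi>) \<psi>" if "\<psi> \<in> pos_hom X unit_op" for \<psi>
    using functional_eq_sup_on[OF X sup_on_lax_hom[OF X closed_upper_subset[OF A]] that] that by simp
  show ?thesis
    by (intro equalityI sup_on_reflects_subset[OF X A closed_upper_subset[OF cu]]
        sup_on_reflects_subset[OF X cu closed_upper_subset[OF A]]) (simp_all add: eq)
qed

text \<open>This map will be the inverse of \<open>j_map\<close>. For a hit set, a function
  vanishing off \<open>U\<close> with value 1 at a point of the zero set gives the open condition
  \<open>0 < \<Phi>' \<psi>\<close>. For a miss set, a function vanishing on the zero set with value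
  1 on \<open>K\<close> gives \<open>\<Phi>' \<psi> < 1\<close>.\<close>

lemma zero_set_pos_hom:
  assumes X: "X \<in> PosComp"
  shows "(\<lambda>\<Phi>\<in>sp (G_obj T (C_obj T X)). zero_set X \<Phi>) \<in> pos_hom (G_obj T (C_obj T X)) (V_obj X)"
proof -
  let ?G = "G_obj T (C_obj T X)" let ?L = "lax_hom T (C_obj T X) (unit_mon T)"
  note rep = functional_eq_sup_on[OF X] and cu = zero_set_closed_upper[OF X]
  have ev: "continuous_map (tp ?G) euclideanreal (\<lambda>\<Phi>. \<Phi> \<psi>)" if "\<psi> \<in> pos_hom X unit_op" for \<psi>
    by (rule continuous_map_G_eval) (simp add: that)
  have "continuous_map (tp ?G) (tp (V_obj X)) (zero_set X)"
    unfolding continuous_map_into_V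
  proof (intro conjI allI impI; (elim conjE)?)
    show "zero_set X \<in> sp ?G \<rightarrow> closed_upper X" using cu by blast
    show "openin (tp ?G) {\<Phi> \<in> sp ?G. zero_set X \<Phi> \<inter> U \<noteq> {}}" if U: "openin (tp X) U" "lower_in X U" for U
    proof (subst openin_subopen, intro ballI)
      fix \<Phi> assume "\<Phi> \<in> {\<Phi> \<in> sp ?G. zero_set X \<Phi> \<inter> U \<noteq> {}}"
      then obtain x where \<Phi>: "\<Phi> \<in> ?L" and x: "x \<in> zero_set X \<Phi>" "x \<in> U" by auto
      have "sp X - U \<in> closed_upper X" unfolding closed_upper_def using U upper_in_Compl[OF X U(2)] by blast
      moreover have "x \<in> sp X" "x \<notin> sp X - U" using x closed_upper_subset[OF cu] by auto
      ultimately obtain \<psi> where \<psi>: "\<psi> \<in> pos_hom X unit_op" "\<And>y. y \<in> sp X - U \<Longrightarrow> \<psi> y = 0" "\<psi> x = 1"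
        using separating_function[OF X] by metis
      have "openin (tp ?G) {\<Phi>' \<in> sp ?G. 0 < \<Phi>' \<psi>}" by (rule openin_less_fun) (simp_all add: ev \<psi>(1))
      moreover have "0 < \<Phi> \<psi>"
        using rep[OF \<Phi> \<psi>(1)] sup_on_ge[OF C_Pi[OF X \<psi>(1) closed_upper_subset[OF cu]] x(1)] \<psi>(3) by simp
      moreover have "zero_set X \<Phi>' \<inter> U \<noteq> {}" if "\<Phi>' \<in> ?L" "0 < \<Phi>' \<psi>" for \<Phi>'
      proof -
        have "0 < sup_on (zero_set X \<Phi>') \<psi>" using rep[OF that(1) \<psi>(1)] that(2) by simp
        then obtain y where "y \<in> zero_set X \<Phi>'" "0 < \<psi> y"
          using less_sup_on_iff[OF C_Pi[OF X \<psi>(1) closed_upper_subset[OF cu]]] by auto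
        then show ?thesis using \<psi>(2)[of y] closed_upper_subset[OF cu, of \<Phi>'] by auto
      qed
      ultimately show "\<exists>W. openin (tp ?G) W \<and> \<Phi> \<in> W \<and> W \<subseteq> {\<Phi> \<in> sp ?G. zero_set X \<Phi> \<inter> U \<noteq> {}}"
        using \<Phi> by (intro exI[of _ "{\<Phi>' \<in> sp ?G. 0 < \<Phi>' \<psi>}"]) auto
    qed
    show "openin (tp ?G) {\<Phi> \<in> sp ?G. zero_set X \<Phi> \<inter> K = {}}" if K: "closedin (tp X) K" "lower_in X K" for K
    proof (subst openin_subopen, intro ballI)
      fix \<Phi> assume "\<Phi> \<in> {\<Phi> \<in> sp ?G. zero_set X \<Phi> \<inter> K = {}}"
      then have \<Phi>: "\<Phi> \<in> ?L" and disj: "zero_set X \<Phi> \<inter> K = {}" by auto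
      have cl: "closedin (tp X) (zero_set X \<Phi>)" "upper_in X (zero_set X \<Phi>)" using cu[of \<Phi>] unfolding closed_upper_def by auto
      obtain \<psi> where \<psi>: "\<psi> \<in> pos_hom X unit_op" "\<And>y. y \<in> zero_set X \<Phi> \<Longrightarrow> \<psi> y = 0" "\<And>y. y \<in> K \<Longrightarrow> \<psi> y = 1"
        using ordered_Urysohn[OF X cl K disj] by metis
      have "openin (tp ?G) {\<Phi>' \<in> sp ?G. \<Phi>' \<psi> < 1}" by (rule openin_less_fun) (simp_all add: ev \<psi>(1))
      moreover have "\<Phi> \<psi> < 1"
        using rep[OF \<Phi> \<psi>(1)] sup_on_le_iff[OF C_Pi[OF X \<psi>(1) closed_upper_subset[OF cu]], of 0 \<Phi>] \<psi>(2) by simp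
      moreover have "zero_set X \<Phi>' \<inter> K = {}" if "\<Phi>' \<in> ?L" "\<Phi>' \<psi> < 1" for \<Phi>'
      proof -
        have "sup_on (zero_set X \<Phi>') \<psi> < 1" using rep[OF that(1) \<psi>(1)] that(2) by simp
        then have "\<psi> y < 1" if "y \<in> zero_set X \<Phi>'" for y
          using sup_on_ge[OF C_Pi[OF X \<psi>(1) closed_upper_subset[OF cu]] that] by simp
        then show ?thesis using \<psi>(3) by fastforce
      qed
      ultimately show "\<exists>W. openin (tp ?G) W \<and> \<Phi> \<in> W \<and> W \<subseteq> {\<Phi> \<in> sp ?G. zero_set X \<Phi> \<inter> K = {}}"
        using \<Phi> by (intro exI[of _ "{\<Phi>' \<in> sp ?G. \<Phi>' \<psi> < 1}"]) auto
    qed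
  qed
  then have cont: "continuous_map (tp ?G) (tp (V_obj X)) (\<lambda>\<Phi>\<in>sp ?G. zero_set X \<Phi>)"
    by (rule continuous_map_eq) simp
  have "zero_set X \<Phi>' \<subseteq> zero_set X \<Phi>" if "(\<Phi>, \<Phi>') \<in> ple ?G" for \<Phi> \<Phi>'
  proof (rule sup_on_reflects_subset[OF X cu closed_upper_subset[OF cu]])
    fix \<psi> assume \<psi>: "\<psi> \<in> pos_hom X unit_op"
    have "\<Phi> \<in> ?L" "\<Phi>' \<in> ?L" "\<Phi>' \<psi> \<le> \<Phi> \<psi>" using that \<psi> by (auto simp: ple_G)
    then show "sup_on (zero_set X \<Phi>') \<psi> \<le> sup_on (zero_set X \<Phi>) \<psi>" using rep \<psi> by metis
  qed
  note mono = this
  have "((\<lambda>\<Phi>\<in>sp ?G. zero_set X \<Phi>) \<Phi>, (\<lambda>\<Phi>\<in>sp ?G. zero_set X \<Phi>) \<Phi>') \<in> ple (V_obj X)"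
    if le: "(\<Phi>, \<Phi>') \<in> ple ?G" for \<Phi> \<Phi>'
  proof -
    have "\<Phi> \<in> ?L" "\<Phi>' \<in> ?L" using le by (simp_all add: ple_G)
    then show ?thesis using mono[OF le] cu by (simp add: ple_V)
  qed
  moreover have "(\<lambda>\<Phi>\<in>sp ?G. zero_set X \<Phi>) \<in> sp ?G \<rightarrow>\<^sub>E sp (V_obj X)" using cu by (simp add: PiE_iff)
  ultimately show ?thesis unfolding pos_hom_def using cont by blast
qed

text \<open>\<open>V X\<close> is compact as the image of \<open>G (C X)\<close> under
  \<open>zero_set\<close>, which is onto by \<open>zero_set_sup_on\<close>. The order is closed
  because inclusion amounts to inequalities between the functions
  \<open>A \<mapsto> sup_on A \<psi>\<close>, whose continuity is \<open>C_dist_mem\<close> for the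
  counit.\<close>

lemma V_obj_PosComp:
  assumes X: "X \<in> PosComp" shows "V_obj X \<in> PosComp"
proof -
  let ?G = "G_obj T (C_obj T X)" let ?V = "tp (V_obj X)"
  define k where "k = (\<lambda>\<Phi>\<in>sp ?G. zero_set X \<Phi>)"
  have k: "k \<in> pos_hom ?G (V_obj X)" unfolding k_def by (rule zero_set_pos_hom[OF X])
  have "k ` sp ?G = closed_upper X"
  proof
    show "k ` sp ?G \<subseteq> closed_upper X" using zero_set_closed_upper[OF X] by (auto simp: k_def)
    show "closed_upper X \<subseteq> k ` sp ?G"
    proof
      fix A assume A: "A \<in> closed_upper X"
      let ?\<Phi> = "\<lambda>\<psi>\<in>pos_hom X unit_op. sup_on A \<psi>"
      have "?\<Phi> \<in> sp ?G" using sup_on_lax_hom[OF X closed_upper_subset[OF A]] by simp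
      then show "A \<in> k ` sp ?G" using zero_set_sup_on[OF X A] by (intro image_eqI[of _ _ ?\<Phi>]) (simp_all add: k_def)
    qed
  qed
  moreover have "compactin (tp ?G) (sp ?G)"
    using PosComp_compact[OF G_obj_PosComp[OF C_obj_MonObj[OF X]]] by (simp add: compact_space_def)
  moreover have "continuous_map (tp ?G) ?V k" using k unfolding pos_hom_def by blast
  ultimately have "compactin ?V (closed_upper X)" using image_compactin by metis
  then have comp: "compact_space ?V" by (simp add: compact_space_def)
  define s where "s \<psi> A = C_dist (V_obj X) X (V_counit X) \<psi> A" for \<psi> A
  have cont: "continuous_map ?V euclideanreal (s \<psi>)" if \<psi>: "\<psi> \<in> pos_hom X unit_op" for \<psi>
    using C_dist_mem[OF ple_V_subset X V_counit_dist_hom \<psi>] unfolding s_def pos_hom_unit_iff_relation[OF ple_V_subset] by simp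
  have s: "s \<psi> A = sup_on A \<psi>" if "\<psi> \<in> pos_hom X unit_op" "A \<in> closed_upper X" for \<psi> A
  proof -
    have "V_counit X `` {A} = A" using that(2) by (auto simp: V_counit_def)
    then show ?thesis using C_dist_apply[OF that(1), of A "V_obj X"] that(2) by (simp add: s_def)
  qed
  have sub: "B \<subseteq> A \<longleftrightarrow> (\<forall>\<psi>\<in>pos_hom X unit_op. s \<psi> B \<le> s \<psi> A)" if A: "A \<in> closed_upper X" and B: "B \<in> closed_upper X" for A B
  proof
    assume "\<forall>\<psi>\<in>pos_hom X unit_op. s \<psi> B \<le> s \<psi> A"
    then show "B \<subseteq> A" by (intro sup_on_reflects_subset[OF X A closed_upper_subset[OF B]]) (simp add: s A B)
  next
    assume BA: "B \<subseteq> A"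
    show "\<forall>\<psi>\<in>pos_hom X unit_op. s \<psi> B \<le> s \<psi> A"
    proof
      fix \<psi> assume \<psi>: "\<psi> \<in> pos_hom X unit_op"
      note M = C_Pi[OF X \<psi> closed_upper_subset]
      have "sup_on B \<psi> \<le> sup_on A \<psi>"
        using sup_on_le_iff[OF M[OF B] sup_on_nonneg[OF M[OF A]]] sup_on_ge[OF M[OF A]] BA by blast
      then show "s \<psi> B \<le> s \<psi> A" by (simp add: s \<psi> A B)
    qed
  qed
  have "ple (V_obj X) = {p \<in> topspace (prod_topology ?V ?V). \<forall>\<psi>\<in>pos_hom X unit_op. s \<psi> (snd p) \<le> s \<psi> (fst p)}"
    using sub by (auto simp: ple_V)
  moreover have "closedin (prod_topology ?V ?V) \<dots>"
    by (intro closedin_Collect_ball closedin_le_fun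
        continuous_map_compose[OF continuous_map_snd cont, unfolded comp_def]
        continuous_map_compose[OF continuous_map_fst cont, unfolded comp_def])
  moreover have "partial_order_on (sp (V_obj X)) (ple (V_obj X))"
    unfolding partial_order_on_def preorder_on_def refl_on_def trans_def antisym_def by (auto simp: ple_V)
  ultimately show ?thesis unfolding PosComp_def using comp by simp
qed

section \<open>The monad morphism\<close>

lemma j_map_apply:
  assumes X: "X \<in> PosComp" and A: "A \<in> closed_upper X"
  shows "j_map T X A = (\<lambda>\<psi>\<in>pos_hom X unit_op. sup_on A \<psi>)"
proof -
  note V = V_obj_PosComp[OF X]
  have cA: "V_counit X `` {A} = A" using A by (auto simp: V_counit_def)
  have A': "A \<in> sp (V_obj X)" using A by simp
  have "j_map T X A = compose (pos_hom X unit_op) (ev_space T (V_obj X) A) (C_dist (V_obj X) X (V_counit X))"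
    unfolding j_map_def compose_eq[OF A'] G_map_def using pos_hom_mem[OF ev_space_pos_hom[OF V] A'] by simp
  also have "\<dots> = (\<lambda>\<psi>\<in>pos_hom X unit_op. sup_on A \<psi>)"
    unfolding compose_def
  proof (rule restrict_ext)
    fix \<psi> assume \<psi>: "\<psi> \<in> pos_hom X unit_op"
    show "ev_space T (V_obj X) A (C_dist (V_obj X) X (V_counit X) \<psi>) = sup_on A \<psi>"
      unfolding ev_space_apply[OF A'] using C_dist_mem[OF ple_V_subset X V_counit_dist_hom \<psi>]
      by (simp add: C_dist_apply[OF \<psi> A'] cA)
  qed
  finally show ?thesis .
qed

lemma j_map_eq:
  assumes X: "X \<in> PosComp"
  shows "j_map T X = (\<lambda>A\<in>closed_upper X. \<lambda>\<psi>\<in>pts (C_obj T X). sup01 {\<psi> x | x. x \<in> A})"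
proof (rule extensionalityI[of _ "closed_upper X"])
  show "j_map T X \<in> extensional (closed_upper X)" using compose_extensional by (simp add: j_map_def)
  show "j_map T X A = (\<lambda>A\<in>closed_upper X. \<lambda>\<psi>\<in>pts (C_obj T X). sup01 {\<psi> x | x. x \<in> A}) A" if "A \<in> closed_upper X" for A
    unfolding j_map_apply[OF X that] restrict_apply'[OF that] sup_on_def pts_C by (rule refl)
qed simp

lemma j_map_pos_hom:
  assumes X: "X \<in> PosComp" shows "j_map T X \<in> pos_hom (V_obj X) (GC_obj T X)"
proof -
  note V = V_obj_PosComp[OF X]
  show ?thesis
    unfolding j_map_def GC_obj_def
    by (rule pos_hom_compose[OF ev_space_pos_hom[OF V] G_map_pos_hom[OF C_obj_MonObj[OF X] C_obj_MonObj[OF V]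
        C_dist_lax_hom[OF V X V_counit_dist_hom]] ple_V_subset])
qed

lemma j_map_iso:
  assumes X: "X \<in> PosComp" shows "is_pos_iso (V_obj X) (GC_obj T X) (j_map T X)"
  unfolding is_pos_iso_def
proof (intro conjI bexI)
  let ?k = "\<lambda>\<Phi>\<in>sp (G_obj T (C_obj T X)). zero_set X \<Phi>"
  show "j_map T X \<in> pos_hom (V_obj X) (GC_obj T X)" by (rule j_map_pos_hom[OF X])
  show "?k \<in> pos_hom (GC_obj T X) (V_obj X)" unfolding GC_obj_def by (rule zero_set_pos_hom[OF X])
  show "compose (sp (V_obj X)) ?k (j_map T X) = (\<lambda>x\<in>sp (V_obj X). x)"
    unfolding compose_def
  proof (rule restrict_ext)
    fix A assume "A \<in> sp (V_obj X)"
    then have A: "A \<in> closed_upper X" by simp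
    show "?k (j_map T X A) = A"
      unfolding j_map_apply[OF X A] using sup_on_lax_hom[OF X closed_upper_subset[OF A]] by (simp add: zero_set_sup_on[OF X A])
  qed
  show "compose (sp (GC_obj T X)) (j_map T X) ?k = (\<lambda>y\<in>sp (GC_obj T X). y)"
    unfolding compose_def GC_obj_def
  proof (rule restrict_ext)
    fix \<Phi> assume "\<Phi> \<in> sp (G_obj T (C_obj T X))"
    then have \<Phi>: "\<Phi> \<in> lax_hom T (C_obj T X) (unit_mon T)" by simp
    have "(\<lambda>\<psi>\<in>pos_hom X unit_op. sup_on (zero_set X \<Phi>) \<psi>) = \<Phi>"
      using lax_hom_ext[OF \<Phi>] functional_eq_sup_on[OF X \<Phi>]
      by (intro extensionalityI[of _ "pos_hom X unit_op"]) simp_all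
    then show "j_map T X (?k \<Phi>) = \<Phi>"
      using \<Phi> j_map_apply[OF X zero_set_closed_upper[OF X, of \<Phi>]] by simp
  qed
qed

section \<open>Compatibility of \<open>j_map\<close> with the monad structures\<close>

lemma V_map_closed_upper:
  assumes X: "X \<in> PosComp" and Y: "Y \<in> PosComp" and f: "f \<in> pos_hom X Y" and A: "A \<in> closed_upper X"
  shows "V_map X Y f A \<in> closed_upper Y"
proof -
  let ?F = "{B \<in> closed_upper Y. f ` A \<subseteq> B}"
  have "sp Y \<in> closed_upper Y" unfolding closed_upper_def upper_in_def using ple_points[OF Y] by auto
  then have top: "sp Y \<in> ?F" using pos_hom_mem[OF f] closed_upper_subset[OF A] by blast
  have "closedin (tp Y) (\<Inter>?F)" using top closed_upper_closed by (intro closedin_Inter) blast+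
  moreover have "upper_in Y (\<Inter>?F)"
    unfolding upper_in_def
  proof (intro conjI ballI)
    show "\<Inter>?F \<subseteq> sp Y" using top by blast
    fix p assume p: "p \<in> ple Y"
    show "case p of (x, y) \<Rightarrow> x \<in> \<Inter>?F \<longrightarrow> y \<in> \<Inter>?F"
    proof (cases p)
      case (Pair x y)
      then show ?thesis using p closed_upper_upper[of _ Y x y] by auto
    qed
  qed
  ultimately show ?thesis using A unfolding V_map_def closed_upper_def by simp
qed

text \<open>The set where \<open>\<psi>\<close> is at most \<open>w\<close> is closed and upper, so
  it contains the image of \<open>A\<close> exactly when it contains the closed upper set generated
  by that image. The two suprema therefore have the same upper bounds.\<close>

lemma sup_on_V_map:
  assumes X: "X \<in> PosComp" and Y: "Y \<in> PosComp" and f: "f \<in> pos_hom X Y" and A: "A \<in> closed_upper X"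
    and \<psi>: "\<psi> \<in> pos_hom Y unit_op"
  shows "sup_on (V_map X Y f A) \<psi> = sup_on A (compose (sp X) \<psi> f)"
proof -
  let ?B = "V_map X Y f A"
  have B: "?B = \<Inter>{B \<in> closed_upper Y. f ` A \<subseteq> B}" using A by (simp add: V_map_def)
  note cB = V_map_closed_upper[OF X Y f A]
  note c = pos_hom_compose[OF f \<psi> ple_subset[OF X]]
  note M1 = C_Pi[OF Y \<psi> closed_upper_subset[OF cB]] and M2 = C_Pi[OF X c closed_upper_subset[OF A]]
  have le: "sup_on ?B \<psi> \<le> w \<longleftrightarrow> sup_on A (compose (sp X) \<psi> f) \<le> w" if w: "0 \<le> w" for w
  proof -
    have "(\<forall>y\<in>?B. \<psi> y \<le> w) \<longleftrightarrow> (\<forall>x\<in>A. \<psi> (f x) \<le> w)"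
    proof
      show "\<forall>x\<in>A. \<psi> (f x) \<le> w" if "\<forall>y\<in>?B. \<psi> y \<le> w" using that unfolding B by blast
      assume *: "\<forall>x\<in>A. \<psi> (f x) \<le> w"
      have "closedin (tp Y) {y \<in> sp Y. \<psi> y \<le> w}" by (rule closedin_le_fun) (simp_all add: C_cont[OF Y \<psi>])
      moreover have "upper_in Y {y \<in> sp Y. \<psi> y \<le> w}"
        unfolding upper_in_def using C_antimono[OF Y \<psi>] ple_points[OF Y] by fastforce
      ultimately have "{y \<in> sp Y. \<psi> y \<le> w} \<in> closed_upper Y" unfolding closed_upper_def by blast
      moreover have "f ` A \<subseteq> {y \<in> sp Y. \<psi> y \<le> w}" using * pos_hom_mem[OF f] closed_upper_subset[OF A] by blast
      ultimately show "\<forall>y\<in>?B. \<psi> y \<le> w" unfolding B by blast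
    qed
    moreover have "compose (sp X) \<psi> f x = \<psi> (f x)" if "x \<in> A" for x
      using that closed_upper_subset[OF A] by (auto simp: compose_eq)
    ultimately show ?thesis using sup_on_le_iff[OF M1 w] sup_on_le_iff[OF M2 w] by simp
  qed
  show ?thesis using le[OF sup_on_nonneg[OF M1]] le[OF sup_on_nonneg[OF M2]] by simp
qed

lemma j_map_natural:
  assumes X: "X \<in> PosComp" and Y: "Y \<in> PosComp" and f: "f \<in> pos_hom X Y"
  shows "compose (sp (V_obj X)) (j_map T Y) (V_map X Y f) = compose (sp (V_obj X)) (GC_map T X Y f) (j_map T X)"
  unfolding compose_def[of "sp (V_obj X)"]
proof (rule restrict_ext)
  fix A assume A': "A \<in> sp (V_obj X)"
  then have A: "A \<in> closed_upper X" by simp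
  have "j_map T X A \<in> lax_hom T (C_obj T X) (unit_mon T)"
    using pos_hom_mem[OF j_map_pos_hom[OF X] A'] by (simp add: GC_obj_def)
  then have "GC_map T X Y f (j_map T X A) = compose (pos_hom Y unit_op) (j_map T X A) (C_map X Y f)"
    by (simp add: GC_map_def G_map_def)
  also have "\<dots> = (\<lambda>\<psi>\<in>pos_hom Y unit_op. sup_on (V_map X Y f A) \<psi>)"
    unfolding compose_def
  proof (rule restrict_ext)
    fix \<psi> assume \<psi>: "\<psi> \<in> pos_hom Y unit_op"
    show "j_map T X A (C_map X Y f \<psi>) = sup_on (V_map X Y f A) \<psi>"
      unfolding j_map_apply[OF X A] sup_on_V_map[OF X Y f A \<psi>]
      using C_map_mem[OF X f \<psi>] \<psi> by (simp add: C_map_def)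
  qed
  also have "\<dots> = j_map T Y (V_map X Y f A)"
    by (rule j_map_apply[OF Y V_map_closed_upper[OF X Y f A], symmetric])
  finally show "j_map T Y (V_map X Y f A) = GC_map T X Y f (j_map T X A)" by simp
qed

lemma j_map_unit:
  assumes X: "X \<in> PosComp"
  shows "compose (sp X) (j_map T X) (V_unit X) = ev_space T X"
proof (rule extensionalityI[of _ "sp X"])
  fix x assume x: "x \<in> sp X"
  have "V_unit X x = ple X `` {x}" using x by (auto simp: V_unit_def)
  moreover have "ple X `` {x} \<in> closed_upper X" using up_closed_upper[OF X x] by (simp add: Image_singleton)
  ultimately have "compose (sp X) (j_map T X) (V_unit X) x = (\<lambda>\<psi>\<in>pos_hom X unit_op. sup_on (ple X `` {x}) \<psi>)"
    using j_map_apply[OF X] x by (simp add: compose_eq)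
  also have "\<dots> = (\<lambda>\<psi>\<in>pos_hom X unit_op. \<psi> x)" by (rule restrict_ext) (rule sup_on_up[OF X x])
  finally show "compose (sp X) (j_map T X) (V_unit X) x = ev_space T X x" by (simp add: ev_space_apply[OF x])
qed (simp_all add: ev_space_def compose_extensional)

text \<open>The union is the section at \<open>\<A>\<close> of the composite of two counits, so the
  claim is an instance of the composition of distributors.\<close>

lemma Union_closed_upper:
  assumes X: "X \<in> PosComp" and AA: "\<A> \<in> closed_upper (V_obj X)"
  shows "\<Union>\<A> \<in> closed_upper X"
proof -
  note V = V_obj_PosComp[OF X]
  have "(V_counit (V_obj X) O V_counit X) `` {\<A>} \<in> closed_upper X"
    using AA by (intro dist_hom_closed_upper[OF ple_V_subset dist_hom_comp[OF V_obj_PosComp[OF V] V X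
      V_counit_dist_hom V_counit_dist_hom]]) simp
  moreover have "(V_counit (V_obj X) O V_counit X) `` {\<A>} = \<Union>\<A>"
    using AA closed_upper_subset[OF AA] unfolding sp_V by (auto simp: V_counit_def)
  ultimately show ?thesis by simp
qed

lemma j_map_mult:
  assumes X: "X \<in> PosComp"
  shows "compose (sp (V_obj (V_obj X))) (j_map T X) (V_mult X)
    = compose (sp (V_obj (V_obj X))) (GC_mult T X)
        (compose (sp (V_obj (V_obj X))) (j_map T (GC_obj T X)) (V_map (V_obj X) (GC_obj T X) (j_map T X)))"
  unfolding compose_def[of "sp (V_obj (V_obj X))"]
proof (rule restrict_ext)
  fix \<A> assume A': "\<A> \<in> sp (V_obj (V_obj X))"
  then have A: "\<A> \<in> closed_upper (V_obj X)" by simp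
  note V = V_obj_PosComp[OF X] and C = C_obj_MonObj[OF X]
  have G: "GC_obj T X \<in> PosComp" unfolding GC_obj_def by (rule G_obj_PosComp[OF C])
  note j = j_map_pos_hom[OF X]
  let ?B = "V_map (V_obj X) (GC_obj T X) (j_map T X) \<A>"
  have B: "?B \<in> closed_upper (GC_obj T X)" by (rule V_map_closed_upper[OF V G j A])
  note U = Union_closed_upper[OF X A]
  have "j_map T (GC_obj T X) ?B \<in> lax_hom T (C_obj T (GC_obj T X)) (unit_mon T)"
    using pos_hom_mem[OF j_map_pos_hom[OF G], of ?B] B by (simp add: GC_obj_def)
  then have "GC_mult T X (j_map T (GC_obj T X) ?B)
      = compose (pos_hom X unit_op) (j_map T (GC_obj T X) ?B) (ev_mon T (C_obj T X))"
    by (simp add: GC_mult_def G_map_def)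
  also have "\<dots> = (\<lambda>\<psi>\<in>pos_hom X unit_op. sup_on (\<Union>\<A>) \<psi>)"
    unfolding compose_def
  proof (rule restrict_ext)
    fix \<psi> assume \<psi>: "\<psi> \<in> pos_hom X unit_op"
    then have \<psi>': "\<psi> \<in> pts (C_obj T X)" by simp
    have ev: "ev_mon T (C_obj T X) \<psi> \<in> pos_hom (GC_obj T X) unit_op"
      unfolding GC_obj_def by (rule ev_mon_mem[OF C \<psi>'])
    let ?c = "compose (sp (V_obj X)) (ev_mon T (C_obj T X) \<psi>) (j_map T X)"
    note c = pos_hom_compose[OF j ev ple_V_subset]
    \<comment> \<open>Pulled back along \<open>j_map\<close>, evaluation at \<open>\<psi>\<close>
      becomes \<open>K \<mapsto> sup_on K \<psi>\<close>. The multiplication law thus says that an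
      iterated supremum equals the supremum over the union.\<close>
    have ca: "?c K = sup_on K \<psi>" if "K \<in> closed_upper X" for K
      using that sup_on_lax_hom[OF X closed_upper_subset[OF that]] \<psi>
      by (simp add: compose_eq ev_mon_apply[OF \<psi>'] j_map_apply[OF X that])
    note M1 = C_Pi[OF V c closed_upper_subset[OF A]] and M2 = C_Pi[OF X \<psi> closed_upper_subset[OF U]]
    have KX: "K \<in> closed_upper X" if "K \<in> \<A>" for K using that closed_upper_subset[OF A] by auto
    have le: "sup_on \<A> ?c \<le> w \<longleftrightarrow> sup_on (\<Union>\<A>) \<psi> \<le> w" if w: "0 \<le> w" for w
    proof -
      have "?c K \<le> w \<longleftrightarrow> (\<forall>x\<in>K. \<psi> x \<le> w)" if "K \<in> \<A>" for K
        unfolding ca[OF KX[OF that]] by (rule sup_on_le_iff[OF C_Pi[OF X \<psi> closed_upper_subset[OF KX[OF that]]] w])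
      then show ?thesis unfolding sup_on_le_iff[OF M1 w] sup_on_le_iff[OF M2 w] by blast
    qed
    have "j_map T (GC_obj T X) ?B (ev_mon T (C_obj T X) \<psi>) = sup_on ?B (ev_mon T (C_obj T X) \<psi>)"
      unfolding j_map_apply[OF G B] using ev by simp
    also have "\<dots> = sup_on \<A> ?c" by (rule sup_on_V_map[OF V G j A ev])
    also have "\<dots> = sup_on (\<Union>\<A>) \<psi>" using le[OF sup_on_nonneg[OF M1]] le[OF sup_on_nonneg[OF M2]] by simp
    finally show "j_map T (GC_obj T X) ?B (ev_mon T (C_obj T X) \<psi>) = sup_on (\<Union>\<A>) \<psi>" .
  qed
  also have "\<dots> = j_map T X (V_mult X \<A>)" using j_map_apply[OF X U] A by (simp add: V_mult_def)
  finally show "j_map T X (V_mult X \<A>)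
      = GC_mult T X ((\<lambda>x\<in>sp (V_obj (V_obj X)). j_map T (GC_obj T X) (V_map (V_obj X) (GC_obj T X) (j_map T X) x)) \<A>)"
    using A by simp
qed

end


section \<open>Full faithfulness\<close>

text \<open>The functions in \<open>C Y\<close> separate points, so the graph of \<open>f\<close> is
  the closed set \<open>R\<close> of pairs on which all of them agree. Preimages of closed sets are
  then projections along the compact space \<open>Y\<close>.\<close>

lemma continuous_map_into_PosComp:
  assumes Y: "Y \<in> PosComp" and f: "f \<in> topspace Z \<rightarrow> sp Y"
    and cont: "\<And>\<psi>. \<psi> \<in> pos_hom Y unit_op \<Longrightarrow> continuous_map Z euclideanreal (\<lambda>z. \<psi> (f z))"
  shows "continuous_map Z (tp Y) f"
  unfolding continuous_map_closedin
proof (intro conjI allI impI f)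
  fix C assume C: "closedin (tp Y) C"
  let ?P = "prod_topology Z (tp Y)"
  define R where "R = {p \<in> topspace ?P. \<forall>\<psi>\<in>pos_hom Y unit_op. \<psi> (f (fst p)) = \<psi> (snd p)}"
  have "closedin ?P R"
    unfolding R_def
    by (intro closedin_Collect_ball closedin_eq_fun
        continuous_map_compose[OF continuous_map_fst cont, unfolded comp_def]
        continuous_map_compose[OF continuous_map_snd C_cont[OF Y], unfolded comp_def])
  then have "closedin Z ((R\<inverse>) `` C)"
    by (rule closedin_relation_Image[OF PosComp_compact[OF Y] closedin_converse C])
  moreover have R: "(z, y) \<in> R \<longleftrightarrow> z \<in> topspace Z \<and> y = f z" for z y
    using f pos_hom_unit_separates[OF Y, of "f z" y] unfolding R_def by auto
  have "(R\<inverse>) `` C = {z \<in> topspace Z. f z \<in> C}" by (auto simp: R)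
  ultimately show "closedin Z {z \<in> topspace Z. f z \<in> C}" by simp
qed

context tnorm begin

lemma C_dist_bij:
  assumes X: "X \<in> PosComp" and Y: "Y \<in> PosComp"
  shows "bij_betw (C_dist X Y) (dist_hom X Y) (lax_hom T (C_obj T Y) (C_obj T X))"
  unfolding bij_betw_def
proof (intro conjI equalityI subsetI)
  show "inj_on (C_dist X Y) (dist_hom X Y)"
  proof (rule inj_onI)
    fix \<phi> \<theta> assume \<phi>: "\<phi> \<in> dist_hom X Y" and \<theta>: "\<theta> \<in> dist_hom X Y" and eq: "C_dist X Y \<phi> = C_dist X Y \<theta>"
    note d = dist_homD[OF ple_subset[OF X] \<phi>] and e = dist_homD[OF ple_subset[OF X] \<theta>]
    have "\<phi> `` {x} = \<theta> `` {x}" if x: "x \<in> sp X" for x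
    proof -
      have s: "sup_on (\<phi> `` {x}) \<psi> = sup_on (\<theta> `` {x}) \<psi>" if \<psi>: "\<psi> \<in> pos_hom Y unit_op" for \<psi>
        using C_dist_apply[OF \<psi> x, of \<phi>] C_dist_apply[OF \<psi> x, of \<theta>] eq by simp
      show ?thesis
        by (intro equalityI sup_on_reflects_subset[OF Y d(2)[OF x] closed_upper_subset[OF e(2)[OF x]]]
            sup_on_reflects_subset[OF Y e(2)[OF x] closed_upper_subset[OF d(2)[OF x]]]) (simp_all add: s)
    qed
    then have "(x, y) \<in> \<phi> \<longleftrightarrow> (x, y) \<in> \<theta>" for x y using d(1) e(1) by blast
    then show "\<phi> = \<theta>" by auto
  qed
next
  fix H assume "H \<in> C_dist X Y ` dist_hom X Y"
  then show "H \<in> lax_hom T (C_obj T Y) (C_obj T X)" using C_dist_lax_hom[OF X Y] by blast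
next
  fix H assume H: "H \<in> lax_hom T (C_obj T Y) (C_obj T X)"
  note CX = C_obj_MonObj[OF X] and CY = C_obj_MonObj[OF Y]
  have Hm: "H \<psi> \<in> pos_hom X unit_op" if "\<psi> \<in> pos_hom Y unit_op" for \<psi> using lax_hom_mem[OF H, of \<psi>] that by simp
  \<comment> \<open>The map from \<open>X\<close> to \<open>V Y\<close> sought is the transpose of
    \<open>H\<close> under the dual adjunction, followed by the inverse of
    \<open>j_map\<close>.\<close>
  let ?g = "G_map T (C_obj T Y) (C_obj T X) H" and ?k = "\<lambda>\<Phi>\<in>sp (G_obj T (C_obj T Y)). zero_set Y \<Phi>"
  let ?F = "\<lambda>x. ?g (ev_space T X x)"
  define \<phi> where "\<phi> = {(x, y). x \<in> sp X \<and> y \<in> zero_set Y (?F x)}"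
  note g = G_map_pos_hom[OF CY CX H] and ev = ev_space_pos_hom[OF X]
  have F: "?F x \<in> lax_hom T (C_obj T Y) (unit_mon T)" if "x \<in> sp X" for x
    using pos_hom_mem[OF g pos_hom_mem[OF ev that]] by simp
  have "compose (sp X) ?k (compose (sp X) ?g (ev_space T X)) \<in> pos_hom X (V_obj Y)"
    by (rule pos_hom_compose[OF pos_hom_compose[OF ev g ple_subset[OF X]] zero_set_pos_hom[OF Y] ple_subset[OF X]])
  moreover have "compose (sp X) ?k (compose (sp X) ?g (ev_space T X)) = (\<lambda>x\<in>sp X. {y. (x, y) \<in> \<phi>})"
    unfolding compose_def by (rule restrict_ext) (simp add: F \<phi>_def)
  moreover have "\<phi> \<subseteq> sp X \<times> sp Y" unfolding \<phi>_def zero_set_def by blast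
  ultimately have \<phi>: "\<phi> \<in> dist_hom X Y" unfolding dist_hom_def by simp
  have "C_dist X Y \<phi> \<psi> = H \<psi>" if \<psi>: "\<psi> \<in> pos_hom Y unit_op" for \<psi>
  proof (rule C_eqI[OF C_dist_mem[OF ple_subset[OF X] Y \<phi> \<psi>] Hm[OF \<psi>]])
    fix x assume x: "x \<in> sp X"
    have "\<phi> `` {x} = zero_set Y (?F x)" using x by (auto simp: \<phi>_def)
    then have "C_dist X Y \<phi> \<psi> x = ?F x \<psi>"
      using C_dist_apply[OF \<psi> x, of \<phi>] functional_eq_sup_on[OF Y F[OF x] \<psi>] by simp
    also have "\<dots> = ev_space T X x (H \<psi>)"
      using pos_hom_mem[OF ev x] \<psi> by (intro G_map_apply) simp_all
    also have "\<dots> = H \<psi> x" using Hm[OF \<psi>] by (simp add: ev_space_apply[OF x])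
    finally show "C_dist X Y \<phi> \<psi> x = H \<psi> x" .
  qed
  then have "C_dist X Y \<phi> = H"
    using lax_hom_ext[OF H] by (intro extensionalityI[of _ "pos_hom Y unit_op"]) (simp_all add: C_dist_def)
  then show "H \<in> C_dist X Y ` dist_hom X Y" using \<phi> by blast
qed

text \<open>If \<open>A\<close> had no least element, then every point of \<open>A\<close> would be a zero of some \<open>\<psi>\<close> with supremum
  \<open>1\<close> on \<open>A\<close>; by compactness a finite product of such functions would be at most \<open>1/2\<close> on \<open>A\<close>.\<close>

lemma multiplicative_sup_on_principal:
  assumes X: "X \<in> PosComp" and A: "A \<in> closed_upper X"
    and one: "sup_on A (\<lambda>x\<in>sp X. 1) = 1"
    and mult: "\<And>\<psi> \<phi>. \<psi> \<in> pos_hom X unit_op \<Longrightarrow> \<phi> \<in> pos_hom X unit_op \<Longrightarrow>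
      sup_on A (\<lambda>x\<in>sp X. T (\<psi> x) (\<phi> x)) = T (sup_on A \<psi>) (sup_on A \<phi>)"
  obtains x where "x \<in> sp X" "A = ple X `` {x}"
proof -
  have "\<exists>x\<in>A. \<forall>a\<in>A. (x, a) \<in> ple X"
  proof (rule ccontr)
    assume no: "\<not> (\<exists>x\<in>A. \<forall>a\<in>A. (x, a) \<in> ple X)"
    define P where "P = {\<psi> \<in> pos_hom X unit_op. sup_on A \<psi> = 1}"
    have "compactin (tp X) A" using PosComp_compact[OF X] closed_upper_closed[OF A] by (rule closedin_compact_space)
    then have "\<exists>\<psi>\<in>P. A \<subseteq> {x \<in> sp X. \<psi> x < 1 / 2}"
    proof (rule compactin_directed_cover)
      \<comment> \<open>Preservation of the unit enters here: for an empty \<open>A\<close> every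
        supremum would be 0 and \<open>P\<close> would be empty.\<close>
      have "(\<lambda>x\<in>sp X. 1) \<in> P" unfolding P_def using C_const[OF X, of 1] one by simp
      then show "P \<noteq> {}" by blast
      show "openin (tp X) {x \<in> sp X. \<psi> x < 1 / 2}" if "\<psi> \<in> P" for \<psi>
        using that unfolding P_def by (intro openin_less_fun) (simp_all add: C_cont[OF X])
      show "\<exists>\<psi>\<in>P. x \<in> {x \<in> sp X. \<psi> x < 1 / 2}" if x: "x \<in> A" for x
      proof -
        obtain a where a: "a \<in> A" "(x, a) \<notin> ple X" using no x by blast
        have sp: "x \<in> sp X" "a \<in> sp X" using x a closed_upper_subset[OF A] by auto
        obtain \<psi> where \<psi>: "\<psi> \<in> pos_hom X unit_op" "\<And>y. y \<in> {y. (x, y) \<in> ple X} \<Longrightarrow> \<psi> y = 0" "\<psi> a = 1"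
          using separating_function[OF X up_closed_upper[OF X sp(1)] sp(2)] a(2) by auto
        note M = C_Pi[OF X \<psi>(1) closed_upper_subset[OF A]]
        have "sup_on A \<psi> = 1" using sup_on_ge[OF M a(1)] sup_on_mem[OF M] \<psi>(3) by simp
        moreover have "\<psi> x = 0" using ple_refl[OF X sp(1)] by (intro \<psi>(2)) simp
        ultimately show ?thesis using \<psi>(1) sp(1) unfolding P_def by (intro bexI[of _ \<psi>]) simp_all
      qed
      show "\<exists>\<tau>\<in>P. {x \<in> sp X. \<psi> x < 1 / 2} \<union> {x \<in> sp X. \<phi> x < 1 / 2} \<subseteq> {x \<in> sp X. \<tau> x < 1 / 2}"
        if "\<psi> \<in> P" "\<phi> \<in> P" for \<psi> \<phi>
      proof (rule bexI[of _ "\<lambda>x\<in>sp X. T (\<psi> x) (\<phi> x)"])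
        have \<psi>: "\<psi> \<in> pos_hom X unit_op" "sup_on A \<psi> = 1" and \<phi>: "\<phi> \<in> pos_hom X unit_op" "sup_on A \<phi> = 1"
          using that unfolding P_def by auto
        show "(\<lambda>x\<in>sp X. T (\<psi> x) (\<phi> x)) \<in> P"
          unfolding P_def using mult[OF \<psi>(1) \<phi>(1)] C_T[OF X \<psi>(1) \<phi>(1)] \<psi>(2) \<phi>(2) T_1_left[of 1] by simp
        have "T (\<psi> x) (\<phi> x) \<le> \<psi> x" "T (\<psi> x) (\<phi> x) \<le> \<phi> x" if "x \<in> sp X" for x
          using T_le_left T_le_right C_mem[OF X \<psi>(1) that] C_mem[OF X \<phi>(1) that] by blast+
        then show "{x \<in> sp X. \<psi> x < 1 / 2} \<union> {x \<in> sp X. \<phi> x < 1 / 2}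
            \<subseteq> {x \<in> sp X. (\<lambda>x\<in>sp X. T (\<psi> x) (\<phi> x)) x < 1 / 2}" by fastforce
      qed
    qed
    then obtain \<psi> where \<psi>: "\<psi> \<in> pos_hom X unit_op" "sup_on A \<psi> = 1" "\<And>x. x \<in> A \<Longrightarrow> \<psi> x < 1 / 2"
      unfolding P_def by blast
    have "sup_on A \<psi> \<le> 1 / 2"
      using sup_on_le_iff[OF C_Pi[OF X \<psi>(1) closed_upper_subset[OF A]], of "1 / 2"] \<psi>(3) by (simp add: less_imp_le)
    then show False using \<psi>(2) by simp
  qed
  then obtain x where x: "x \<in> A" "\<And>a. a \<in> A \<Longrightarrow> (x, a) \<in> ple X" by blast
  then have "A = ple X `` {x}" using closed_upper_upper[OF A] by blast
  then show thesis using that x(1) closed_upper_subset[OF A] by blast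
qed

section \<open>Morphisms that preserve unit and multiplication\<close>

lemma C_map_mon_hom:
  assumes X: "X \<in> PosComp" and Y: "Y \<in> PosComp" and f: "f \<in> pos_hom X Y"
  shows "C_map X Y f \<in> mon_hom T (C_obj T Y) (C_obj T X)"
proof -
  have fm: "f x \<in> sp Y" if "x \<in> sp X" for x using pos_hom_mem[OF f that] .
  have c1: "(\<lambda>x\<in>sp Y. 1) \<in> pos_hom Y unit_op" by (rule C_const[OF Y]) simp
  have "C_map X Y f (\<lambda>x\<in>sp Y. 1) = (\<lambda>x\<in>sp X. 1)"
    using c1 fm by (simp add: C_map_def compose_def cong: restrict_cong)
  moreover have "C_map X Y f (\<lambda>y\<in>sp Y. T (\<psi> y) (\<phi> y)) = (\<lambda>x\<in>sp X. T (C_map X Y f \<psi> x) (C_map X Y f \<phi> x))"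
    if \<psi>: "\<psi> \<in> pos_hom Y unit_op" and \<phi>: "\<phi> \<in> pos_hom Y unit_op" for \<psi> \<phi>
  proof -
    have "C_map X Y f (\<lambda>y\<in>sp Y. T (\<psi> y) (\<phi> y)) = (\<lambda>x\<in>sp X. (\<lambda>y\<in>sp Y. T (\<psi> y) (\<phi> y)) (f x))"
      using C_T[OF Y \<psi> \<phi>] by (simp add: C_map_def compose_def)
    also have "\<dots> = (\<lambda>x\<in>sp X. T (C_map X Y f \<psi> x) (C_map X Y f \<phi> x))"
      by (rule restrict_ext) (simp add: fm C_map_apply \<psi> \<phi>)
    finally show ?thesis .
  qed
  ultimately show ?thesis
    using C_map_lax_hom[OF assms] unfolding lax_hom_def mon_hom_def by simp
qed

lemma mon_hom_subset_lax_hom: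
  assumes "A \<in> MonObj T" "B \<in> MonObj T" shows "mon_hom T A B \<subseteq> lax_hom T A B"
proof
  fix h assume h: "h \<in> mon_hom T A B"
  have "nat_le B b b" if "b \<in> pts B" for b
    using MonObj_ucategory[OF assms(2)] that unfolding ucategory_def nat_le_def by blast
  moreover have "h x \<in> pts B" if "x \<in> pts A" for x
    using h that unfolding mon_hom_def by (auto dest: PiE_mem)
  ultimately show "h \<in> lax_hom T A B"
    using h MonObj_mul[OF assms(2)] unfolding mon_hom_def lax_hom_def by simp
qed

text \<open>For surjectivity, a multiplicative \<open>H\<close> is lax and so comes from a
  distributor. Its sections are principal by \<open>multiplicative_sup_on_principal\<close>, and
  their generators define \<open>f\<close>. Since \<open>\<psi> (f x) = H \<psi> x\<close>,
  continuity of \<open>f\<close> follows from that of the functions \<open>H \<psi>\<close>.\<close>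

lemma C_map_bij:
  assumes X: "X \<in> PosComp" and Y: "Y \<in> PosComp"
  shows "bij_betw (C_map X Y) (pos_hom X Y) (mon_hom T (C_obj T Y) (C_obj T X))"
  unfolding bij_betw_def
proof (intro conjI equalityI subsetI)
  show "inj_on (C_map X Y) (pos_hom X Y)"
  proof (rule inj_onI)
    fix f g assume f: "f \<in> pos_hom X Y" and g: "g \<in> pos_hom X Y" and eq: "C_map X Y f = C_map X Y g"
    have "f x = g x" if x: "x \<in> sp X" for x
    proof (rule pos_hom_unit_separates[OF Y pos_hom_mem[OF f x] pos_hom_mem[OF g x]])
      fix \<psi> assume \<psi>: "\<psi> \<in> pos_hom Y unit_op"
      show "\<psi> (f x) = \<psi> (g x)"
        using C_map_apply[OF \<psi> x, of f] C_map_apply[OF \<psi> x, of g] eq by simp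
    qed
    moreover have "f \<in> extensional (sp X)" "g \<in> extensional (sp X)"
      using f g unfolding pos_hom_def PiE_def by auto
    ultimately show "f = g" by (rule extensionalityI[rotated 2])
  qed
next
  fix H assume "H \<in> C_map X Y ` pos_hom X Y"
  then show "H \<in> mon_hom T (C_obj T Y) (C_obj T X)" using C_map_mon_hom[OF X Y] by blast
next
  fix H assume H: "H \<in> mon_hom T (C_obj T Y) (C_obj T X)"
  then have lax: "H \<in> lax_hom T (C_obj T Y) (C_obj T X)"
    using mon_hom_subset_lax_hom[OF C_obj_MonObj[OF Y] C_obj_MonObj[OF X]] by blast
  then obtain \<phi> where \<phi>: "\<phi> \<in> dist_hom X Y" "H = C_dist X Y \<phi>"
    using C_dist_bij[OF X Y] unfolding bij_betw_def by blast
  note d = dist_homD[OF ple_subset[OF X] \<phi>(1)]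
  have Hm: "H \<psi> \<in> pos_hom X unit_op" if "\<psi> \<in> pos_hom Y unit_op" for \<psi> using lax_hom_mem[OF lax, of \<psi>] that by simp
  have sup: "sup_on (\<phi> `` {x}) \<psi> = H \<psi> x" if "\<psi> \<in> pos_hom Y unit_op" "x \<in> sp X" for \<psi> x
    using C_dist_apply[OF that] \<phi>(2) by simp
  have "\<exists>y\<in>sp Y. \<phi> `` {x} = ple Y `` {y}" if x: "x \<in> sp X" for x
  proof -
    have "sup_on (\<phi> `` {x}) (\<lambda>y\<in>sp Y. 1) = 1"
      using H x sup[OF C_const[OF Y] x, of 1] unfolding mon_hom_def by simp
    moreover have "sup_on (\<phi> `` {x}) (\<lambda>y\<in>sp Y. T (\<psi> y) (\<theta> y)) = T (sup_on (\<phi> `` {x}) \<psi>) (sup_on (\<phi> `` {x}) \<theta>)"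
      if \<psi>: "\<psi> \<in> pos_hom Y unit_op" and \<theta>: "\<theta> \<in> pos_hom Y unit_op" for \<psi> \<theta>
    proof -
      have "H (\<lambda>y\<in>sp Y. T (\<psi> y) (\<theta> y)) = (\<lambda>x\<in>sp X. T (H \<psi> x) (H \<theta> x))"
        using H \<psi> \<theta> unfolding mon_hom_def by simp
      then show ?thesis using sup[OF C_T[OF Y \<psi> \<theta>] x] sup[OF \<psi> x] sup[OF \<theta> x] x by simp
    qed
    ultimately obtain y where "y \<in> sp Y" "\<phi> `` {x} = ple Y `` {y}"
      by (rule multiplicative_sup_on_principal[OF Y d(2)[OF x]])
    then show ?thesis by blast
  qed
  then obtain f0 where f0: "\<And>x. x \<in> sp X \<Longrightarrow> f0 x \<in> sp Y \<and> \<phi> `` {x} = ple Y `` {f0 x}" by metis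
  define f where "f = (\<lambda>x\<in>sp X. f0 x)"
  have f: "f x \<in> sp Y" "\<phi> `` {x} = ple Y `` {f x}" if "x \<in> sp X" for x using f0[OF that] that by (simp_all add: f_def)
  have Hf: "H \<psi> x = \<psi> (f x)" if "\<psi> \<in> pos_hom Y unit_op" "x \<in> sp X" for \<psi> x
    using sup[OF that] f[OF that(2)] sup_on_up[OF Y _ that(1)] by simp
  have "continuous_map (tp X) (tp Y) f"
  proof (rule continuous_map_into_PosComp[OF Y])
    show "f \<in> sp X \<rightarrow> sp Y" using f by blast
    show "continuous_map (tp X) euclideanreal (\<lambda>x. \<psi> (f x))" if "\<psi> \<in> pos_hom Y unit_op" for \<psi>
      by (rule continuous_map_eq[OF C_cont[OF X Hm[OF that]]]) (rule Hf[OF that])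
  qed
  moreover have "(f x, f y) \<in> ple Y" if xy: "(x, y) \<in> ple X" for x y
  proof -
    note p = ple_points[OF X xy]
    have "f y \<in> \<phi> `` {y}" using f[OF p(2)] ple_refl[OF Y] by blast
    then have "f y \<in> \<phi> `` {x}" using d(3)[OF xy] by blast
    then show ?thesis using f(2)[OF p(1)] by blast
  qed
  moreover have "f \<in> sp X \<rightarrow>\<^sub>E sp Y" using f(1) by (simp add: f_def)
  ultimately have fp: "f \<in> pos_hom X Y" unfolding pos_hom_def by blast
  have "C_map X Y f \<psi> = H \<psi>" if \<psi>: "\<psi> \<in> pos_hom Y unit_op" for \<psi>
    by (rule C_eqI[OF C_map_mem[OF X fp \<psi>] Hm[OF \<psi>]]) (simp add: C_map_apply \<psi> Hf)
  then have "C_map X Y f = H"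
    using lax_hom_ext[OF lax] by (intro extensionalityI[of _ "pos_hom Y unit_op"]) (simp_all add: C_map_def)
  then show "H \<in> C_map X Y ` pos_hom X Y" using fp by blast
qed

end


theorem theorem6p18:
  fixes T :: "real \<Rightarrow> real \<Rightarrow> real"
  assumes "continuous_tnorm T"
  shows
    \<comment> \<open>the dualising object\<close>
    "unit_op \<in> PosComp \<and> unit_mon T \<in> MonObj T \<and> sp unit_op = pts (unit_mon T) \<and>

    \<comment> \<open>the functor \<open>C : PosComp \<rightarrow> LaxMon\<^sup>o\<^sup>p\<close>\<close>
     (\<forall>X\<in>PosComp. C_obj T X \<in> MonObj T) \<and>
     (\<forall>X\<in>PosComp. \<forall>Y\<in>PosComp. \<forall>f\<in>pos_hom X Y. C_map X Y f \<in> lax_hom T (C_obj T Y) (C_obj T X)) \<and>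
     (\<forall>X\<in>PosComp. C_map X X (\<lambda>x\<in>sp X. x) = (\<lambda>\<psi>\<in>pts (C_obj T X). \<psi>)) \<and>
     (\<forall>X\<in>PosComp. \<forall>Y\<in>PosComp. \<forall>Z\<in>PosComp. \<forall>f\<in>pos_hom X Y. \<forall>g\<in>pos_hom Y Z.
        C_map X Z (compose (sp X) g f) = compose (pts (C_obj T Z)) (C_map X Y f) (C_map Y Z g)) \<and>

    \<comment> \<open>the colimits of \<open>C X\<close> are pointwise\<close>
     (\<forall>X\<in>PosComp. is_bottom (C_obj T X) (\<lambda>x\<in>sp X. 0)) \<and>
     (\<forall>X\<in>PosComp. \<forall>\<psi>\<in>pts (C_obj T X). \<forall>\<phi>\<in>pts (C_obj T X).
        is_binary_sup (C_obj T X) \<psi> \<phi> (\<lambda>x\<in>sp X. max (\<psi> x) (\<phi> x))) \<and>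
     (\<forall>X\<in>PosComp. \<forall>\<psi>\<in>pts (C_obj T X). \<forall>u\<in>{0..1}.
        is_copower T (C_obj T X) \<psi> u (\<lambda>x\<in>sp X. T (\<psi> x) u)) \<and>

    \<comment> \<open>the functor \<open>G : LaxMon\<^sup>o\<^sup>p \<rightarrow> PosComp\<close>\<close>
     (\<forall>A\<in>MonObj T. G_obj T A \<in> PosComp) \<and>
     (\<forall>A\<in>MonObj T. \<forall>B\<in>MonObj T. \<forall>h\<in>lax_hom T A B. G_map T A B h \<in> pos_hom (G_obj T B) (G_obj T A)) \<and>
     (\<forall>A\<in>MonObj T. G_map T A A (\<lambda>a\<in>pts A. a) = (\<lambda>\<Phi>\<in>sp (G_obj T A). \<Phi>)) \<and>
     (\<forall>A\<in>MonObj T. \<forall>B\<in>MonObj T. \<forall>D\<in>MonObj T. \<forall>h\<in>lax_hom T A B. \<forall>k\<in>lax_hom T B D.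
        G_map T A D (compose (pts A) k h) = compose (sp (G_obj T D)) (G_map T A B h) (G_map T B D k)) \<and>

    \<comment> \<open>the dual adjunction: the evaluation maps are natural and satisfy the triangle identities\<close>
     (\<forall>X\<in>PosComp. ev_space T X \<in> pos_hom X (G_obj T (C_obj T X))) \<and>
     (\<forall>X\<in>PosComp. \<forall>Y\<in>PosComp. \<forall>f\<in>pos_hom X Y.
        compose (sp X) (ev_space T Y) f
          = compose (sp X) (G_map T (C_obj T Y) (C_obj T X) (C_map X Y f)) (ev_space T X)) \<and>
     (\<forall>A\<in>MonObj T. ev_mon T A \<in> lax_hom T A (C_obj T (G_obj T A))) \<and>
     (\<forall>A\<in>MonObj T. \<forall>B\<in>MonObj T. \<forall>h\<in>lax_hom T A B.
        compose (pts A) (ev_mon T B) h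
          = compose (pts A) (C_map (G_obj T B) (G_obj T A) (G_map T A B h)) (ev_mon T A)) \<and>
     (\<forall>X\<in>PosComp.
        compose (pts (C_obj T X)) (C_map X (G_obj T (C_obj T X)) (ev_space T X)) (ev_mon T (C_obj T X))
          = (\<lambda>\<psi>\<in>pts (C_obj T X). \<psi>)) \<and>
     (\<forall>A\<in>MonObj T.
        compose (sp (G_obj T A)) (G_map T A (C_obj T (G_obj T A)) (ev_mon T A)) (ev_space T (G_obj T A))
          = (\<lambda>\<Phi>\<in>sp (G_obj T A). \<Phi>)) \<and>

    \<comment> \<open>the extension \<open>C : PosCompDist \<rightarrow> LaxMon\<^sup>o\<^sup>p\<close>\<close>
     (\<forall>X\<in>PosComp. \<forall>Y\<in>PosComp. \<forall>\<phi>\<in>dist_hom X Y. C_dist X Y \<phi> \<in> lax_hom T (C_obj T Y) (C_obj T X)) \<and>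
     (\<forall>X\<in>PosComp. ple X \<in> dist_hom X X \<and> C_dist X X (ple X) = (\<lambda>\<psi>\<in>pts (C_obj T X). \<psi>)) \<and>
     (\<forall>X\<in>PosComp. \<forall>Y\<in>PosComp. \<forall>Z\<in>PosComp. \<forall>\<phi>\<in>dist_hom X Y. \<forall>\<theta>\<in>dist_hom Y Z.
        \<phi> O \<theta> \<in> dist_hom X Z \<and>
        C_dist X Z (\<phi> O \<theta>) = compose (pts (C_obj T Z)) (C_dist X Y \<phi>) (C_dist Y Z \<theta>)) \<and>
     (\<forall>X\<in>PosComp. \<forall>Y\<in>PosComp. \<forall>f\<in>pos_hom X Y.
        dist_of X Y f \<in> dist_hom X Y \<and> C_dist X Y (dist_of X Y f) = C_map X Y f) \<and>

    \<comment> \<open>the induced monad morphism \<open>j\<close> and its components; it is an isomorphism\<close>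
     (\<forall>X\<in>PosComp. V_obj X \<in> PosComp \<and> V_counit X \<in> dist_hom (V_obj X) X) \<and>
     (\<forall>X\<in>PosComp. j_map T X
        = (\<lambda>A\<in>closed_upper X. \<lambda>\<psi>\<in>pts (C_obj T X). sup01 {\<psi> x | x. x \<in> A})) \<and>
     (\<forall>X\<in>PosComp. j_map T X \<in> pos_hom (V_obj X) (GC_obj T X)) \<and>
     (\<forall>X\<in>PosComp. \<forall>Y\<in>PosComp. \<forall>f\<in>pos_hom X Y.
        compose (sp (V_obj X)) (j_map T Y) (V_map X Y f)
          = compose (sp (V_obj X)) (GC_map T X Y f) (j_map T X)) \<and>
     (\<forall>X\<in>PosComp. compose (sp X) (j_map T X) (V_unit X) = ev_space T X) \<and>
     (\<forall>X\<in>PosComp.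
        compose (sp (V_obj (V_obj X))) (j_map T X) (V_mult X)
          = compose (sp (V_obj (V_obj X))) (GC_mult T X)
              (compose (sp (V_obj (V_obj X))) (j_map T (GC_obj T X))
                 (V_map (V_obj X) (GC_obj T X) (j_map T X)))) \<and>
     (\<forall>X\<in>PosComp. is_pos_iso (V_obj X) (GC_obj T X) (j_map T X)) \<and>

    \<comment> \<open>\<open>C : PosCompDist \<rightarrow> LaxMon\<^sup>o\<^sup>p\<close> is fully faithful\<close>
     (\<forall>X\<in>PosComp. \<forall>Y\<in>PosComp.
        bij_betw (C_dist X Y) (dist_hom X Y) (lax_hom T (C_obj T Y) (C_obj T X))) \<and>

    \<comment> \<open>\<open>C : PosComp \<rightarrow> Mon\<^sup>o\<^sup>p\<close> is a fully faithful functor\<close>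
     (\<forall>X\<in>PosComp. \<forall>Y\<in>PosComp. \<forall>f\<in>pos_hom X Y. C_map X Y f \<in> mon_hom T (C_obj T Y) (C_obj T X)) \<and>
     (\<forall>X\<in>PosComp. \<forall>Y\<in>PosComp.
        bij_betw (C_map X Y) (pos_hom X Y) (mon_hom T (C_obj T Y) (C_obj T X)))"
proof -
  interpret tnorm T by unfold_locales (fact assms)
  have sp: "sp unit_op = pts (unit_mon T)" by simp
  show ?thesis
    unfolding pts_C
    by (intro conjI ballI;
      (rule unit_op_PosComp unit_mon_MonObj sp
        C_obj_MonObj C_map_lax_hom C_map_id[unfolded pts_C] C_map_compose[unfolded pts_C]
        C_bottom C_binary_sup C_is_copower
        G_obj_PosComp G_map_pos_hom G_map_id G_map_compose
        ev_space_pos_hom ev_space_natural ev_mon_lax_hom ev_mon_natural triangle_C[unfolded pts_C] triangle_G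
        C_dist_lax_hom ple_dist_hom C_dist_ple dist_hom_comp C_dist_comp dist_of_dist_hom C_dist_dist_of
        V_obj_PosComp V_counit_dist_hom j_map_eq[unfolded pts_C] j_map_pos_hom j_map_natural j_map_unit
        j_map_mult j_map_iso C_dist_bij C_map_mon_hom C_map_bij; assumption))
qed

end
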